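(* There exist an integer $n_0\ge 1$, a set $\mathcal{M}\subset\mathbb{R}^{n_0}$, a hypersurface $S$ with associated partition $\mathrm{Int}(\mathcal{M})\setminus S=\Omega_-\cup\Omega_+$, and a coefficient $c$ (all as described in the context) for which there exist sequences $(\lambda_n)_{n\in\mathbb{N}}$ of real numbers and $(u_n)_{n\in\mathbb{N}}$ of functions in the domain $\mathcal{A}$ of $-\Delta_c$, with $\lambda_n\to+\infty$ and with each $u_n$ satisfying the transmission conditions $$(u_n|_{\Omega_-})|_S=(u_n|_{\Omega_+})|_S\quad\text{and}\quad c_-\,\partial_\nu(u_n|_{\Omega_-})|_S=c_+\,\partial_\nu(u_n|_{\Omega_+})|_S,$$ such that for every measurable $\omega\subset\mathcal{M}$ with $\mathrm{dist}(\overline{\omega},S)>0$ there exist constants $C,d>0$ such that, for all $n\in\mathbb{N}$, $$\|u_n\|_{L^2(\omega)}\le Ce^{-d\sqrt{\lambda_n}},\qquad -\Delta_c u_n=\lambda_n u_n,\qquad \|u_n\|_{L^2(\mathcal{M})}=1.$$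
   Context: $\mathcal{M}$ is a compact, connected subset of a Euclidean space with smooth boundary $\partial\mathcal{M}$, and $S\subset\mathrm{Int}(\mathcal{M})$ is a (nonempty) smooth hypersurface such that $\mathrm{Int}(\mathcal{M})\setminus S=\Omega_-\cup\Omega_+$ with $\Omega_-\cap\Omega_+=\emptyset$, $\Omega_\pm$ open. The coefficient $c=\mathbf{1}_{\Omega_-}c_-+\mathbf{1}_{\Omega_+}c_+$ is strictly positive and piecewise smooth ($c_\pm$ smooth up to $S$) and has a jump across the interface $S$. $\nu$ is the unit normal vector field to $S$ pointing into $\Omega_+$. The operator is $-\Delta_c:=-\mathrm{div}(c\nabla\,\cdot)$, with domain $$\mathcal{A}=\{u\in H^1_0(\mathcal{M}) : u|_{\Omega_-}\in H^2(\Omega_-),\ u|_{\Omega_+}\in H^2(\Omega_+),\ c_-\partial_\nu(u|_{\Omega_-})|_S=c_+\partial_\nu(u|_{\Omega_+})|_S\},$$ on which it is self-adjoint in $L^2(\mathcal{M})$. *)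

theory Defs
  imports "HOL-Analysis.Analysis"
begin

text \<open>
  The dimension is existentially quantified in the theorem, so \<open>\<real>\<^sup>n\<close> is the library's
  \<^const>\<open>Euclidean_space\<close> \<open>n\<close>: the sequences \<open>x :: nat \<Rightarrow> real\<close> with \<open>x i = 0\<close> for \<open>i \<ge> n\<close>.
  The metric of the type \<^typ>\<open>nat \<Rightarrow> real\<close> is not the Euclidean one and is never used.
\<close>

type_synonym pt = "nat \<Rightarrow> real"

abbreviation Rn :: "nat \<Rightarrow> pt set" where
  "Rn n \<equiv> topspace (Euclidean_space n)"

definition edist :: "nat \<Rightarrow> pt \<Rightarrow> pt \<Rightarrow> real" where
  "edist n x y = L2_set (\<lambda>i. x i - y i) {..<n}"

text \<open>The values are extended so that the distance to the empty set is \<open>\<infinity>\<close>.\<close>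

definition eset_dist :: "nat \<Rightarrow> pt set \<Rightarrow> pt set \<Rightarrow> ennreal" where
  "eset_dist n A B = (INF x\<in>A. INF y\<in>B. ennreal (edist n x y))"

definition ediam :: "nat \<Rightarrow> pt set \<Rightarrow> ennreal" where
  "ediam n A = (SUP x\<in>A. SUP y\<in>A. ennreal (edist n x y))"


section \<open>Lebesgue measure and surface measure\<close>

text \<open>Lebesgue measure of \<open>\<real>\<^sup>n\<close> on the Lebesgue measurable sets; as a measure on all of
  \<^typ>\<open>nat \<Rightarrow> real\<close> it is carried by \<open>Rn n\<close>.\<close>

definition leb :: "nat \<Rightarrow> pt measure" where
  "leb n = completion
     (distr (\<Pi>\<^sub>M i\<in>{..<n}. (lborel :: real measure)) borel (\<lambda>x i. if i < n then x i else 0))"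

definition hausdorff_pre :: "nat \<Rightarrow> nat \<Rightarrow> real \<Rightarrow> pt set \<Rightarrow> ennreal" where
  "hausdorff_pre n s \<delta> A =
     (INF B\<in>{B :: nat \<Rightarrow> pt set. A \<subseteq> (\<Union>k. B k) \<and> (\<forall>k. ediam n (B k) \<le> ennreal \<delta>)}.
        (\<Sum>k. if B k = {} then 0
             else ennreal (unit_ball_vol (real s) / 2 ^ s) * ediam n (B k) ^ s))"

definition hausdorff :: "nat \<Rightarrow> nat \<Rightarrow> pt set \<Rightarrow> ennreal" where
  "hausdorff n s A = (SUP \<delta>\<in>{0<..}. hausdorff_pre n s \<delta> A)"

text \<open>The surface measure of a hypersurface of \<open>\<real>\<^sup>n\<close> is the \<open>(n-1)\<close>-dimensional Hausdorff measure
  on its Borel subsets.\<close>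

definition surface_measure :: "nat \<Rightarrow> pt set \<Rightarrow> pt measure" where
  "surface_measure n S = measure_of S {A \<in> sets borel. A \<subseteq> S} (hausdorff n (n - 1))"


section \<open>Smooth functions, domains and hypersurfaces\<close>

definition partial :: "nat \<Rightarrow> (pt \<Rightarrow> real) \<Rightarrow> pt \<Rightarrow> real" where
  "partial i f x = deriv (\<lambda>t. f (x(i := t))) (x i)"

fun partials :: "nat list \<Rightarrow> (pt \<Rightarrow> real) \<Rightarrow> pt \<Rightarrow> real" where
  "partials [] f = f"
| "partials (i # js) f = partial i (partials js f)"

definition smooth_on :: "nat \<Rightarrow> pt set \<Rightarrow> (pt \<Rightarrow> real) \<Rightarrow> bool" where
  "smooth_on n W f \<longleftrightarrow> openin (Euclidean_space n) W \<and>
     (\<forall>js\<in>lists {..<n}.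
        continuous_map (subtopology (Euclidean_space n) W) euclideanreal (partials js f) \<and>
        (\<forall>x\<in>W. \<forall>i<n. (\<lambda>t. partials js f (x(i := t))) differentiable (at (x i))))"

text \<open>Smooth up to the boundary: \<open>f\<close> itself is required to be a smooth extension, hence its values
  on the boundary are the boundary values.\<close>

definition smooth_up_to_boundary :: "nat \<Rightarrow> pt set \<Rightarrow> (pt \<Rightarrow> real) \<Rightarrow> bool" where
  "smooth_up_to_boundary n \<Omega> f \<longleftrightarrow>
     (\<exists>W. Euclidean_space n closure_of \<Omega> \<subseteq> W \<and> smooth_on n W f)"

definition regular_function :: "nat \<Rightarrow> pt set \<Rightarrow> (pt \<Rightarrow> real) \<Rightarrow> bool" where
  "regular_function n U \<rho> \<longleftrightarrow> smooth_on n U \<rho> \<and> (\<forall>x\<in>U. \<exists>i<n. partial i \<rho> x \<noteq> 0)"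

definition has_smooth_boundary :: "nat \<Rightarrow> pt set \<Rightarrow> bool" where
  "has_smooth_boundary n M \<longleftrightarrow>
     (\<forall>p \<in> Euclidean_space n frontier_of M.
        \<exists>U \<rho>. p \<in> U \<and> regular_function n U \<rho> \<and> M \<inter> U = {x \<in> U. \<rho> x \<le> 0})"

definition local_equation :: "nat \<Rightarrow> pt set \<Rightarrow> pt \<Rightarrow> pt set \<Rightarrow> (pt \<Rightarrow> real) \<Rightarrow> bool" where
  "local_equation n S p U \<rho> \<longleftrightarrow> p \<in> U \<and> regular_function n U \<rho> \<and> S \<inter> U = {x \<in> U. \<rho> x = 0}"

definition smooth_hypersurface :: "nat \<Rightarrow> pt set \<Rightarrow> bool" where
  "smooth_hypersurface n S \<longleftrightarrow> S \<subseteq> Rn n \<and> (\<forall>p\<in>S. \<exists>U \<rho>. local_equation n S p U \<rho>)"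

text \<open>The normal line of \<open>S\<close> at \<open>p\<close> is spanned by the gradient of any local equation.\<close>

definition unit_normal_field :: "nat \<Rightarrow> pt set \<Rightarrow> (pt \<Rightarrow> pt) \<Rightarrow> bool" where
  "unit_normal_field n S \<nu> \<longleftrightarrow>
     (\<forall>p\<in>S. \<nu> p \<in> Rn n \<and> L2_set (\<nu> p) {..<n} = 1 \<and>
        (\<exists>U \<rho> a. local_equation n S p U \<rho> \<and> (\<forall>i<n. \<nu> p i = a * partial i \<rho> p)))"

text \<open>\<open>S\<close> is an interface: at each of its points, \<open>\<nu>\<close> points into \<open>\<Omega>p\<close> and \<open>-\<nu>\<close> into \<open>\<Omega>m\<close>.\<close>

definition normal_from_to :: "pt set \<Rightarrow> (pt \<Rightarrow> pt) \<Rightarrow> pt set \<Rightarrow> pt set \<Rightarrow> bool" where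
  "normal_from_to S \<nu> \<Omega>m \<Omega>p \<longleftrightarrow>
     (\<forall>p\<in>S. \<exists>\<epsilon>>0. \<forall>t\<in>{0<..<\<epsilon>}.
        (\<lambda>i. p i + t * \<nu> p i) \<in> \<Omega>p \<and> (\<lambda>i. p i - t * \<nu> p i) \<in> \<Omega>m)"


section \<open>Sobolev spaces and traces\<close>

definition L2_on :: "nat \<Rightarrow> pt set \<Rightarrow> (pt \<Rightarrow> real) \<Rightarrow> bool" where
  "L2_on n A u \<longleftrightarrow>
     set_borel_measurable (leb n) A u \<and> set_integrable (leb n) A (\<lambda>x. (u x)\<^sup>2)"

definition L2_norm :: "nat \<Rightarrow> pt set \<Rightarrow> (pt \<Rightarrow> real) \<Rightarrow> real" where
  "L2_norm n A u = sqrt (LINT x:A|leb n. (u x)\<^sup>2)"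

definition test_function :: "nat \<Rightarrow> pt set \<Rightarrow> (pt \<Rightarrow> real) \<Rightarrow> bool" where
  "test_function n \<Omega> \<phi> \<longleftrightarrow> smooth_on n (Rn n) \<phi> \<and>
     (\<exists>K\<subseteq>\<Omega>. compactin (Euclidean_space n) K \<and> (\<forall>x \<in> Rn n - K. \<phi> x = 0))"

text \<open>\<open>G i\<close> is the weak derivative of \<open>u\<close> in the direction \<open>i\<close>, and it is square integrable.\<close>

definition has_weak_gradient :: "nat \<Rightarrow> pt set \<Rightarrow> (pt \<Rightarrow> real) \<Rightarrow> (nat \<Rightarrow> pt \<Rightarrow> real) \<Rightarrow> bool" where
  "has_weak_gradient n \<Omega> u G \<longleftrightarrow>
     (\<forall>i<n. L2_on n \<Omega> (G i) \<and>
        (\<forall>\<phi>. test_function n \<Omega> \<phi> \<longrightarrow>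
           (LINT x:\<Omega>|leb n. u x * partial i \<phi> x) = - (LINT x:\<Omega>|leb n. G i x * \<phi> x)))"

definition has_weak_divergence :: "nat \<Rightarrow> pt set \<Rightarrow> (nat \<Rightarrow> pt \<Rightarrow> real) \<Rightarrow> (pt \<Rightarrow> real) \<Rightarrow> bool" where
  "has_weak_divergence n \<Omega> F h \<longleftrightarrow>
     (\<forall>\<phi>. test_function n \<Omega> \<phi> \<longrightarrow>
        (\<Sum>i<n. LINT x:\<Omega>|leb n. F i x * partial i \<phi> x) = - (LINT x:\<Omega>|leb n. h x * \<phi> x))"

definition H1 :: "nat \<Rightarrow> pt set \<Rightarrow> (pt \<Rightarrow> real) \<Rightarrow> bool" where
  "H1 n \<Omega> u \<longleftrightarrow> L2_on n \<Omega> u \<and> (\<exists>G. has_weak_gradient n \<Omega> u G)"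

definition H2 :: "nat \<Rightarrow> pt set \<Rightarrow> (pt \<Rightarrow> real) \<Rightarrow> bool" where
  "H2 n \<Omega> u \<longleftrightarrow> L2_on n \<Omega> u \<and> (\<exists>G. has_weak_gradient n \<Omega> u G \<and> (\<forall>i<n. H1 n \<Omega> (G i)))"

definition H1_approximates :: "nat \<Rightarrow> pt set \<Rightarrow> (nat \<Rightarrow> pt \<Rightarrow> real) \<Rightarrow> (pt \<Rightarrow> real) \<Rightarrow> bool" where
  "H1_approximates n \<Omega> \<phi> u \<longleftrightarrow>
     (\<lambda>k. L2_norm n \<Omega> (\<lambda>x. \<phi> k x - u x)) \<longlonglongrightarrow> 0 \<and>
     (\<exists>G. has_weak_gradient n \<Omega> u G \<and>
        (\<forall>i<n. (\<lambda>k. L2_norm n \<Omega> (\<lambda>x. partial i (\<phi> k) x - G i x)) \<longlonglongrightarrow> 0))"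

text \<open>\<open>H\<^sup>1\<^sub>0\<close> is the closure of the test functions in \<open>H\<^sup>1\<close>.\<close>

definition H10 :: "nat \<Rightarrow> pt set \<Rightarrow> (pt \<Rightarrow> real) \<Rightarrow> bool" where
  "H10 n \<Omega> u \<longleftrightarrow> H1 n \<Omega> u \<and>
     (\<exists>\<phi>. (\<forall>k. test_function n \<Omega> (\<phi> k)) \<and> H1_approximates n \<Omega> \<phi> u)"

text \<open>The trace on \<open>S \<subseteq> \<partial>\<Omega>\<close> is the continuous extension to \<open>H\<^sup>1(\<Omega>)\<close>, with values in \<open>L\<^sup>2(S)\<close>, of the
  restriction map defined on functions smooth up to the boundary. It is a relation because
  \<open>g\<close> is only determined almost everywhere.\<close>

definition has_trace :: "nat \<Rightarrow> pt set \<Rightarrow> pt set \<Rightarrow> (pt \<Rightarrow> real) \<Rightarrow> (pt \<Rightarrow> real) \<Rightarrow> bool" where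
  "has_trace n \<Omega> S u g \<longleftrightarrow> H1 n \<Omega> u \<and> g \<in> borel_measurable (surface_measure n S) \<and>
     (\<exists>\<phi>. (\<forall>k. smooth_up_to_boundary n \<Omega> (\<phi> k)) \<and> H1_approximates n \<Omega> \<phi> u \<and>
        (\<lambda>k. \<integral>\<^sup>+x. ennreal ((\<phi> k x - g x)\<^sup>2) \<partial>surface_measure n S) \<longlonglongrightarrow> 0)"

definition has_normal_trace ::
    "nat \<Rightarrow> pt set \<Rightarrow> pt set \<Rightarrow> (pt \<Rightarrow> pt) \<Rightarrow> (pt \<Rightarrow> real) \<Rightarrow> (pt \<Rightarrow> real) \<Rightarrow> bool" where
  "has_normal_trace n \<Omega> S \<nu> u h \<longleftrightarrow>
     (\<exists>G \<gamma>. has_weak_gradient n \<Omega> u G \<and> (\<forall>i<n. has_trace n \<Omega> S (G i) (\<gamma> i)) \<and>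
        (\<forall>x\<in>S. h x = (\<Sum>i<n. \<nu> x i * \<gamma> i x)))"


section \<open>The transmission problem\<close>

definition pw_coeff :: "pt set \<Rightarrow> pt set \<Rightarrow> (pt \<Rightarrow> real) \<Rightarrow> (pt \<Rightarrow> real) \<Rightarrow> pt \<Rightarrow> real" where
  "pw_coeff \<Omega>m \<Omega>p cm cp x = indicator \<Omega>m x * cm x + indicator \<Omega>p x * cp x"

definition transmission_geometry ::
    "nat \<Rightarrow> pt set \<Rightarrow> pt set \<Rightarrow> pt set \<Rightarrow> pt set \<Rightarrow> (pt \<Rightarrow> pt) \<Rightarrow> bool" where
  "transmission_geometry n M S \<Omega>m \<Omega>p \<nu> \<longleftrightarrow>
     compactin (Euclidean_space n) M \<and> connectedin (Euclidean_space n) M \<and>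
     has_smooth_boundary n M \<and>
     S \<noteq> {} \<and> S \<subseteq> Euclidean_space n interior_of M \<and>
     compactin (Euclidean_space n) S \<and> smooth_hypersurface n S \<and>
     openin (Euclidean_space n) \<Omega>m \<and> openin (Euclidean_space n) \<Omega>p \<and> \<Omega>m \<inter> \<Omega>p = {} \<and>
     Euclidean_space n interior_of M - S = \<Omega>m \<union> \<Omega>p \<and>
     unit_normal_field n S \<nu> \<and> normal_from_to S \<nu> \<Omega>m \<Omega>p"

text \<open>Positivity up to the boundary, so that the operator is uniformly elliptic.\<close>

definition transmission_coefficient ::
    "nat \<Rightarrow> pt set \<Rightarrow> pt set \<Rightarrow> pt set \<Rightarrow> (pt \<Rightarrow> real) \<Rightarrow> (pt \<Rightarrow> real) \<Rightarrow> bool" where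
  "transmission_coefficient n S \<Omega>m \<Omega>p cm cp \<longleftrightarrow>
     smooth_up_to_boundary n \<Omega>m cm \<and> smooth_up_to_boundary n \<Omega>p cp \<and>
     (\<forall>x \<in> Euclidean_space n closure_of \<Omega>m. cm x > 0) \<and>
     (\<forall>x \<in> Euclidean_space n closure_of \<Omega>p. cp x > 0) \<and>
     (\<forall>x\<in>S. cm x \<noteq> cp x)"

definition continuity_condition ::
    "nat \<Rightarrow> pt set \<Rightarrow> pt set \<Rightarrow> pt set \<Rightarrow> (pt \<Rightarrow> real) \<Rightarrow> bool" where
  "continuity_condition n S \<Omega>m \<Omega>p u \<longleftrightarrow>
     (\<exists>gm gp. has_trace n \<Omega>m S u gm \<and> has_trace n \<Omega>p S u gp \<and>
        (AE x in surface_measure n S. gm x = gp x))"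

definition flux_condition ::
    "nat \<Rightarrow> pt set \<Rightarrow> pt set \<Rightarrow> pt set \<Rightarrow> (pt \<Rightarrow> pt) \<Rightarrow> (pt \<Rightarrow> real) \<Rightarrow> (pt \<Rightarrow> real) \<Rightarrow>
     (pt \<Rightarrow> real) \<Rightarrow> bool" where
  "flux_condition n S \<Omega>m \<Omega>p \<nu> cm cp u \<longleftrightarrow>
     (\<exists>hm hp. has_normal_trace n \<Omega>m S \<nu> u hm \<and> has_normal_trace n \<Omega>p S \<nu> u hp \<and>
        (AE x in surface_measure n S. cm x * hm x = cp x * hp x))"

definition operator_domain ::
    "nat \<Rightarrow> pt set \<Rightarrow> pt set \<Rightarrow> pt set \<Rightarrow> pt set \<Rightarrow> (pt \<Rightarrow> pt) \<Rightarrow> (pt \<Rightarrow> real) \<Rightarrow> (pt \<Rightarrow> real) \<Rightarrow>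
     (pt \<Rightarrow> real) set" where
  "operator_domain n M S \<Omega>m \<Omega>p \<nu> cm cp =
     {u. H10 n (Euclidean_space n interior_of M) u \<and> H2 n \<Omega>m u \<and> H2 n \<Omega>p u \<and>
         flux_condition n S \<Omega>m \<Omega>p \<nu> cm cp u}"

text \<open>\<open>-div(c \<nabla>u) = f\<close> in the sense of distributions on \<open>\<Omega>\<close>, for \<open>u \<in> H\<^sup>1(\<Omega>)\<close> and
  \<open>f \<in> L\<^sup>2(\<Omega>)\<close>.\<close>

definition minus_Delta_eq ::
    "nat \<Rightarrow> pt set \<Rightarrow> (pt \<Rightarrow> real) \<Rightarrow> (pt \<Rightarrow> real) \<Rightarrow> (pt \<Rightarrow> real) \<Rightarrow> bool" where
  "minus_Delta_eq n \<Omega> c u f \<longleftrightarrow> H1 n \<Omega> u \<and> L2_on n \<Omega> f \<and>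
     (\<exists>G. has_weak_gradient n \<Omega> u G \<and>
        has_weak_divergence n \<Omega> (\<lambda>i x. c x * G i x) (\<lambda>x. - f x))"

end

theory Submission
  imports Defs
begin

text \<open>
  Whispering gallery modes in the disk of radius 2 with interface the unit circle, \<open>c = 1\<close> inside and
  \<open>c = 4 r\<^sup>2\<close> outside. The mode \<open>u = \<Gamma>(r\<^sup>2) Re (z\<^sup>k)\<close> is a Bessel function \<open>J\<^sub>k (sqrt \<lambda> r)\<close> times \<open>cos (k \<theta>)\<close>
  inside and \<open>r\<^sup>-\<^sup>1 sinh (\<kappa> (ln 2 - ln r)) cos (k \<theta>)\<close> outside, where \<open>\<kappa>\<^sup>2 = k\<^sup>2 + 1 - \<lambda>/4\<close>.
  Between \<open>\<lambda> = k\<^sup>2\<close> and the square of the first zero of \<open>J\<^sub>k\<close> the flux condition is met by the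
  intermediate value theorem, and Sturm comparison shows that this zero is at most \<open>k (1 + o(1))\<close>. Hence the
  region where \<open>\<lambda> r\<^sup>2 / c > k\<^sup>2\<close>, where \<open>u\<close> oscillates, shrinks to the circle, and away from it \<open>u\<close> gains
  a factor \<open>exp (- \<delta> k)\<close> under a fixed dilation towards the circle. As dilations preserve angles and scale
  Lebesgue measure, this gives the decay of the \<open>L\<^sup>2\<close> norms.
\<close>

section \<open>Smooth functions on open subsets of Euclidean space\<close>

text \<open>The coefficient 4 r^2 turns separation of variables on the annulus into an Euler
  equation, r^2 w'' + 3 r w' = (k^2 - \<lambda>/4) w, solved by powers of r; a constant coefficient
  would bring in modified Bessel functions. Its value 4 on the circle separates the two sides: as
  k^2 < \<lambda> \<le> 3/2 k^2, a mode can oscillate just inside the circle, while k^2 -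
  \<lambda>/4 \<ge> 5/8 k^2 forces decay outside. Profiles are functions of s = r^2 multiplied by Re
  (z^k). Smoothness at the origin is then automatic and no polar change of variables occurs, only
  derivatives along the axes, integrals along lines and dilations. Each half of a mode is the
  restriction of a function smooth across the circle, so its traces are plain restrictions. The
  delicate points are membership in \<open>H10\<close>, where the kink on the circle has to be
  smoothed, and the weak equation across the circle, where line integrals take the place of a Gauss
  formula. Comparing u at x with u at a dilated point cancels both the angular factor and the
  normalisation, so that decay becomes a statement about one radial profile.\<close>

lemma Rn_iff: "x \<in> Rn n \<longleftrightarrow> (\<forall>i\<ge>n. x i = 0)"
  by (simp add: topspace_Euclidean_space)

lemma Euclidean_space_top_of_set: "Euclidean_space n = top_of_set {x. \<forall>i\<ge>n. x i = 0}"
  by (simp add: Euclidean_space_def euclidean_product_topology)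

lemma upd_in_Rn: "x \<in> Rn n \<Longrightarrow> i < n \<Longrightarrow> x(i := t) \<in> Rn n"
  by (auto simp: Rn_iff)

lemma closed_Rn: "closed (Rn n)"
  using closedin_Euclidean_space_iff closedin_topspace by blast

lemma openin_Rn_subset: "openin (Euclidean_space n) W \<Longrightarrow> W \<subseteq> Rn n"
  by (rule openin_subset)

lemma openin_Rn_iff: "openin (Euclidean_space n) W \<longleftrightarrow> (\<exists>T. open T \<and> W = Rn n \<inter> T)"
  by (simp add: Euclidean_space_top_of_set openin_open)

lemma compactin_Rn_iff: "compactin (Euclidean_space n) K \<longleftrightarrow> compact K \<and> K \<subseteq> Rn n"
  by (simp add: Euclidean_space_top_of_set compactin_subtopology)

lemma continuous_map_Rn:
  "W \<subseteq> Rn n \<Longrightarrow> continuous_map (subtopology (Euclidean_space n) W) euclideanreal f \<longleftrightarrow> continuous_on W f"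
  by (simp add: Euclidean_space_top_of_set subtopology_subtopology inf.absorb2)

lemma continuous_on_upd: "continuous_on UNIV (\<lambda>t. (x :: pt)(i := t))"
proof (rule continuous_on_coordinatewise_then_product)
  fix j show "continuous_on UNIV (\<lambda>t. (x(i := t)) j)" by (cases "j = i") auto
qed

lemma continuous_on_coord: "continuous_on A (\<lambda>x :: pt. x i)"
  by (rule continuous_on_subset[OF continuous_on_product_coordinates subset_UNIV])

lemma open_line:
  assumes "openin (Euclidean_space n) W" "i < n" "x \<in> Rn n"
  shows "open {t. x(i := t) \<in> W}"
proof -
  from assms(1) obtain T where T: "open T" "W = Rn n \<inter> T"
    unfolding openin_Rn_iff by blast
  have "{t. x(i := t) \<in> W} = (\<lambda>t. x(i := t)) -` T"
    using T upd_in_Rn[OF assms(3,2)] by auto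
  thus ?thesis using open_vimage[OF T(1) continuous_on_upd] by simp
qed

text \<open>\<open>partial\<close> is a \<open>deriv\<close>, whose value means nothing where the
  derivative does not exist. This relation carries existence along, so derivatives are computed with
  it and converted by \<open>has_partial_imp_partial\<close> at the end.\<close>

definition has_partial :: "pt set \<Rightarrow> nat \<Rightarrow> (pt \<Rightarrow> real) \<Rightarrow> (pt \<Rightarrow> real) \<Rightarrow> bool" where
  "has_partial W i f g \<longleftrightarrow>
     (\<forall>x\<in>W. ((\<lambda>t. f (x(i := t))) has_real_derivative g x) (at (x i)))"

lemma has_partial_imp_partial: "has_partial W i f g \<Longrightarrow> x \<in> W \<Longrightarrow> partial i f x = g x"
  unfolding has_partial_def partial_def by (auto intro: DERIV_imp_deriv)

lemma has_partial_const: "has_partial W i (\<lambda>_. c) (\<lambda>_. 0)"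
  by (simp add: has_partial_def)

lemma has_partial_coord: "has_partial W i (\<lambda>x. x j) (\<lambda>_. if i = j then 1 else 0)"
  by (simp add: has_partial_def)

lemma has_partial_add:
  "has_partial W i f f' \<Longrightarrow> has_partial W i g g' \<Longrightarrow> has_partial W i (\<lambda>x. f x + g x) (\<lambda>x. f' x + g' x)"
  unfolding has_partial_def by (auto intro: DERIV_add)

lemma has_partial_mult:
  assumes "has_partial W i f f'" "has_partial W i g g'"
  shows "has_partial W i (\<lambda>x. f x * g x) (\<lambda>x. f' x * g x + f x * g' x)"
  unfolding has_partial_def
proof
  fix x assume "x \<in> W"
  with assms have "((\<lambda>t. f (x(i:=t))) has_real_derivative f' x) (at (x i))"
    "((\<lambda>t. g (x(i:=t))) has_real_derivative g' x) (at (x i))"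
    by (auto simp: has_partial_def)
  from DERIV_mult[OF this] 
  show "((\<lambda>t. f (x(i:=t)) * g (x(i:=t))) has_real_derivative f' x * g x + f x * g' x) (at (x i))"
    by (simp add: mult.commute add.commute)
qed

lemma has_partial_comp:
  assumes "has_partial W i g g'" "\<And>x. x \<in> W \<Longrightarrow> (F has_real_derivative F' (g x)) (at (g x))"
  shows "has_partial W i (\<lambda>x. F (g x)) (\<lambda>x. F' (g x) * g' x)"
  unfolding has_partial_def
proof
  fix x assume x: "x \<in> W"
  from x assms have "((\<lambda>t. g (x(i:=t))) has_real_derivative g' x) (at (x i))"
    by (auto simp: has_partial_def)
  from DERIV_chain2[OF _ this, of F "F' (g x)"] assms(2)[OF x]
  show "((\<lambda>t. F (g (x(i:=t)))) has_real_derivative F' (g x) * g' x) (at (x i))"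
    by simp
qed

lemma has_partial_cong:
  assumes W: "openin (Euclidean_space n) W" "i < n" and eq: "\<And>x. x \<in> W \<Longrightarrow> f x = g x"
    and d: "has_partial W i f d"
  shows "has_partial W i g d"
  unfolding has_partial_def
proof
  fix x assume x: "x \<in> W"
  have o: "open {t. x(i := t) \<in> W}"
    using W x openin_Rn_subset by (intro open_line) auto
  show "((\<lambda>t. g (x(i := t))) has_real_derivative d x) (at (x i))"
  proof (rule has_field_derivative_transform_within_open[OF _ o, where f = "\<lambda>t. f (x(i := t))"])
    show "((\<lambda>t. f (x(i := t))) has_real_derivative d x) (at (x i))"
      using d x by (simp add: has_partial_def)
  qed (use x eq in auto)
qed

text \<open>Recursion on the order, with the derivatives left existential, makes closure under sums,
  products and compositions a plain induction. The formulation of \<open>smooth_on\<close> by index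
  lists names fixed iterated derivatives and does not support this.\<close>

primrec Ck :: "nat \<Rightarrow> pt set \<Rightarrow> nat \<Rightarrow> (pt \<Rightarrow> real) \<Rightarrow> bool" where
  "Ck n W 0 f \<longleftrightarrow> continuous_on W f"
| "Ck n W (Suc m) f \<longleftrightarrow> continuous_on W f \<and> (\<forall>i<n. \<exists>g. has_partial W i f g \<and> Ck n W m g)"

lemma Ck_continuous: "Ck n W m f \<Longrightarrow> continuous_on W f"
  by (cases m) auto

lemma Ck_Suc_D: "Ck n W (Suc m) f \<Longrightarrow> Ck n W m f"
proof (induction m arbitrary: f)
  case (Suc m)
  then show ?case by (simp only: Ck.simps(2)) meson
qed auto

lemma Ck_const: "Ck n W m (\<lambda>_. c)"
  by (induction m arbitrary: c) (use has_partial_const in fastforce)+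

lemma Ck_coord: "Ck n W m (\<lambda>x. x j)"
proof (cases m)
  case (Suc m')
  have "\<exists>g. has_partial W i (\<lambda>x. x j) g \<and> Ck n W m' g" for i
    using has_partial_coord Ck_const by blast
  thus ?thesis by (simp add: Suc continuous_on_coord)
qed (simp add: continuous_on_coord)

lemma Ck_add: "Ck n W m f \<Longrightarrow> Ck n W m g \<Longrightarrow> Ck n W m (\<lambda>x. f x + g x)"
proof (induction m arbitrary: f g)
  case (Suc m)
  have "\<exists>h. has_partial W i (\<lambda>x. f x + g x) h \<and> Ck n W m h" if "i < n" for i
  proof -
    obtain f' g' where *: "has_partial W i f f'" "Ck n W m f'" "has_partial W i g g'" "Ck n W m g'"
      using Suc.prems \<open>i < n\<close> by (simp only: Ck.simps(2)) blast
    show ?thesis using has_partial_add[OF *(1,3)] Suc.IH[OF *(2,4)] by blast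
  qed
  with Suc.prems show ?case by (auto intro: continuous_on_add)
qed (auto intro: continuous_on_add)

lemma Ck_mult: "Ck n W m f \<Longrightarrow> Ck n W m g \<Longrightarrow> Ck n W m (\<lambda>x. f x * g x)"
proof (induction m arbitrary: f g)
  case (Suc m)
  have "\<exists>h. has_partial W i (\<lambda>x. f x * g x) h \<and> Ck n W m h" if i: "i < n" for i
  proof -
    obtain f' g' where *: "has_partial W i f f'" "Ck n W m f'" "has_partial W i g g'" "Ck n W m g'"
      using Suc.prems i by (simp only: Ck.simps(2)) blast
    have "Ck n W m (\<lambda>x. f' x * g x + f x * g' x)"
      by (intro Ck_add Suc.IH * Ck_Suc_D[OF Suc.prems(1)] Ck_Suc_D[OF Suc.prems(2)])
    with has_partial_mult[OF *(1,3)] show ?thesis by blast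
  qed
  with Suc.prems show ?case by (auto intro: continuous_on_mult)
qed (auto intro: continuous_on_mult)

lemma Ck_cong:
  assumes W: "openin (Euclidean_space n) W" and eq: "\<And>x. x \<in> W \<Longrightarrow> f x = g x" and f: "Ck n W m f"
  shows "Ck n W m g"
proof -
  have c: "continuous_on W g"
    using Ck_continuous[OF f] continuous_on_cong[of W W f g] eq by simp
  show ?thesis
  proof (cases m)
    case (Suc m')
    have "\<exists>d. has_partial W i g d \<and> Ck n W m' d" if i: "i < n" for i
    proof -
      from f i obtain d where d: "has_partial W i f d" "Ck n W m' d"
        by (auto simp: Suc)
      have "has_partial W i g d"
        by (rule has_partial_cong[OF W i _ d(1)]) (rule eq)
      with d show ?thesis by blast
    qed
    thus ?thesis using c by (simp add: Suc)
  qed (simp add: c)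
qed

text \<open>The derivatives supplied for different orders could be different functions. Uniqueness
  of derivatives identifies all of them on W with \<open>partial i f\<close>, so a single function
  serves every order.\<close>

lemma Ck_all_partial:
  assumes W: "openin (Euclidean_space n) W" and f: "\<And>m. Ck n W m f" and i: "i < n"
  shows "has_partial W i f (partial i f)" "Ck n W m (partial i f)"
proof -
  have *: "\<exists>g. has_partial W i f g \<and> Ck n W m g" for m
    using f[of "Suc m"] i by simp
  have eq: "partial i f x = g x" if "has_partial W i f g" "x \<in> W" for g x
    using has_partial_imp_partial that by blast
  show "has_partial W i f (partial i f)"
    using * eq by (metis has_partial_def)
  obtain g where "has_partial W i f g" "Ck n W m g" using * by blast
  thus "Ck n W m (partial i f)" using Ck_cong[OF W, of g "partial i f"] eq by metis
qed

text \<open>One direction is an induction on the order, for all index lists at once; the other is an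
  induction on the list, peeling off one derivative with \<open>Ck_all_partial\<close>.\<close>

lemma smooth_on_iff_Ck: "smooth_on n W f \<longleftrightarrow> openin (Euclidean_space n) W \<and> (\<forall>m. Ck n W m f)"
proof (intro iffI conjI)
  assume s: "smooth_on n W f"
  thus W: "openin (Euclidean_space n) W" by (simp add: smooth_on_def)
  have c: "continuous_on W (partials js f)" if "js \<in> lists {..<n}" for js
    using s that continuous_map_Rn[OF openin_Rn_subset[OF W]] by (auto simp: smooth_on_def)
  have d: "has_partial W i (partials js f) (partials (i # js) f)" if "js \<in> lists {..<n}" "i < n" for i js
    using s that by (auto simp: smooth_on_def has_partial_def partial_def DERIV_deriv_iff_real_differentiable)
  have "Ck n W m (partials js f)" if "js \<in> lists {..<n}" for m js
    using that
  proof (induction m arbitrary: js)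
    case (Suc m)
    have "\<exists>g. has_partial W i (partials js f) g \<and> Ck n W m g" if "i < n" for i
      using d[OF Suc.prems that] Suc.IH[of "i # js"] Suc.prems that by auto
    thus ?case using c[OF Suc.prems] by simp
  qed (simp add: c)
  from this[of "[]"] show "\<forall>m. Ck n W m f" by simp
next
  assume a: "openin (Euclidean_space n) W \<and> (\<forall>m. Ck n W m f)"
  hence W: "openin (Euclidean_space n) W" by simp
  have *: "\<forall>m. Ck n W m (partials js f)" if "js \<in> lists {..<n}" for js
    using that
  proof (induction js)
    case Nil
    then show ?case using a by simp
  next
    case (Cons i js)
    then show ?case using Ck_all_partial(2)[OF W, of "partials js f" i] by auto
  qed
  show "smooth_on n W f"
    unfolding smooth_on_def
  proof (intro conjI W ballI allI impI)
    fix js assume js: "js \<in> lists {..<n}"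
    show "continuous_map (subtopology (Euclidean_space n) W) euclideanreal (partials js f)"
      using *[OF js] Ck_continuous continuous_map_Rn[OF openin_Rn_subset[OF W]] by blast
    fix x i assume "x \<in> W" "i < n"
    with Ck_all_partial(1)[OF W, of "partials js f" i] *[OF js]
    show "(\<lambda>t. partials js f (x(i := t))) differentiable (at (x i))"
      unfolding has_partial_def by (auto simp: real_differentiable_def)
  qed
qed

lemma smooth_onD:
  assumes "smooth_on n W f"
  shows "openin (Euclidean_space n) W" "continuous_on W f"
    "i < n \<Longrightarrow> has_partial W i f (partial i f)" "i < n \<Longrightarrow> smooth_on n W (partial i f)"
  using assms Ck_all_partial[of n W f] Ck_continuous[of n W 0 f] unfolding smooth_on_iff_Ck
  by (auto dest: spec[of _ 0])

lemma smooth_on_const: "openin (Euclidean_space n) W \<Longrightarrow> smooth_on n W (\<lambda>_. c)"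
  by (simp add: smooth_on_iff_Ck Ck_const)

lemma smooth_on_coord: "openin (Euclidean_space n) W \<Longrightarrow> smooth_on n W (\<lambda>x. x j)"
  by (simp add: smooth_on_iff_Ck Ck_coord)

lemma smooth_on_add: "smooth_on n W f \<Longrightarrow> smooth_on n W g \<Longrightarrow> smooth_on n W (\<lambda>x. f x + g x)"
  by (simp add: smooth_on_iff_Ck Ck_add)

lemma smooth_on_mult: "smooth_on n W f \<Longrightarrow> smooth_on n W g \<Longrightarrow> smooth_on n W (\<lambda>x. f x * g x)"
  by (simp add: smooth_on_iff_Ck Ck_mult)

lemma smooth_on_diff:
  assumes "smooth_on n W f" "smooth_on n W g" shows "smooth_on n W (\<lambda>x. f x - g x)"
proof -
  have "smooth_on n W (\<lambda>x. (-1) * g x)"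
    using assms by (intro smooth_on_mult smooth_on_const) (auto simp: smooth_on_def)
  from smooth_on_add[OF assms(1) this] show ?thesis by simp
qed

section \<open>Smooth functions of one real variable\<close>

primrec CkR :: "real set \<Rightarrow> nat \<Rightarrow> (real \<Rightarrow> real) \<Rightarrow> bool" where
  "CkR I 0 F \<longleftrightarrow> continuous_on I F"
| "CkR I (Suc m) F \<longleftrightarrow> continuous_on I F \<and>
     (\<exists>F'. (\<forall>s\<in>I. (F has_real_derivative F' s) (at s)) \<and> CkR I m F')"

definition smoothR :: "real set \<Rightarrow> (real \<Rightarrow> real) \<Rightarrow> bool" where
  "smoothR I F \<longleftrightarrow> (\<forall>m. CkR I m F)"

lemma CkR_SucE:
  assumes "CkR I (Suc m) F"
  obtains F' where "\<And>s. s \<in> I \<Longrightarrow> (F has_real_derivative F' s) (at s)" "CkR I m F'"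
  using assms by auto

lemma CkR_continuous: "CkR I m F \<Longrightarrow> continuous_on I F"
  by (cases m) auto

lemma CkR_SucI:
  assumes "\<And>s. s \<in> I \<Longrightarrow> (F has_real_derivative F' s) (at s)" "CkR I m F'"
  shows "CkR I (Suc m) F"
  using assms by (auto intro!: DERIV_continuous_on[of I F F'] simp: has_field_derivative_at_within)

lemma CkR_Suc_D: "CkR I (Suc m) f \<Longrightarrow> CkR I m f"
proof (induction m arbitrary: f)
  case (Suc m)
  then show ?case by (simp only: CkR.simps(2)) meson
qed auto

lemma CkR_const: "CkR I m (\<lambda>_. c)"
proof (induction m arbitrary: c)
  case (Suc m)
  show ?case by (rule CkR_SucI[OF _ Suc]) (auto intro!: derivative_eq_intros)
qed auto

lemma CkR_id: "CkR I m (\<lambda>x. x)"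
proof (cases m)
  case (Suc m')
  show ?thesis unfolding Suc by (rule CkR_SucI[OF _ CkR_const[of _ _ 1]]) (auto intro!: derivative_eq_intros)
qed auto

lemma CkR_add: "CkR I m f \<Longrightarrow> CkR I m g \<Longrightarrow> CkR I m (\<lambda>x. f x + g x)"
proof (induction m arbitrary: f g)
  case (Suc m)
  then obtain f' g' where *: "\<And>s. s\<in>I \<Longrightarrow> (f has_real_derivative f' s) (at s)" "CkR I m f'"
      "\<And>s. s\<in>I \<Longrightarrow> (g has_real_derivative g' s) (at s)" "CkR I m g'" by (elim CkR_SucE) blast
  show ?case by (rule CkR_SucI[OF _ Suc.IH[OF *(2,4)]]) (auto intro: DERIV_add *)
qed (auto intro: continuous_on_add)

lemma CkR_mult: "CkR I m f \<Longrightarrow> CkR I m g \<Longrightarrow> CkR I m (\<lambda>x. f x * g x)"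
proof (induction m arbitrary: f g)
  case (Suc m)
  then obtain f' g' where *: "\<And>s. s\<in>I \<Longrightarrow> (f has_real_derivative f' s) (at s)" "CkR I m f'"
      "\<And>s. s\<in>I \<Longrightarrow> (g has_real_derivative g' s) (at s)" "CkR I m g'" by (elim CkR_SucE) blast
  have "CkR I m (\<lambda>x. f' x * g x + g' x * f x)"
    by (intro CkR_add Suc.IH * CkR_Suc_D[OF Suc.prems(1)] CkR_Suc_D[OF Suc.prems(2)])
  thus ?case by (rule CkR_SucI[rotated]) (auto intro: DERIV_mult *)
qed (auto intro: continuous_on_mult)

lemma CkR_comp:
  assumes "CkR I m f" "CkR J m g" "g ` J \<subseteq> I" shows "CkR J m (\<lambda>x. f (g x))"
  using assms(1,2)
proof (induction m arbitrary: f)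
  case 0
  thus ?case using continuous_on_compose2[OF _ _ assms(3)] by simp
next
  case (Suc m)
  obtain f' where f': "\<And>s. s\<in>I \<Longrightarrow> (f has_real_derivative f' s) (at s)" "CkR I m f'"
    using CkR_SucE[OF Suc.prems(1)] by blast
  obtain g' where g': "\<And>s. s\<in>J \<Longrightarrow> (g has_real_derivative g' s) (at s)" "CkR J m g'"
    using CkR_SucE[OF Suc.prems(2)] by blast
  have "CkR J m (\<lambda>x. f' (g x) * g' x)"
    by (rule CkR_mult[OF Suc.IH[OF f'(2) CkR_Suc_D[OF Suc.prems(2)]] g'(2)])
  thus ?case
  proof (rule CkR_SucI[rotated])
    fix s assume s: "s \<in> J"
    with assms(3) have "g s \<in> I" by blast
    from DERIV_chain2[OF f'(1)[OF this] g'(1)[OF s]]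
    show "((\<lambda>x. f (g x)) has_real_derivative f' (g s) * g' s) (at s)" .
  qed
qed

lemma Ck_comp:
  assumes "CkR I m F" "Ck n W m g" "g ` W \<subseteq> I" shows "Ck n W m (\<lambda>x. F (g x))"
  using assms(1,2)
proof (induction m arbitrary: F)
  case 0
  thus ?case using continuous_on_compose2[OF _ _ assms(3)] by simp
next
  case (Suc m)
  then obtain F' where F': "\<And>s. s\<in>I \<Longrightarrow> (F has_real_derivative F' s) (at s)" "CkR I m F'" by auto
  have "\<exists>h. has_partial W i (\<lambda>x. F (g x)) h \<and> Ck n W m h" if i: "i < n" for i
  proof -
    obtain g' where g': "has_partial W i g g'" "Ck n W m g'"
      using Suc.prems i by (simp only: Ck.simps(2)) blast
    have "Ck n W m (\<lambda>x. F' (g x) * g' x)"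
      by (rule Ck_mult[OF Suc.IH[OF F'(2) Ck_Suc_D[OF Suc.prems(2)]] g'(2)])
    moreover have "has_partial W i (\<lambda>x. F (g x)) (\<lambda>x. F' (g x) * g' x)"
      using F' assms(3) by (intro has_partial_comp[OF g'(1), of F F']) blast
    ultimately show ?thesis by blast
  qed
  moreover have "continuous_on W (\<lambda>x. F (g x))"
    using continuous_on_compose2[OF _ _ assms(3)] CkR_continuous[OF Suc.prems(1)] Ck_continuous[OF Suc.prems(2)]
    by blast
  ultimately show ?case by simp
qed

lemma smooth_on_comp:
  "smoothR I F \<Longrightarrow> smooth_on n W g \<Longrightarrow> g ` W \<subseteq> I \<Longrightarrow> smooth_on n W (\<lambda>x. F (g x))"
  unfolding smooth_on_iff_Ck smoothR_def using Ck_comp[of I _ F n W g] by simp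

lemma smoothR_const: "smoothR I (\<lambda>_. c)" by (simp add: smoothR_def CkR_const)
lemma smoothR_id: "smoothR I (\<lambda>x. x)" by (simp add: smoothR_def CkR_id)
lemma smoothR_add: "smoothR I f \<Longrightarrow> smoothR I g \<Longrightarrow> smoothR I (\<lambda>x. f x + g x)"
  by (simp add: smoothR_def CkR_add)
lemma smoothR_mult: "smoothR I f \<Longrightarrow> smoothR I g \<Longrightarrow> smoothR I (\<lambda>x. f x * g x)"
  by (simp add: smoothR_def CkR_mult)
lemma smoothR_diff: "smoothR I f \<Longrightarrow> smoothR I g \<Longrightarrow> smoothR I (\<lambda>x. f x - g x)"
  using smoothR_add[of I f "\<lambda>x. (-1) * g x"] smoothR_mult[OF smoothR_const, of I g "-1"] by simp
lemma smoothR_comp: "smoothR I f \<Longrightarrow> smoothR J g \<Longrightarrow> g ` J \<subseteq> I \<Longrightarrow> smoothR J (\<lambda>x. f (g x))"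
  unfolding smoothR_def using CkR_comp[of I _ f J g] by simp

lemma smoothR_seqI:
  assumes "\<And>j s. s \<in> I \<Longrightarrow> (D j has_real_derivative D (Suc j) s) (at s)"
  shows "smoothR I (D j)"
proof -
  have c: "continuous_on I (D j)" for j
    using assms by (auto intro!: DERIV_continuous_on[of I "D j" "D (Suc j)"] simp: has_field_derivative_at_within)
  have "CkR I m (D j)" for m
  proof (induction m arbitrary: j)
    case (Suc m)
    show ?case by (rule CkR_SucI[OF assms Suc])
  qed (simp add: c)
  thus ?thesis by (simp add: smoothR_def)
qed

section \<open>Integration along lines and scaling\<close>

text \<open>Points of \<open>lebP {..<n}\<close> are \<open>undefined\<close> outside
  \<open>{..<n}\<close>. This is the map in the definition of \<open>leb\<close> that pads them with
  zeros.\<close>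

definition ext0 :: "nat \<Rightarrow> pt \<Rightarrow> pt" where
  "ext0 n x = (\<lambda>i. if i < n then x i else 0)"

abbreviation lebP :: "nat set \<Rightarrow> pt measure" where
  "lebP I \<equiv> \<Pi>\<^sub>M i\<in>I. (lborel :: real measure)"

lemma ext0_measurable [measurable]: "ext0 n \<in> lebP {..<n} \<rightarrow>\<^sub>M borel"
proof (rule measurable_coordinatewise_then_product)
  fix i show "(\<lambda>x. ext0 n x i) \<in> borel_measurable (lebP {..<n})"
    by (cases "i < n") (auto simp: ext0_def)
qed

lemma ext0_in_Rn: "ext0 n x \<in> Rn n"
  by (auto simp: ext0_def Rn_iff)

lemma ext0_upd: "i < n \<Longrightarrow> ext0 n (x(i := y)) = (ext0 n x)(i := y)"
  by (auto simp: ext0_def)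

lemma leb_eq: "leb n = completion (distr (lebP {..<n}) borel (ext0 n))"
  by (simp add: leb_def ext0_def[abs_def])

lemma sets_leb: "A \<in> sets borel \<Longrightarrow> A \<in> sets (leb n)"
  by (simp add: leb_eq)

lemma measurable_leb: "f \<in> borel_measurable borel \<Longrightarrow> f \<in> borel_measurable (leb n)"
  unfolding leb_eq by (rule measurable_completion) simp

lemma nn_integral_leb:
  "f \<in> borel_measurable borel \<Longrightarrow> (\<integral>\<^sup>+x. f x \<partial>leb n) = (\<integral>\<^sup>+x. f (ext0 n x) \<partial>lebP {..<n})"
  unfolding leb_eq by (simp add: nn_integral_completion nn_integral_distr)

lemma integral_leb:
  fixes f :: "pt \<Rightarrow> real"
  shows "f \<in> borel_measurable borel \<Longrightarrow> (\<integral>x. f x \<partial>leb n) = (\<integral>x. f (ext0 n x) \<partial>lebP {..<n})"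
  unfolding leb_eq by (simp add: integral_completion integral_distr)

lemma integrable_leb:
  fixes f :: "pt \<Rightarrow> real"
  shows "f \<in> borel_measurable borel \<Longrightarrow> integrable (leb n) f \<longleftrightarrow> integrable (lebP {..<n}) (\<lambda>x. f (ext0 n x))"
  unfolding leb_eq by (simp add: integrable_completion integrable_distr_eq)

interpretation lebP: product_sigma_finite "\<lambda>_ :: nat. lborel :: real measure"
  by standard

lemma emeasure_leb_bounded:
  assumes B: "B \<in> sets (leb n)" "\<And>x i. x \<in> B \<Longrightarrow> i < n \<Longrightarrow> \<bar>x i\<bar> \<le> b"
  shows "emeasure (leb n) B < \<infinity>"
proof -
  let ?Q = "{x :: pt. \<forall>i\<in>{..<n}. x i \<in> {-b..b}}"
  have Q: "?Q \<in> sets borel"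
    by measurable
  have "emeasure (leb n) B \<le> emeasure (leb n) ?Q"
    using B(2) by (intro emeasure_mono sets_leb Q) (force simp: abs_le_iff)
  also have "\<dots> = emeasure (lebP {..<n}) (ext0 n -` ?Q \<inter> space (lebP {..<n}))"
    unfolding leb_eq using Q by (simp add: emeasure_distr)
  also have "ext0 n -` ?Q \<inter> space (lebP {..<n}) = (\<Pi>\<^sub>E i\<in>{..<n}. {-b..b})"
    by (auto simp: space_PiM ext0_def PiE_def Pi_def)
  also have "emeasure (lebP {..<n}) \<dots> = (\<Prod>i<n. ennreal (if -b \<le> b then b - -b else 0))"
    by (subst lebP.emeasure_PiM) (auto intro!: prod.cong)
  also have "\<dots> < \<infinity>"
    by (auto simp: power_less_top_ennreal)
  finally show ?thesis .
qed

text \<open>Fubini, integrating first along the i-th axis. It reduces integration by parts in n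
  variables to the fundamental theorem of calculus on lines.\<close>

lemma integral_leb_line_zero:
  fixes g :: "pt \<Rightarrow> real"
  assumes g: "g \<in> borel_measurable borel" "integrable (leb n) g" and i: "i < n"
    and z: "\<And>x. x \<in> Rn n \<Longrightarrow> (\<integral>t. g (x(i := t)) \<partial>lborel) = 0"
  shows "(\<integral>x. g x \<partial>leb n) = 0"
proof -
  let ?I = "{..<n} - {i}"
  have I: "{..<n} = insert i ?I" using i by auto
  have "(\<integral>x. g x \<partial>leb n) = (\<integral>x. g (ext0 n x) \<partial>lebP (insert i ?I))"
    using integral_leb[OF g(1)] I by simp
  also have "\<dots> = (\<integral>x. (\<integral>y. g (ext0 n (x(i := y))) \<partial>lborel) \<partial>lebP ?I)"
    using integrable_leb[OF g(1)] g(2) I by (intro lebP.product_integral_insert) auto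
  also have "\<dots> = 0"
    by (simp add: ext0_upd[OF i] z ext0_in_Rn)
  finally show ?thesis .
qed

lemma null_sets_leb_line:
  assumes B: "B \<in> sets borel" and i: "i < n"
    and z: "\<And>x. x \<in> Rn n \<Longrightarrow> countable {t. x(i := t) \<in> B}"
  shows "B \<in> null_sets (leb n)"
proof -
  let ?I = "{..<n} - {i}"
  have I: "{..<n} = insert i ?I" using i by auto
  have [measurable]: "B \<in> sets borel" by fact
  have m: "(\<lambda>x. indicator B (ext0 n x) :: ennreal) \<in> borel_measurable (lebP {..<n})"
    by measurable
  have "emeasure (leb n) B = (\<integral>\<^sup>+x. indicator B x \<partial>leb n)"
    by (simp add: sets_leb[OF B])
  also have "\<dots> = (\<integral>\<^sup>+x. indicator B (ext0 n x) \<partial>lebP (insert i ?I))"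
    using nn_integral_leb[of "indicator B" n] I by simp
  also have "\<dots> = (\<integral>\<^sup>+x. (\<integral>\<^sup>+y. indicator B (ext0 n (x(i := y))) \<partial>lborel) \<partial>lebP ?I)"
    using m I by (intro lebP.product_nn_integral_insert) auto
  also have "\<dots> = (\<integral>\<^sup>+x. 0 \<partial>lebP ?I)"
  proof (intro nn_integral_cong)
    fix x
    have c: "countable {t. (ext0 n x)(i := t) \<in> B}" by (rule z[OF ext0_in_Rn])
    have "(\<integral>\<^sup>+y. indicator B (ext0 n (x(i := y))) \<partial>lborel)
        = (\<integral>\<^sup>+y. indicator {t. (ext0 n x)(i := t) \<in> B} y \<partial>lborel)"
      by (intro nn_integral_cong) (auto simp: ext0_upd[OF i] indicator_def)
    also have "\<dots> = emeasure lborel {t. (ext0 n x)(i := t) \<in> B}"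
      by (rule nn_integral_indicator[OF null_setsD2[OF countable_imp_null_set_lborel[OF c]]])
    also have "\<dots> = 0" by (rule emeasure_lborel_countable[OF c])
    finally show "(\<integral>\<^sup>+y. indicator B (ext0 n (x(i := y))) \<partial>lborel) = 0" .
  qed
  finally show ?thesis using sets_leb[OF B] by (auto simp: null_sets_def)
qed

text \<open>Induction on the coordinates: the new coordinate is integrated out, the induction
  hypothesis is applied to the remaining function, and the one-dimensional affine substitution
  contributes one more factor c. The \<open>restrict\<close> keeps the dilated point in the product
  space.\<close>

lemma nn_integral_lebP_scale:
  fixes f :: "pt \<Rightarrow> ennreal"
  assumes "finite I" "f \<in> borel_measurable (lebP I)" "c > 0"
  shows "(\<integral>\<^sup>+x. f x \<partial>lebP I) = ennreal (c ^ card I) * (\<integral>\<^sup>+x. f (\<lambda>i\<in>I. c * x i) \<partial>lebP I)"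
  using assms
proof (induction I arbitrary: f)
  case empty
  then show ?case by (simp add: PiM_empty nn_integral_count_space_finite restrict_def)
next
  case (insert i I)
  note [measurable] = insert.prems(1)
  let ?S = "\<lambda>J (x :: pt). (\<lambda>j\<in>J. c * x j)"
  have S[measurable]: "?S J \<in> lebP J \<rightarrow>\<^sub>M lebP J" for J
    by (rule measurable_restrict) measurable
  have fS: "(\<lambda>x. f (?S (insert i I) x)) \<in> borel_measurable (lebP (insert i I))"
    by measurable
  have "(\<lambda>(x, y). f (x(i := y))) \<in> borel_measurable (lebP I \<Otimes>\<^sub>M lborel)"
    using measurable_compose[OF measurable_add_dim insert.prems(1)] by (simp add: case_prod_beta')
  hence m: "(\<lambda>x. \<integral>\<^sup>+y. f (x(i := y)) \<partial>lborel) \<in> borel_measurable (lebP I)"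
    by (rule lborel.borel_measurable_nn_integral)
  have "(\<integral>\<^sup>+x. f x \<partial>lebP (insert i I)) = (\<integral>\<^sup>+x. (\<integral>\<^sup>+y. f (x(i := y)) \<partial>lborel) \<partial>lebP I)"
    by (rule lebP.product_nn_integral_insert[OF insert.hyps(1,2) insert.prems(1)])
  also have "\<dots> = ennreal (c ^ card I) * (\<integral>\<^sup>+x. (\<integral>\<^sup>+y. f ((?S I x)(i := y)) \<partial>lborel) \<partial>lebP I)"
    by (rule insert.IH[OF m insert.prems(2)])
  also have "(\<integral>\<^sup>+x. (\<integral>\<^sup>+y. f ((?S I x)(i := y)) \<partial>lborel) \<partial>lebP I) =
      (\<integral>\<^sup>+x. ennreal c * (\<integral>\<^sup>+y. f ((?S I x)(i := c * y)) \<partial>lborel) \<partial>lebP I)"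
  proof (intro nn_integral_cong)
    fix x assume x: "x \<in> space (lebP I)"
    have "?S I x \<in> space (lebP I)" using x by (auto simp: space_PiM)
    hence "(\<lambda>y. (?S I x)(i := y)) \<in> borel \<rightarrow>\<^sub>M lebP (insert i I)"
      using measurable_component_update[of "?S I x" I "\<lambda>_. lborel" i] insert.hyps(2) by simp
    hence "(\<lambda>y. f ((?S I x)(i := y))) \<in> borel_measurable borel"
      using insert.prems(1) by (rule measurable_compose)
    from nn_integral_real_affine[OF this, of c 0] insert.prems(2)
    show "(\<integral>\<^sup>+y. f ((?S I x)(i := y)) \<partial>lborel) = ennreal c * (\<integral>\<^sup>+y. f ((?S I x)(i := c * y)) \<partial>lborel)"
      by simp
  qed
  also have "\<dots> = ennreal c * (\<integral>\<^sup>+x. (\<integral>\<^sup>+y. f (?S (insert i I) (x(i := y))) \<partial>lborel) \<partial>lebP I)"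
  proof -
    have eq: "(?S I x)(i := c * y) = ?S (insert i I) (x(i := y))" if "x \<in> space (lebP I)" for x y
      using insert.hyps(2) by (auto simp: fun_eq_iff restrict_def)
    have "(\<integral>\<^sup>+x. ennreal c * (\<integral>\<^sup>+y. f ((?S I x)(i := c * y)) \<partial>lborel) \<partial>lebP I)
       = (\<integral>\<^sup>+x. ennreal c * (\<integral>\<^sup>+y. f (?S (insert i I) (x(i := y))) \<partial>lborel) \<partial>lebP I)"
      by (intro nn_integral_cong) (simp only: eq)
    also have "\<dots> = ennreal c * (\<integral>\<^sup>+x. (\<integral>\<^sup>+y. f (?S (insert i I) (x(i := y))) \<partial>lborel) \<partial>lebP I)"
      using insert.hyps by (intro nn_integral_cmult) measurable
    finally show ?thesis .
  qed
  also have "(\<integral>\<^sup>+x. (\<integral>\<^sup>+y. f (?S (insert i I) (x(i := y))) \<partial>lborel) \<partial>lebP I)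
      = (\<integral>\<^sup>+x. f (?S (insert i I) x) \<partial>lebP (insert i I))"
    by (rule lebP.product_nn_integral_insert[OF insert.hyps(1,2) fS, symmetric])
  finally show ?case
    using insert.hyps insert.prems(2) by (simp add: mult.assoc[symmetric] ennreal_mult mult.commute del: restrict_apply)
qed

lemma nn_integral_leb_scale:
  fixes f :: "pt \<Rightarrow> ennreal"
  assumes f: "f \<in> borel_measurable borel" and c: "c > 0"
  shows "(\<integral>\<^sup>+x. f x \<partial>leb n) = ennreal (c ^ n) * (\<integral>\<^sup>+x. f (\<lambda>i. c * x i) \<partial>leb n)"
proof -
  have m: "(\<lambda>x :: pt. (\<lambda>i. c * x i)) \<in> borel \<rightarrow>\<^sub>M borel"
    by (rule measurable_coordinatewise_then_product) measurable
  have "ext0 n (\<lambda>i\<in>{..<n}. c * x i) = (\<lambda>i. c * ext0 n x i)" for x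
    by (auto simp: ext0_def)
  thus ?thesis
    using nn_integral_lebP_scale[of "{..<n}" "\<lambda>x. f (ext0 n x)" c] f c
      nn_integral_leb[OF f] nn_integral_leb[OF measurable_compose[OF m f]]
    by simp
qed

lemma openin_Rn_borel: "openin (Euclidean_space n) W \<Longrightarrow> W \<in> sets borel"
  unfolding openin_Rn_iff using closed_Rn[of n] by auto

section \<open>Symmetry of second partial derivatives\<close>

text \<open>The mean value theorem applied in s to the increment over t, and then in t. The
  left-hand side is symmetric in the two variables, which is what makes it useful for interchanging
  derivatives.\<close>

lemma mvt_rectangle:
  fixes F F1 F12 :: "real \<Rightarrow> real \<Rightarrow> real"
  assumes d1: "\<And>s t. ((\<lambda>s. F s t) has_real_derivative F1 s t) (at s)"
    and d2: "\<And>s t. ((\<lambda>t. F1 s t) has_real_derivative F12 s t) (at t)" and h: "h > 0"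
  shows "\<exists>\<xi>\<in>{a<..<a+h}. \<exists>\<eta>\<in>{b<..<b+h}. F (a+h) (b+h) - F (a+h) b - F a (b+h) + F a b = h * h * F12 \<xi> \<eta>"
proof -
  have "((\<lambda>s. F s (b+h) - F s b) has_real_derivative F1 s (b+h) - F1 s b) (at s)" for s
    by (intro DERIV_diff d1)
  from MVT2[of a "a+h", OF _ this] h
  obtain \<xi> where \<xi>: "a < \<xi>" "\<xi> < a+h"
    "(F (a+h) (b+h) - F (a+h) b) - (F a (b+h) - F a b) = h * (F1 \<xi> (b+h) - F1 \<xi> b)" by auto
  from MVT2[of b "b+h" "F1 \<xi>" "F12 \<xi>", OF _ d2] h
  obtain \<eta> where \<eta>: "b < \<eta>" "\<eta> < b+h" "F1 \<xi> (b+h) - F1 \<xi> b = h * F12 \<xi> \<eta>" by auto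
  from \<xi> \<eta> have "F (a+h) (b+h) - F (a+h) b - F a (b+h) + F a b = h * h * F12 \<xi> \<eta>"
    by (simp add: algebra_simps)
  thus ?thesis by (intro bexI[of _ \<xi>] bexI[of _ \<eta>]) (use \<xi> \<eta> in auto)
qed

text \<open>The same second difference over a square with corner x equals the area times either
  mixed derivative, each at some point of the square. As the side 1/(m+1) shrinks, continuity brings
  both values to x.\<close>

lemma smooth_on_partial_commute:
  assumes f: "smooth_on n (Rn n) f" and ij: "i < n" "j < n" and x: "x \<in> Rn n"
  shows "partial i (partial j f) x = partial j (partial i f) x"
proof (cases "i = j")
  case False
  define P where "P s t = x(i := s, j := t)" for s t
  have P: "P s t \<in> Rn n" for s t
    using x ij by (auto simp: P_def upd_in_Rn)
  have Pi: "(P s t)(i := s') = P s' t" and Pj: "(P s t)(j := t') = P s t'" for s t s' t'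
    using False by (auto simp: P_def)
  have Pv: "P s t i = s" "P s t j = t" for s t using False by (auto simp: P_def)
  have D: "has_partial (Rn n) k g (partial k g)" if "smooth_on n (Rn n) g" "k < n" for k g
    using that by (rule smooth_onD)
  have di: "((\<lambda>s. g (P s t)) has_real_derivative partial i g (P s t)) (at s)" if "smooth_on n (Rn n) g" for g s t
  proof -
    have "((\<lambda>s'. g ((P s t)(i := s'))) has_real_derivative partial i g (P s t)) (at (P s t i))"
      using D[OF that ij(1)] P[of s t] unfolding has_partial_def by blast
    thus ?thesis unfolding Pi Pv .
  qed
  have dj: "((\<lambda>t. g (P s t)) has_real_derivative partial j g (P s t)) (at t)" if "smooth_on n (Rn n) g" for g s t
  proof -
    have "((\<lambda>t'. g ((P s t)(j := t'))) has_real_derivative partial j g (P s t)) (at (P s t j))"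
      using D[OF that ij(2)] P[of s t] unfolding has_partial_def by blast
    thus ?thesis unfolding Pj Pv .
  qed
  define a b where "a = x i" and "b = x j"
  define h where "h m = 1 / real (Suc m)" for m
  have h: "h m > 0" for m by (simp add: h_def)
  have hl: "h \<longlonglongrightarrow> 0" unfolding h_def using LIMSEQ_inverse_real_of_nat by (simp add: inverse_eq_divide)
  have s: "smooth_on n (Rn n) (partial i f)" "smooth_on n (Rn n) (partial j f)"
    using f ij smooth_onD(4) by auto
  have "\<exists>\<xi>\<in>{a<..<a+h m}. \<exists>\<eta>\<in>{b<..<b+h m}. f (P (a+h m) (b+h m)) - f (P (a+h m) b) - f (P a (b+h m)) + f (P a b)
      = h m * h m * partial j (partial i f) (P \<xi> \<eta>)" for m
    by (rule mvt_rectangle[of "\<lambda>s t. f (P s t)" "\<lambda>s t. partial i f (P s t)" "\<lambda>s t. partial j (partial i f) (P s t)"])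
      (intro di dj f s h)+
  then obtain \<xi> \<eta> where 1: "\<And>m. \<xi> m \<in> {a<..<a+h m}" "\<And>m. \<eta> m \<in> {b<..<b+h m}"
    "\<And>m. f (P (a+h m) (b+h m)) - f (P (a+h m) b) - f (P a (b+h m)) + f (P a b)
      = h m * h m * partial j (partial i f) (P (\<xi> m) (\<eta> m))" by metis
  have "\<exists>\<eta>\<in>{b<..<b+h m}. \<exists>\<xi>\<in>{a<..<a+h m}. f (P (a+h m) (b+h m)) - f (P a (b+h m)) - f (P (a+h m) b) + f (P a b)
      = h m * h m * partial i (partial j f) (P \<xi> \<eta>)" for m
    by (rule mvt_rectangle[of "\<lambda>t s. f (P s t)" "\<lambda>t s. partial j f (P s t)" "\<lambda>t s. partial i (partial j f) (P s t)"])
      (intro di dj f s h)+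
  then obtain \<eta>' \<xi>' where 2: "\<And>m. \<xi>' m \<in> {a<..<a+h m}" "\<And>m. \<eta>' m \<in> {b<..<b+h m}"
    "\<And>m. f (P (a+h m) (b+h m)) - f (P a (b+h m)) - f (P (a+h m) b) + f (P a b)
      = h m * h m * partial i (partial j f) (P (\<xi>' m) (\<eta>' m))" by metis
  have eq: "partial j (partial i f) (P (\<xi> m) (\<eta> m)) = partial i (partial j f) (P (\<xi>' m) (\<eta>' m))" for m
  proof -
    have "h m * h m * partial j (partial i f) (P (\<xi> m) (\<eta> m)) = h m * h m * partial i (partial j f) (P (\<xi>' m) (\<eta>' m))"
      using 1(3)[of m] 2(3)[of m] by linarith
    with h[of m] show ?thesis by simp
  qed
  have cP: "continuous_on UNIV (\<lambda>p. P (fst p) (snd p))"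
  proof (rule continuous_on_coordinatewise_then_product)
    fix k show "continuous_on UNIV (\<lambda>p. P (fst p) (snd p) k)"
      unfolding P_def by (cases "k = j"; cases "k = i") (auto intro: continuous_intros)
  qed
  have lim: "(\<lambda>m. g (P (\<sigma> m) (\<tau> m))) \<longlonglongrightarrow> g x"
    if "\<And>m. \<sigma> m \<in> {a<..<a+h m}" "\<And>m. \<tau> m \<in> {b<..<b+h m}" "smooth_on n (Rn n) g" for g \<sigma> \<tau>
  proof -
    have s: "\<sigma> \<longlonglongrightarrow> a"
      by (rule real_tendsto_sandwich[OF _ _ tendsto_const tendsto_add[OF tendsto_const hl, of a, simplified]])
         (use that(1) in \<open>auto intro!: always_eventually simp: less_imp_le\<close>)
    have t: "\<tau> \<longlonglongrightarrow> b"
      by (rule real_tendsto_sandwich[OF _ _ tendsto_const tendsto_add[OF tendsto_const hl, of b, simplified]])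
         (use that(2) in \<open>auto intro!: always_eventually simp: less_imp_le\<close>)
    have c: "continuous_on UNIV (\<lambda>p. g (P (fst p) (snd p)))"
      using continuous_on_compose2[OF smooth_onD(2)[OF that(3)] cP] P by blast
    have "(\<lambda>m. g (P (fst (\<sigma> m, \<tau> m)) (snd (\<sigma> m, \<tau> m)))) \<longlonglongrightarrow> g (P (fst (a, b)) (snd (a, b)))"
      by (rule continuous_on_tendsto_compose[OF c tendsto_Pair[OF s t]]) auto
    thus ?thesis by (simp add: P_def a_def b_def)
  qed
  have "(\<lambda>m. partial j (partial i f) (P (\<xi> m) (\<eta> m))) \<longlonglongrightarrow> partial j (partial i f) x"
    by (rule lim[OF 1(1,2)]) (intro smooth_onD(4) s ij)
  moreover have "(\<lambda>m. partial i (partial j f) (P (\<xi>' m) (\<eta>' m))) \<longlonglongrightarrow> partial i (partial j f) x"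
    by (rule lim[OF 2(1,2)]) (intro smooth_onD(4) s ij)
  ultimately show ?thesis using LIMSEQ_unique eq by simp
qed simp

section \<open>Bounded measurable functions on bounded sets\<close>

text \<open>Borel measurability in the ambient space, unlike measurability for the completed measure
  \<open>leb\<close>, survives restriction to lines. Boundedness makes products integrable on
  bounded domains.\<close>

definition bounded_meas :: "pt set \<Rightarrow> (pt \<Rightarrow> real) \<Rightarrow> bool" where
  "bounded_meas \<Omega> f \<longleftrightarrow> (\<lambda>x. indicator \<Omega> x * f x) \<in> borel_measurable borel \<and> (\<exists>C. \<forall>x\<in>\<Omega>. \<bar>f x\<bar> \<le> C)"

definition bounded_dom :: "nat \<Rightarrow> pt set \<Rightarrow> bool" where
  "bounded_dom n \<Omega> \<longleftrightarrow> \<Omega> \<in> sets borel \<and> \<Omega> \<subseteq> Rn n \<and> (\<exists>b. \<forall>x\<in>\<Omega>. \<forall>i<n. \<bar>x i\<bar> \<le> b)"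

lemma bounded_measD: "bounded_meas \<Omega> f \<Longrightarrow> (\<lambda>x. indicator \<Omega> x * f x) \<in> borel_measurable borel"
  by (simp add: bounded_meas_def)

lemma bounded_meas_add:
  assumes "bounded_meas \<Omega> f" "bounded_meas \<Omega> g" shows "bounded_meas \<Omega> (\<lambda>x. f x + g x)"
proof -
  obtain C D where "\<forall>x\<in>\<Omega>. \<bar>f x\<bar> \<le> C" "\<forall>x\<in>\<Omega>. \<bar>g x\<bar> \<le> D" using assms by (auto simp: bounded_meas_def)
  hence "\<forall>x\<in>\<Omega>. \<bar>f x + g x\<bar> \<le> C + D" by (auto intro: order_trans[OF abs_triangle_ineq] add_mono)
  moreover have "(\<lambda>x. indicator \<Omega> x * f x + indicator \<Omega> x * g x) \<in> borel_measurable borel"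
    by (rule borel_measurable_add[OF assms[THEN bounded_measD]])
  ultimately show ?thesis unfolding bounded_meas_def distrib_left by blast
qed

lemma bounded_meas_mult:
  assumes "bounded_meas \<Omega> f" "bounded_meas \<Omega> g" shows "bounded_meas \<Omega> (\<lambda>x. f x * g x)"
proof -
  obtain C D where "\<forall>x\<in>\<Omega>. \<bar>f x\<bar> \<le> C" "\<forall>x\<in>\<Omega>. \<bar>g x\<bar> \<le> D" using assms by (auto simp: bounded_meas_def)
  hence "\<bar>f x * g x\<bar> \<le> \<bar>C\<bar> * \<bar>D\<bar>" if "x \<in> \<Omega>" for x
    unfolding abs_mult using that by (intro mult_mono) force+
  moreover have "(\<lambda>x. (indicator \<Omega> x * f x) * (indicator \<Omega> x * g x)) \<in> borel_measurable borel"
    by (rule borel_measurable_times[OF assms[THEN bounded_measD]])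
  moreover have "(\<lambda>x. (indicator \<Omega> x * f x) * (indicator \<Omega> x * g x)) = (\<lambda>x. indicator \<Omega> x * (f x * g x))"
    by (auto simp: indicator_def)
  ultimately show ?thesis unfolding bounded_meas_def by metis
qed

lemma bounded_meas_const: "\<Omega> \<in> sets borel \<Longrightarrow> bounded_meas \<Omega> (\<lambda>_. c)"
  by (auto simp: bounded_meas_def)

lemma bounded_meas_minus: "\<Omega> \<in> sets borel \<Longrightarrow> bounded_meas \<Omega> f \<Longrightarrow> bounded_meas \<Omega> (\<lambda>x. - f x)"
  using bounded_meas_mult[OF bounded_meas_const, of \<Omega> f "-1"] by simp

lemma bounded_meas_diff:
  "\<Omega> \<in> sets borel \<Longrightarrow> bounded_meas \<Omega> f \<Longrightarrow> bounded_meas \<Omega> g \<Longrightarrow> bounded_meas \<Omega> (\<lambda>x. f x - g x)"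
  using bounded_meas_add[of \<Omega> f "\<lambda>x. - g x"] bounded_meas_minus by simp

lemma bounded_meas_cong:
  assumes "bounded_meas \<Omega> f" "\<And>x. x \<in> \<Omega> \<Longrightarrow> f x = g x" shows "bounded_meas \<Omega> g"
proof -
  have "(\<lambda>x. indicator \<Omega> x * f x) = (\<lambda>x. indicator \<Omega> x * g x)"
    using assms(2) by (auto simp: indicator_def)
  thus ?thesis using assms unfolding bounded_meas_def by simp
qed

lemma bounded_meas_subset:
  assumes "bounded_meas \<Omega> f" "\<Omega>' \<subseteq> \<Omega>" "\<Omega>' \<in> sets borel" shows "bounded_meas \<Omega>' f"
proof -
  have "(\<lambda>x. indicator \<Omega>' x * (indicator \<Omega> x * f x)) \<in> borel_measurable borel"
    using borel_measurable_times[OF borel_measurable_indicator[OF assms(3)], of "\<lambda>x. indicator \<Omega> x * f x"] assms(1)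
    by (simp add: bounded_meas_def)
  moreover have "(\<lambda>x. indicator \<Omega>' x * (indicator \<Omega> x * f x)) = (\<lambda>x. indicator \<Omega>' x * f x)"
    using assms(2) by (intro ext) (auto simp: indicator_def)
  ultimately show ?thesis using assms(1,2) unfolding bounded_meas_def by (metis subsetD)
qed

lemma bounded_meas_continuous:
  assumes "\<Omega> \<in> sets borel" "continuous_on K f" "compact K" "\<Omega> \<subseteq> K"
  shows "bounded_meas \<Omega> f"
proof -
  have "(\<lambda>x. indicator \<Omega> x * f x) \<in> borel_measurable borel"
    using borel_measurable_continuous_on_indicator[OF assms(1) continuous_on_subset[OF assms(2,4)]] by simp
  moreover have "bounded (f ` K)" using assms by (intro compact_imp_bounded compact_continuous_image)
  then obtain C where "\<forall>x\<in>K. \<bar>f x\<bar> \<le> C" by (auto simp: bounded_iff)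
  ultimately show ?thesis using assms(4) by (auto simp: bounded_meas_def)
qed

lemma bounded_domI:
  assumes "\<Omega> \<in> sets borel" "compact K" "\<Omega> \<subseteq> K" "K \<subseteq> Rn n" shows "bounded_dom n \<Omega>"
proof -
  have "\<exists>b. \<forall>x\<in>K. \<bar>x i\<bar> \<le> b" for i
  proof -
    have "bounded ((\<lambda>x. x i) ` K)"
      by (intro compact_imp_bounded compact_continuous_image continuous_on_coord assms)
    thus ?thesis by (auto simp: bounded_iff)
  qed
  then obtain b where b: "\<And>i x. x \<in> K \<Longrightarrow> \<bar>x i\<bar> \<le> b i" by metis
  have "\<bar>x i\<bar> \<le> (\<Sum>i<n. \<bar>b i\<bar>)" if "x \<in> K" "i < n" for x i
  proof -
    have "\<bar>x i\<bar> \<le> \<bar>b i\<bar>" using b[OF that(1), of i] by linarith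
    also have "\<dots> \<le> (\<Sum>i<n. \<bar>b i\<bar>)" using that by (intro member_le_sum) auto
    finally show ?thesis .
  qed
  thus ?thesis using assms by (auto simp: bounded_dom_def)
qed

lemma set_integrable_bounded_meas:
  assumes "bounded_dom n \<Omega>" "bounded_meas \<Omega> f" shows "set_integrable (leb n) \<Omega> f"
proof -
  obtain C where C: "\<forall>x\<in>\<Omega>. \<bar>f x\<bar> \<le> C" using assms by (auto simp: bounded_meas_def)
  have "emeasure (leb n) \<Omega> < \<infinity>"
  proof -
    obtain b where "\<And>x i. x \<in> \<Omega> \<Longrightarrow> i < n \<Longrightarrow> \<bar>x i\<bar> \<le> b"
      using assms(1) by (auto simp: bounded_dom_def)
    thus ?thesis using assms(1) by (intro emeasure_leb_bounded[of \<Omega> n b] sets_leb) (auto simp: bounded_dom_def)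
  qed
  hence "integrable (leb n) (\<lambda>x. indicator \<Omega> x * f x)"
    using assms C by (intro integrableI_bounded_set[where A = \<Omega> and B = C])
      (auto simp: bounded_meas_def bounded_dom_def sets_leb intro!: measurable_leb)
  thus ?thesis by (simp add: set_integrable_def)
qed

lemma L2_on_bounded_meas:
  assumes "bounded_dom n \<Omega>" "bounded_meas \<Omega> f" shows "L2_on n \<Omega> f"
proof -
  have "set_borel_measurable (leb n) \<Omega> f"
    using assms measurable_leb by (auto simp: bounded_meas_def set_borel_measurable_def)
  moreover have "set_integrable (leb n) \<Omega> (\<lambda>x. (f x)\<^sup>2)"
    unfolding power2_eq_square
    using assms by (intro set_integrable_bounded_meas bounded_meas_mult)
  ultimately show ?thesis by (simp add: L2_on_def)
qed

lemma set_integral_cong_on: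
  "(\<And>x. x \<in> \<Omega> \<Longrightarrow> f x = g x) \<Longrightarrow> (LINT x:\<Omega>|M. f x) = (LINT x:\<Omega>|M. g x)" for f g :: "pt \<Rightarrow> real"
  unfolding set_lebesgue_integral_def by (intro Bochner_Integration.integral_cong) (auto simp: indicator_def)

lemma L2_norm_cong: "(\<And>x. x \<in> \<Omega> \<Longrightarrow> f x = g x) \<Longrightarrow> L2_norm n \<Omega> f = L2_norm n \<Omega> g"
  unfolding L2_norm_def by (subst set_integral_cong_on[of \<Omega> "\<lambda>x. (f x)\<^sup>2" "\<lambda>x. (g x)\<^sup>2"]) auto

lemma has_weak_gradient_cong:
  assumes "has_weak_gradient n \<Omega> u G" "\<And>x. x \<in> \<Omega> \<Longrightarrow> u x = v x"
  shows "has_weak_gradient n \<Omega> v G"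
proof -
  have "(LINT x:\<Omega>|leb n. v x * g x) = (LINT x:\<Omega>|leb n. u x * g x)" for g
    by (rule set_integral_cong_on) (simp add: assms(2))
  thus ?thesis using assms(1) by (simp add: has_weak_gradient_def)
qed

lemma L2_norm_tendsto_0:
  assumes \<Omega>: "bounded_dom n \<Omega>" and f: "\<And>k. bounded_meas \<Omega> (f k)"
    and C: "\<And>k x. x \<in> \<Omega> \<Longrightarrow> \<bar>f k x\<bar> \<le> C" and l: "\<And>x. x \<in> \<Omega> \<Longrightarrow> (\<lambda>k. f k x) \<longlonglongrightarrow> 0"
  shows "(\<lambda>k. L2_norm n \<Omega> (f k)) \<longlonglongrightarrow> 0"
proof -
  have b: "\<Omega> \<in> sets borel" using \<Omega> by (simp add: bounded_dom_def)
  have "(\<lambda>k. \<integral>x. indicator \<Omega> x * (f k x)\<^sup>2 \<partial>leb n) \<longlonglongrightarrow> (\<integral>x. 0 \<partial>leb n)"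
  proof (rule integral_dominated_convergence[where w = "\<lambda>x. indicator \<Omega> x * C\<^sup>2"])
    show "integrable (leb n) (\<lambda>x. indicator \<Omega> x * C\<^sup>2)"
      using set_integrable_bounded_meas[OF \<Omega> bounded_meas_const[OF b]] by (simp add: set_integrable_def)
    show "AE x in leb n. (\<lambda>k. indicator \<Omega> x * (f k x)\<^sup>2) \<longlonglongrightarrow> 0"
    proof (intro AE_I2)
      fix x show "(\<lambda>k. indicator \<Omega> x * (f k x)\<^sup>2) \<longlonglongrightarrow> 0"
        using tendsto_power[OF l, of x 2] by (cases "x \<in> \<Omega>") auto
    qed
    show "AE x in leb n. norm (indicator \<Omega> x * (f k x)\<^sup>2) \<le> indicator \<Omega> x * C\<^sup>2" for k
    proof (intro AE_I2)
      fix x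
      have "x \<in> \<Omega> \<Longrightarrow> (f k x)\<^sup>2 \<le> C\<^sup>2" using C[of x k] by (metis abs_ge_zero power2_abs power_mono)
      thus "norm (indicator \<Omega> x * (f k x)\<^sup>2) \<le> indicator \<Omega> x * C\<^sup>2" by (auto simp: indicator_def)
    qed
    show "(\<lambda>x. indicator \<Omega> x * (f k x)\<^sup>2) \<in> borel_measurable (leb n)" for k
      using bounded_meas_mult[OF f f, of k k] measurable_leb by (auto simp: bounded_meas_def power2_eq_square)
  qed simp
  from tendsto_real_sqrt[OF this] show ?thesis
    by (simp add: L2_norm_def set_lebesgue_integral_def)
qed

section \<open>Weak derivatives and traces\<close>

text \<open>The same compact set K works: its complement is relatively open and the function
  vanishes there, hence so do its derivatives.\<close>

lemma test_function_partial:
  assumes "test_function n \<Omega> \<phi>" "i < n" shows "test_function n \<Omega> (partial i \<phi>)"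
proof -
  obtain K where K: "K \<subseteq> \<Omega>" "compactin (Euclidean_space n) K" "\<And>x. x \<in> Rn n - K \<Longrightarrow> \<phi> x = 0"
    and s: "smooth_on n (Rn n) \<phi>" using assms(1) unfolding test_function_def by blast
  have "K \<subseteq> Rn n" "closed K" using K(2) by (auto simp: compactin_Rn_iff compact_imp_closed)
  hence o: "openin (Euclidean_space n) (Rn n - K)"
    unfolding openin_Rn_iff by (intro exI[of _ "- K"]) auto
  have "has_partial (Rn n - K) i \<phi> (\<lambda>_. 0)"
    by (rule has_partial_cong[OF o assms(2) _ has_partial_const[of _ _ 0]]) (simp add: K(3))
  hence "partial i \<phi> x = 0" if "x \<in> Rn n - K" for x
    using has_partial_imp_partial that by blast
  thus ?thesis unfolding test_function_def using K(1,2) smooth_onD(4)[OF s assms(2)] by blast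
qed

lemma test_function_bounded_meas:
  assumes t: "test_function n \<Omega> \<phi>" and o: "\<Omega> \<in> sets borel" "\<Omega> \<subseteq> Rn n" shows "bounded_meas \<Omega> \<phi>"
proof -
  obtain K where K: "K \<subseteq> \<Omega>" "compactin (Euclidean_space n) K" "\<And>x. x \<in> Rn n - K \<Longrightarrow> \<phi> x = 0"
    and s: "smooth_on n (Rn n) \<phi>" using t unfolding test_function_def by blast
  have c: "continuous_on (Rn n) \<phi>" using s by (rule smooth_onD)
  have K': "compact K" "K \<subseteq> Rn n" using K(2) by (auto simp: compactin_Rn_iff)
  have "bounded (\<phi> ` K)"
    using K' c by (intro compact_imp_bounded compact_continuous_image) (auto intro: continuous_on_subset)
  then obtain C where C: "\<forall>x\<in>K. \<bar>\<phi> x\<bar> \<le> C" by (auto simp: bounded_iff)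
  have "\<bar>\<phi> x\<bar> \<le> \<bar>C\<bar>" if "x \<in> \<Omega>" for x
    using C K(3)[of x] that o(2) by (cases "x \<in> K") force+
  moreover have "(\<lambda>x. indicator \<Omega> x *\<^sub>R \<phi> x) \<in> borel_measurable borel"
    by (rule borel_measurable_continuous_on_indicator[OF o(1) continuous_on_subset[OF c o(2)]])
  ultimately show ?thesis by (auto simp: bounded_meas_def)
qed

text \<open>On every line parallel to the \<open>i\<close>-th axis, \<open>u\<close> is an antiderivative of \<open>g\<close> away from finitely
  many points; as \<open>u\<close> is continuous, \<open>g\<close> is then the weak derivative of \<open>u\<close>.\<close>

definition line_deriv :: "nat \<Rightarrow> pt set \<Rightarrow> nat \<Rightarrow> (pt \<Rightarrow> real) \<Rightarrow> (pt \<Rightarrow> real) \<Rightarrow> bool" where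
  "line_deriv n \<Omega> i u g \<longleftrightarrow> continuous_on \<Omega> u \<and>
     (\<forall>x\<in>Rn n. \<exists>E. finite E \<and>
        (\<forall>t. x(i := t) \<in> \<Omega> \<and> t \<notin> E \<longrightarrow> ((\<lambda>t. u (x(i := t))) has_real_derivative g (x(i := t))) (at t)))"

lemma integral_lborel_compact_deriv:
  fixes v w :: "real \<Rightarrow> real"
  assumes E: "finite E" and c: "continuous_on UNIV v"
    and d: "\<And>t. t \<notin> E \<Longrightarrow> (v has_real_derivative w t) (at t)"
    and z: "\<And>t. \<bar>t\<bar> > b \<Longrightarrow> v t = 0 \<and> w t = 0"
    and w: "w \<in> borel_measurable borel" "\<And>t. \<bar>w t\<bar> \<le> C"
  shows "(\<integral>t. w t \<partial>lborel) = 0"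
proof -
  \<comment> \<open>This makes a positive and larger than b, so that v vanishes at both
    endpoints.\<close>
  define a where "a = \<bar>b\<bar> + 1"
  have "(w has_integral (v a - v (-a))) {-a..a}"
    using E d c by (intro fundamental_theorem_of_calculus_interior_strong[of E])
      (auto simp: a_def has_real_derivative_iff_has_vector_derivative intro: continuous_on_subset)
  moreover have "v a = 0" "v (-a) = 0" using z[of a] z[of "-a"] by (auto simp: a_def)
  ultimately have "(w has_integral 0) {-a..a}" by simp
  hence 1: "(w has_integral 0) UNIV"
    by (rule has_integral_on_superset) (use z in \<open>auto simp: a_def\<close>)
  have "integrable lborel w"
  proof (rule integrableI_bounded_set[where A = "{-a..a}" and B = C])
    show "AE x in lborel. x \<notin> {-a..a} \<longrightarrow> w x = 0"
      using z by (intro AE_I2) (auto simp: a_def)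
  qed (use w in \<open>auto simp: emeasure_lborel_Icc_eq\<close>)
  from has_integral_integral_lborel[OF this] 1 show ?thesis
    using has_integral_unique by blast
qed

text \<open>On each line the product of u and the test function, extended by 0, is continuous with
  compact support, and off finitely many points its derivative is the integrand w. So w integrates
  to 0 on every line, and Fubini concludes.\<close>

lemma weak_derivative_line_deriv:
  assumes o: "openin (Euclidean_space n) \<Omega>" and \<Omega>: "bounded_dom n \<Omega>" and i: "i < n"
    and b: "bounded_meas \<Omega> u" "bounded_meas \<Omega> g" and l: "line_deriv n \<Omega> i u g"
    and t: "test_function n \<Omega> \<phi>"
  shows "(LINT x:\<Omega>|leb n. u x * partial i \<phi> x) = - (LINT x:\<Omega>|leb n. g x * \<phi> x)"
proof -
  obtain K where K: "K \<subseteq> \<Omega>" "compactin (Euclidean_space n) K" "\<And>x. x \<in> Rn n - K \<Longrightarrow> \<phi> x = 0"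
    and s: "smooth_on n (Rn n) \<phi>" using t unfolding test_function_def by blast
  have \<Omega>': "\<Omega> \<in> sets borel" "\<Omega> \<subseteq> Rn n" using \<Omega> by (auto simp: bounded_dom_def)
  have K': "closed K" "K \<subseteq> Rn n" using K(2) by (auto simp: compactin_Rn_iff compact_imp_closed)
  note bm = test_function_bounded_meas[OF t \<Omega>'] test_function_bounded_meas[OF test_function_partial[OF t i] \<Omega>']
  have m1: "bounded_meas \<Omega> (\<lambda>x. u x * partial i \<phi> x)" and m2: "bounded_meas \<Omega> (\<lambda>x. g x * \<phi> x)"
    using b bm by (auto intro: bounded_meas_mult)
  have m: "bounded_meas \<Omega> (\<lambda>x. u x * partial i \<phi> x + g x * \<phi> x)" by (rule bounded_meas_add[OF m1 m2])
  define w where "w x = indicator \<Omega> x * (u x * partial i \<phi> x + g x * \<phi> x)" for x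
  have wm: "w \<in> borel_measurable borel" using m by (simp add: bounded_meas_def w_def[abs_def])
  have wi: "integrable (leb n) w"
    using set_integrable_bounded_meas[OF \<Omega> m] by (simp add: set_integrable_def w_def[abs_def])
  obtain B where B: "\<And>x i. x \<in> \<Omega> \<Longrightarrow> i < n \<Longrightarrow> \<bar>x i\<bar> \<le> B" using \<Omega> by (auto simp: bounded_dom_def)
  obtain C where "\<forall>x\<in>\<Omega>. \<bar>u x * partial i \<phi> x + g x * \<phi> x\<bar> \<le> C" using m by (auto simp: bounded_meas_def)
  hence C: "\<bar>w x\<bar> \<le> \<bar>C\<bar>" for x by (cases "x \<in> \<Omega>") (auto simp: w_def)
  have "(\<integral>x. w x \<partial>leb n) = 0"
  proof (rule integral_leb_line_zero[OF wm wi i])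
    fix x assume x: "x \<in> Rn n"
    obtain E where E: "finite E"
      "\<And>t. x(i := t) \<in> \<Omega> \<Longrightarrow> t \<notin> E \<Longrightarrow> ((\<lambda>t. u (x(i := t))) has_real_derivative g (x(i := t))) (at t)"
      using l x unfolding line_deriv_def by blast
    define v where "v t = (if x(i := t) \<in> \<Omega> then u (x(i := t)) * \<phi> (x(i := t)) else 0)" for t
    have oin: "open {t. x(i := t) \<in> \<Omega>}" by (rule open_line[OF o i x])
    have "closed ((\<lambda>t. x(i := t)) -` K)" by (rule closed_vimage[OF K'(1) continuous_on_upd])
    hence oout: "open {t. x(i := t) \<notin> K}" by (simp add: closed_def vimage_def Collect_neg_eq[symmetric])
    have v0: "v t = 0" if "x(i := t) \<notin> K" for t
      using K(3)[of "x(i := t)"] upd_in_Rn[OF x i] that by (auto simp: v_def)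
    have w0: "w (x(i := t)) = 0" if "x(i := t) \<notin> \<Omega>" for t using that by (simp add: w_def)
    \<comment> \<open>Outside \<Omega> a whole neighbourhood misses the closed set K, where the test
      function is supported, so the extension by 0 is locally constant.\<close>
    have d0: "(v has_real_derivative w (x(i := t))) (at t)" if "x(i := t) \<notin> \<Omega>" for t
      unfolding w0[OF that]
      by (rule has_field_derivative_transform_within_open[OF _ oout, where f = "\<lambda>_. 0"])
         (use that K(1) v0 in auto)
    have d\<phi>: "((\<lambda>t. \<phi> (x(i := t))) has_real_derivative partial i \<phi> (x(i := t))) (at t)" for t
    proof -
      have "x(i := t) \<in> Rn n" by (rule upd_in_Rn[OF x i])
      with smooth_onD(3)[OF s i] have "((\<lambda>t'. \<phi> ((x(i := t))(i := t'))) has_real_derivative partial i \<phi> (x(i := t))) (at ((x(i := t)) i))"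
        unfolding has_partial_def by blast
      thus ?thesis by simp
    qed
    have d1: "(v has_real_derivative w (x(i := t))) (at t)" if "x(i := t) \<in> \<Omega>" "t \<notin> E" for t
    proof (rule has_field_derivative_transform_within_open[OF _ oin, where f = "\<lambda>t. u (x(i := t)) * \<phi> (x(i := t))"])
      show "((\<lambda>t. u (x(i := t)) * \<phi> (x(i := t))) has_real_derivative w (x(i := t))) (at t)"
        using DERIV_mult[OF E(2)[OF that] d\<phi>] that by (simp add: w_def mult.commute add.commute)
    qed (use that in \<open>auto simp: v_def\<close>)
    have cin: "continuous_on {t. x(i := t) \<in> \<Omega>} v"
    proof -
      have cu: "continuous_on {t. x(i := t) \<in> \<Omega>} (\<lambda>t. u (x(i := t)))"
        by (rule continuous_on_compose2[OF _ continuous_on_subset[OF continuous_on_upd subset_UNIV]])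
           (use l in \<open>auto simp: line_deriv_def\<close>)
      have c\<phi>: "continuous_on {t. x(i := t) \<in> \<Omega>} (\<lambda>t. \<phi> (x(i := t)))"
        by (rule DERIV_continuous_on[where D = "\<lambda>t. partial i \<phi> (x(i := t))"])
           (use d\<phi> has_field_derivative_at_within in blast)
      have "continuous_on {t. x(i := t) \<in> \<Omega>} (\<lambda>t. u (x(i := t)) * \<phi> (x(i := t)))"
        by (rule continuous_on_mult[OF cu c\<phi>])
      thus ?thesis by (subst continuous_on_cong[OF refl]) (auto simp: v_def)
    qed
    have cont: "isCont v t" for t
    proof (cases "x(i := t) \<in> \<Omega>")
      case True
      thus ?thesis using cin oin by (simp add: continuous_on_eq_continuous_at)
    next
      case False
      from DERIV_isCont[OF d0[OF this]] show ?thesis .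
    qed
    show "(\<integral>t. w (x(i := t)) \<partial>lborel) = 0"
    proof (rule integral_lborel_compact_deriv[OF E(1), where v = v and b = B and C = "\<bar>C\<bar>"])
      show "continuous_on UNIV v" using cont by (simp add: continuous_at_imp_continuous_on)
      show "(v has_real_derivative w (x(i := t))) (at t)" if "t \<notin> E" for t
        using d0[of t] d1[of t] that by blast
      show "v t = 0 \<and> w (x(i := t)) = 0" if "\<bar>t\<bar> > B" for t
      proof -
        have "x(i := t) \<notin> \<Omega>" using B[of "x(i := t)" i] i that by auto
        thus ?thesis using w0 by (simp add: v_def)
      qed
      have "(\<lambda>t. x(i := t)) \<in> borel_measurable borel"
        by (rule borel_measurable_continuous_onI[OF continuous_on_upd])
      from measurable_compose[OF this wm] show "(\<lambda>t. w (x(i := t))) \<in> borel_measurable borel" .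
      show "\<bar>w (x(i := t))\<bar> \<le> \<bar>C\<bar>" for t by (rule C)
    qed
  qed
  moreover have "(\<integral>x. w x \<partial>leb n) = (LINT x:\<Omega>|leb n. u x * partial i \<phi> x) + (LINT x:\<Omega>|leb n. g x * \<phi> x)"
    using set_integral_add(2)[OF set_integrable_bounded_meas[OF \<Omega> m1] set_integrable_bounded_meas[OF \<Omega> m2]]
    by (simp only: set_lebesgue_integral_def w_def real_scaleR_def)
  ultimately show ?thesis by linarith
qed

lemma has_weak_gradient_line_deriv:
  assumes "openin (Euclidean_space n) \<Omega>" "bounded_dom n \<Omega>" "bounded_meas \<Omega> u"
    "\<And>i. i < n \<Longrightarrow> bounded_meas \<Omega> (G i)" "\<And>i. i < n \<Longrightarrow> line_deriv n \<Omega> i u (G i)"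
  shows "has_weak_gradient n \<Omega> u G"
  unfolding has_weak_gradient_def
proof (intro allI impI conjI)
  fix i \<phi> assume i: "i < n"
  show "L2_on n \<Omega> (G i)" by (rule L2_on_bounded_meas[OF assms(2) assms(4)[OF i]])
  assume "test_function n \<Omega> \<phi>"
  thus "(LINT x:\<Omega>|leb n. u x * partial i \<phi> x) = - (LINT x:\<Omega>|leb n. G i x * \<phi> x)"
    by (rule weak_derivative_line_deriv[OF assms(1,2) i assms(3) assms(4)[OF i] assms(5)[OF i]])
qed

lemma has_partial_line_deriv:
  assumes "continuous_on \<Omega> u" "has_partial \<Omega> i u g" shows "line_deriv n \<Omega> i u g"
  unfolding line_deriv_def
proof (intro conjI ballI exI[of _ "{}"] allI impI)
  fix x t assume "x(i := t) \<in> \<Omega> \<and> t \<notin> {}"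
  hence "((\<lambda>t'. u ((x(i := t))(i := t'))) has_real_derivative g (x(i := t))) (at ((x(i := t)) i))"
    using assms(2) unfolding has_partial_def by blast
  thus "((\<lambda>t. u (x(i := t))) has_real_derivative g (x(i := t))) (at t)" by simp
qed (use assms in auto)

section \<open>Functions smooth up to the boundary\<close>

text \<open>The compact set in between bounds every function smooth on W, with all its derivatives,
  on \<Omega>, and keeps the closure of \<Omega> inside W.\<close>

definition compactly_in :: "nat \<Rightarrow> pt set \<Rightarrow> pt set \<Rightarrow> bool" where
  "compactly_in n \<Omega> W \<longleftrightarrow> openin (Euclidean_space n) \<Omega> \<and> (\<exists>K. compact K \<and> \<Omega> \<subseteq> K \<and> K \<subseteq> W)"

lemma compactly_in_bounded_dom:
  "compactly_in n \<Omega> W \<Longrightarrow> W \<subseteq> Rn n \<Longrightarrow> bounded_dom n \<Omega>"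
  unfolding compactly_in_def using bounded_domI openin_Rn_borel by (meson subset_trans)

lemma smooth_on_bounded_meas:
  assumes "smooth_on n W f" "compactly_in n \<Omega> W" shows "bounded_meas \<Omega> f"
proof -
  obtain K where "compact K" "\<Omega> \<subseteq> K" "K \<subseteq> W" "openin (Euclidean_space n) \<Omega>"
    using assms by (auto simp: compactly_in_def)
  thus ?thesis
    using smooth_onD(2)[OF assms(1)] openin_Rn_borel by (intro bounded_meas_continuous[of \<Omega> K]) (auto intro: continuous_on_subset)
qed

lemma smooth_on_has_weak_gradient:
  assumes f: "smooth_on n W f" and c: "compactly_in n \<Omega> W"
  shows "has_weak_gradient n \<Omega> f (\<lambda>i. partial i f)"
proof (rule has_weak_gradient_line_deriv)
  have W: "W \<subseteq> Rn n" using smooth_onD(1)[OF f] by (rule openin_Rn_subset)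
  have "\<Omega> \<subseteq> W" using c by (auto simp: compactly_in_def)
  show "openin (Euclidean_space n) \<Omega>" using c by (simp add: compactly_in_def)
  show "bounded_dom n \<Omega>" by (rule compactly_in_bounded_dom[OF c W])
  show "bounded_meas \<Omega> f" by (rule smooth_on_bounded_meas[OF f c])
  fix i assume i: "i < n"
  show "bounded_meas \<Omega> (partial i f)" by (rule smooth_on_bounded_meas[OF smooth_onD(4)[OF f i] c])
  show "line_deriv n \<Omega> i f (partial i f)"
    using smooth_onD(3)[OF f i] \<open>\<Omega> \<subseteq> W\<close> continuous_on_subset[OF smooth_onD(2)[OF f] \<open>\<Omega> \<subseteq> W\<close>]
    by (intro has_partial_line_deriv) (auto simp: has_partial_def)
qed

lemma smooth_on_L2_on:
  assumes f: "smooth_on n W f" and c: "compactly_in n \<Omega> W" and eq: "\<And>x. x \<in> \<Omega> \<Longrightarrow> f x = u x"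
  shows "L2_on n \<Omega> u"
proof (rule L2_on_bounded_meas)
  show "bounded_dom n \<Omega>"
    by (rule compactly_in_bounded_dom[OF c openin_Rn_subset[OF smooth_onD(1)[OF f]]])
  show "bounded_meas \<Omega> u" by (rule bounded_meas_cong[OF smooth_on_bounded_meas[OF f c] eq])
qed

lemma smooth_on_H1:
  assumes f: "smooth_on n W f" and c: "compactly_in n \<Omega> W" and eq: "\<And>x. x \<in> \<Omega> \<Longrightarrow> f x = u x"
  shows "H1 n \<Omega> u"
  unfolding H1_def
  using smooth_on_L2_on[OF assms] has_weak_gradient_cong[OF smooth_on_has_weak_gradient[OF f c] eq] by blast

lemma smooth_on_H2:
  assumes f: "smooth_on n W f" and c: "compactly_in n \<Omega> W" and eq: "\<And>x. x \<in> \<Omega> \<Longrightarrow> f x = u x"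
  shows "H2 n \<Omega> u"
  unfolding H2_def
proof (intro conjI exI[of _ "\<lambda>i. partial i f"] allI impI)
  fix i assume "i < n"
  show "H1 n \<Omega> (partial i f)" by (rule smooth_on_H1[OF smooth_onD(4)[OF f \<open>i < n\<close>] c refl])
qed (use smooth_on_L2_on[OF assms] has_weak_gradient_cong[OF smooth_on_has_weak_gradient[OF f c] eq] in auto)

text \<open>Since f extends u smoothly beyond the boundary, the constant sequence f is an admissible
  approximation and its restriction to S is the trace.\<close>

lemma smooth_on_has_trace:
  assumes f: "smooth_on n W f" and c: "compactly_in n \<Omega> W" and eq: "\<And>x. x \<in> \<Omega> \<Longrightarrow> f x = u x"
    and S: "S \<in> sets borel" "S \<subseteq> W"
  shows "has_trace n \<Omega> S u f"
  unfolding has_trace_def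
proof (intro conjI exI[of _ "\<lambda>_. f"] allI)
  show "H1 n \<Omega> u" by (rule smooth_on_H1[OF f c eq])
  obtain K where K: "compact K" "\<Omega> \<subseteq> K" "K \<subseteq> W" using c by (auto simp: compactly_in_def)
  have W: "W \<subseteq> Rn n" using smooth_onD(1)[OF f] by (rule openin_Rn_subset)
  have "closedin (Euclidean_space n) K"
    using K W compact_imp_closed by (auto simp: closedin_Euclidean_space_iff)
  hence "Euclidean_space n closure_of \<Omega> \<subseteq> K" using K(2) by (simp add: closure_of_minimal)
  thus "smooth_up_to_boundary n \<Omega> f"
    unfolding smooth_up_to_boundary_def using f K(3) by blast
  show "H1_approximates n \<Omega> (\<lambda>_. f) u"
    unfolding H1_approximates_def
  proof (intro conjI exI[of _ "\<lambda>i. partial i f"] allI impI)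
    have "L2_norm n \<Omega> (\<lambda>x. f x - u x) = 0"
      using L2_norm_cong[of \<Omega> "\<lambda>x. f x - u x" "\<lambda>_. 0"] eq by (simp add: L2_norm_def)
    thus "(\<lambda>k. L2_norm n \<Omega> (\<lambda>x. f x - u x)) \<longlonglongrightarrow> 0" by simp
    show "has_weak_gradient n \<Omega> u (\<lambda>i. partial i f)"
      by (rule has_weak_gradient_cong[OF smooth_on_has_weak_gradient[OF f c] eq])
  qed (simp add: L2_norm_def)
  show "(\<lambda>k. \<integral>\<^sup>+x. ennreal ((f x - f x)\<^sup>2) \<partial>surface_measure n S) \<longlonglongrightarrow> 0" by simp
  have subS: "{A \<in> sets borel. A \<subseteq> S} \<subseteq> Pow S" by auto
  have ss: "sets (surface_measure n S) = sigma_sets S {A \<in> sets borel. A \<subseteq> S}"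
    and sp: "space (surface_measure n S) = S"
    unfolding surface_measure_def using subS by (simp_all add: sets_measure_of space_measure_of)
  show "f \<in> borel_measurable (surface_measure n S)"
  proof (rule measurableI)
    fix A :: "real set" assume A: "A \<in> sets borel"
    have "f \<in> borel_measurable (restrict_space borel S)"
      by (rule borel_measurable_continuous_on_restrict[OF continuous_on_subset[OF smooth_onD(2)[OF f] S(2)]])
    from measurable_sets[OF this A] have "f -` A \<inter> S \<in> sets (restrict_space borel S)"
      by (simp add: space_restrict_space)
    hence "f -` A \<inter> S \<in> sets borel" using S(1) by (simp add: sets_restrict_space_iff)
    thus "f -` A \<inter> space (surface_measure n S) \<in> sets (surface_measure n S)"
      unfolding ss sp by (intro sigma_sets.Basic) auto
  qed simp
qed

lemma smooth_on_has_normal_trace: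
  assumes f: "smooth_on n W f" and c: "compactly_in n \<Omega> W" and eq: "\<And>x. x \<in> \<Omega> \<Longrightarrow> f x = u x"
    and S: "S \<in> sets borel" "S \<subseteq> W"
  shows "has_normal_trace n \<Omega> S \<nu> u (\<lambda>x. \<Sum>i<n. \<nu> x i * partial i f x)"
  unfolding has_normal_trace_def
proof (intro exI[of _ "\<lambda>i. partial i f"] conjI allI impI ballI)
  show "has_weak_gradient n \<Omega> u (\<lambda>i. partial i f)"
    by (rule has_weak_gradient_cong[OF smooth_on_has_weak_gradient[OF f c] eq])
  fix i assume "i < n"
  show "has_trace n \<Omega> S (partial i f) (partial i f)"
    by (rule smooth_on_has_trace[OF smooth_onD(4)[OF f \<open>i < n\<close>] c refl S])
qed simp

section \<open>Bessel profiles\<close>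

definition bes_coeff :: "nat \<Rightarrow> nat \<Rightarrow> real" where
  "bes_coeff k j = (-1) ^ j * fact k / (fact j * fact (k + j))"

text \<open>Up to a factor, \<open>r\<^sup>k * bes k (\<lambda> r\<^sup>2 / 4)\<close> is the Bessel function \<open>J\<^sub>k (sqrt \<lambda> * r)\<close>.\<close>

definition bes :: "nat \<Rightarrow> real \<Rightarrow> real" where
  "bes k y = (\<Sum>j. bes_coeff k j * y ^ j)"

text \<open>Differentiating the series termwise raises the index; this is the classical rule (z^(-k)
  J_k)' = - z^(-k) J_(k+1), written in y = z^2/4.\<close>

definition bes' :: "nat \<Rightarrow> real \<Rightarrow> real" where
  "bes' k y = - bes (Suc k) y / real (Suc k)"

lemma summable_bes: "summable (\<lambda>j. bes_coeff k j * y ^ j)"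
proof (rule summable_comparison_test'[where N = 0])
  show "summable (\<lambda>j. \<bar>y\<bar> ^ j / fact j)"
    using summable_exp[of "\<bar>y\<bar>"] by (simp add: field_simps)
  fix j :: nat
  have "fact k \<le> (fact (k + j) :: real)" by (rule fact_mono) simp
  hence "fact k * \<bar>y\<bar> ^ j / (fact j * fact (k + j)) \<le> fact (k + j) * \<bar>y\<bar> ^ j / (fact j * fact (k + j))"
    by (intro divide_right_mono mult_right_mono) auto
  thus "norm (bes_coeff k j * y ^ j) \<le> \<bar>y\<bar> ^ j / fact j"
    by (simp add: bes_coeff_def abs_mult power_abs)
qed

lemma bes_0 [simp]: "bes k 0 = 1"
  unfolding bes_def using powser_zero[of "bes_coeff k"] by (simp add: bes_coeff_def)

lemma bes_has_derivative: "(bes k has_real_derivative bes' k y) (at y)"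
proof -
  have "diffs (bes_coeff k) j = - bes_coeff (Suc k) j / real (Suc k)" for j
    unfolding diffs_def bes_coeff_def by (simp add: divide_simps fact_reduce)
  hence "diffs (bes_coeff k) j * y ^ j = (- 1 / real (Suc k)) * (bes_coeff (Suc k) j * y ^ j)" for j
    by simp
  hence "(\<Sum>j. diffs (bes_coeff k) j * y ^ j) = (\<Sum>j. (- 1 / real (Suc k)) * (bes_coeff (Suc k) j * y ^ j))"
    by (rule suminf_cong)
  also have "\<dots> = (- 1 / real (Suc k)) * bes (Suc k) y"
    unfolding bes_def by (rule suminf_mult[OF summable_bes])
  finally have "(\<Sum>j. diffs (bes_coeff k) j * y ^ j) = bes' k y" by (simp add: bes'_def)
  with termdiffs_strong_converges_everywhere[of "bes_coeff k" y, OF summable_bes]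
  show ?thesis unfolding bes_def[abs_def] by simp
qed

lemma smoothR_bes: "smoothR I (bes k)"
proof -
  \<comment> \<open>The scalar c belongs to the induction statement because each derivative is a
    multiple of the function of the next index.\<close>
  have d: "CkR I m (\<lambda>y. c * bes k y)" for m c k
  proof (induction m arbitrary: c k)
    case 0
    show ?case unfolding CkR.simps
      by (rule DERIV_continuous_on[OF has_field_derivative_at_within[OF DERIV_cmult[OF bes_has_derivative]]])
  next
    case (Suc m)
    have "CkR I m (\<lambda>y. (- c / real (Suc k)) * bes (Suc k) y)" by (rule Suc)
    hence *: "CkR I m (\<lambda>y. c * bes' k y)" by (simp add: bes'_def divide_simps)
    show ?case by (rule CkR_SucI[OF _ *]) (intro DERIV_cmult bes_has_derivative)
  qed
  from d[of _ 1] show ?thesis by (simp add: smoothR_def)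
qed

lemma bes'_has_derivative: "(bes' k has_real_derivative bes (Suc (Suc k)) y / (real (Suc k) * real (Suc (Suc k)))) (at y)"
  unfolding bes'_def[abs_def]
  by (rule derivative_eq_intros bes_has_derivative | simp add: bes'_def)+

lemma continuous_on_bes: "continuous_on A (bes k)" "continuous_on A (bes' k)"
  by (rule DERIV_continuous_on[OF has_field_derivative_at_within[OF bes_has_derivative]])
     (rule DERIV_continuous_on[OF has_field_derivative_at_within[OF bes'_has_derivative]])

text \<open>The relation J_k + J_(k+2) = 2 (k+1) / z * J_(k+1) in the variable y = z^2/4. The
  constant terms, all equal to 1, are split off and the remaining coefficients compared one by
  one.\<close>

lemma bes_recurrence:
  "y * (bes (Suc (Suc k)) y / (real (Suc k) * real (Suc (Suc k)))) + bes k y = bes (Suc k) y"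
proof -
  let ?c = "1 / (real (Suc k) * real (Suc (Suc k)))"
  have rec: "bes_coeff k (Suc j) + ?c * bes_coeff (Suc (Suc k)) j = bes_coeff (Suc k) (Suc j)" for j
    unfolding bes_coeff_def by (simp add: divide_simps fact_reduce) (simp add: algebra_simps)
  have s: "bes l y = 1 + (\<Sum>j. bes_coeff l (Suc j) * y ^ Suc j)" for l
    using suminf_split_head[OF summable_bes[of l y]] by (simp add: bes_def bes_coeff_def)
  have sm: "summable (\<lambda>j. bes_coeff l (Suc j) * y ^ Suc j)" for l
    using summable_Suc_iff[of "\<lambda>j. bes_coeff l j * y ^ j"] summable_bes by blast
  have "y * ?c * bes (Suc (Suc k)) y = (\<Sum>j. y * ?c * (bes_coeff (Suc (Suc k)) j * y ^ j))"
    unfolding bes_def by (rule suminf_mult[OF summable_bes, symmetric])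
  moreover have "summable (\<lambda>j. y * ?c * (bes_coeff (Suc (Suc k)) j * y ^ j))"
    by (rule summable_mult[OF summable_bes])
  ultimately have "y * ?c * bes (Suc (Suc k)) y + bes k y
      = 1 + (\<Sum>j. y * ?c * (bes_coeff (Suc (Suc k)) j * y ^ j) + bes_coeff k (Suc j) * y ^ Suc j)"
    using suminf_add[OF _ sm[of k]] s[of k] by simp
  also have "(\<lambda>j. y * ?c * (bes_coeff (Suc (Suc k)) j * y ^ j) + bes_coeff k (Suc j) * y ^ Suc j)
     = (\<lambda>j. bes_coeff (Suc k) (Suc j) * y ^ Suc j)"
    unfolding rec[symmetric] by (simp add: algebra_simps)
  finally show ?thesis using s[of "Suc k"] by simp
qed

text \<open>Bessel's equation in the variable y: the fraction is the second derivative of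
  \<open>bes k\<close>, and the recurrence above is exactly this equation once
  \<open>bes (Suc k)\<close> is expressed through \<open>bes'\<close>.\<close>

lemma bes_ode:
  "y * (bes (Suc (Suc k)) y / (real (Suc k) * real (Suc (Suc k)))) + (real k + 1) * bes' k y + bes k y = 0"
  using bes_recurrence[of y k] by (simp add: bes'_def divide_simps) (simp add: algebra_simps)

text \<open>In the logarithmic variable \<open>t = ln r\<close> Bessel's equation reads \<open>g'' = (k\<^sup>2 - 4 c exp (2 t)) g\<close>.\<close>

definition besg :: "nat \<Rightarrow> real \<Rightarrow> real \<Rightarrow> real" where
  "besg k c t = exp (k * t) * bes k (c * exp (2 * t))"

definition besg' :: "nat \<Rightarrow> real \<Rightarrow> real \<Rightarrow> real" where
  "besg' k c t = exp (k * t) * (k * bes k (c * exp (2 * t)) + 2 * (c * exp (2 * t)) * bes' k (c * exp (2 * t)))"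

lemma besg_has_derivative: "(besg k c has_real_derivative besg' k c t) (at t)"
proof -
  have 1: "((\<lambda>t. c * exp (2 * t)) has_real_derivative 2 * (c * exp (2 * t))) (at t)"
    by (rule derivative_eq_intros refl | simp)+
  have 2: "((\<lambda>t. exp (k * t)) has_real_derivative k * exp (k * t)) (at t)"
    by (rule derivative_eq_intros refl | simp)+
  show ?thesis unfolding besg_def[abs_def] besg'_def
    by (rule DERIV_cong[OF DERIV_mult[OF 2 DERIV_chain2[OF bes_has_derivative 1]]]) (simp add: algebra_simps)
qed

lemma besg'_has_derivative:
  "(besg' k c has_real_derivative (k\<^sup>2 - 4 * (c * exp (2 * t))) * besg k c t) (at t)"
proof -
  have 1: "((\<lambda>t. c * exp (2 * t)) has_real_derivative 2 * (c * exp (2 * t))) (at t)"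
    by (rule derivative_eq_intros refl | simp)+
  have 2: "((\<lambda>t. exp (k * t)) has_real_derivative k * exp (k * t)) (at t)"
    by (rule derivative_eq_intros refl | simp)+
  let ?y = "c * exp (2 * t)"
  let ?b2 = "bes (Suc (Suc k)) ?y / (real (Suc k) * real (Suc (Suc k)))"
  have d: "(besg' k c has_real_derivative k * exp (k * t) * (k * bes k ?y + 2 * ?y * bes' k ?y)
     + (k * (bes' k ?y * (2 * ?y)) + (2 * (2 * ?y) * bes' k ?y + ?b2 * (2 * ?y) * (2 * ?y))) * exp (k * t)) (at t)"
    unfolding besg'_def[abs_def]
    by (rule DERIV_mult[OF 2] DERIV_add DERIV_cmult DERIV_mult[OF DERIV_cmult[OF 1]]
        DERIV_chain2[OF bes_has_derivative 1] DERIV_chain2[OF bes'_has_derivative 1])+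
  have "k * exp (k * t) * (k * bes k ?y + 2 * ?y * bes' k ?y)
     + (k * (bes' k ?y * (2 * ?y)) + (2 * (2 * ?y) * bes' k ?y + ?b2 * (2 * ?y) * (2 * ?y))) * exp (k * t)
     = exp (k * t) * (real k ^ 2 * bes k ?y + 4 * ?y * (?y * ?b2 + (real k + 1) * bes' k ?y))"
    by (simp only: algebra_simps power2_eq_square)
  also have "?y * ?b2 + (real k + 1) * bes' k ?y = - bes k ?y"
    using bes_ode[of ?y k] by linarith
  finally show ?thesis
    by (intro DERIV_cong[OF d]) (simp add: besg_def algebra_simps)
qed

section \<open>Location of the first zero and of the eigenvalue\<close>

text \<open>Sturm comparison with sin (m t) on a half period ending at t = 0. If
  \<open>bes k\<close> were positive on the whole interval, g = \<open>besg k c\<close> would be a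
  positive solution on this half period of an equation oscillating at least as fast, which the
  Wronskian excludes.\<close>

lemma bes_not_positive:
  assumes k: "k \<ge> 1" and e: "0 < \<epsilon>" "\<epsilon> \<le> 1/2" "8 * pi \<le> k * \<epsilon> * sqrt \<epsilon>"
  shows "\<exists>y\<in>{0..k\<^sup>2 * (1 + \<epsilon>) / 4}. bes k y \<le> 0"
proof (rule ccontr)
  assume "\<not> ?thesis"
  hence pos: "\<And>y. 0 \<le> y \<Longrightarrow> y \<le> k\<^sup>2 * (1 + \<epsilon>) / 4 \<Longrightarrow> bes k y > 0" by force
  define c where "c = k\<^sup>2 * (1 + \<epsilon>) / 4"
  \<comment> \<open>By the hypothesis 8 pi \<le> k \<epsilon> sqrt \<epsilon>, the half period pi/m
    is at most \<epsilon>/4, so exp (2 t) \<ge> 1 - \<epsilon>/2 on it. As \<epsilon> \<le> 1/2, the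
    coefficient k^2 ((1+\<epsilon>) (1-\<epsilon>/2) - 1) is then still at least k^2 \<epsilon>/4 =
    m^2.\<close>
  define m where "m = k * sqrt \<epsilon> / 2"
  have m: "m > 0" using k e by (simp add: m_def)
  have g: "besg k c t > 0" if "t \<le> 0" for t
  proof -
    have "c * exp (2 * t) \<le> c * 1" using that e by (intro mult_left_mono) (auto simp: c_def)
    thus ?thesis using pos[of "c * exp (2 * t)"] e by (simp add: besg_def c_def)
  qed
  \<comment> \<open>The Wronskian of g and sin (m t). It is nondecreasing on the half period because
    its derivative is a product of two nonpositive factors, yet positivity of g makes it positive at
    -pi/m and negative at 0.\<close>
  define W where "W t = besg' k c t * sin (m * t) - besg k c t * (m * cos (m * t))" for t
  have dW: "(W has_real_derivative (k\<^sup>2 - 4 * (c * exp (2 * t)) + m\<^sup>2) * besg k c t * sin (m * t)) (at t)" for t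
  proof -
    have s: "((\<lambda>t. sin (m * t)) has_real_derivative m * cos (m * t)) (at t)"
      by (rule derivative_eq_intros refl | simp)+
    have co: "((\<lambda>t. m * cos (m * t)) has_real_derivative - (m\<^sup>2 * sin (m * t))) (at t)"
      by (rule derivative_eq_intros refl | simp add: power2_eq_square)+
    show ?thesis unfolding W_def[abs_def]
      by (rule DERIV_cong[OF DERIV_diff[OF DERIV_mult[OF besg'_has_derivative s] DERIV_mult[OF besg_has_derivative co]]])
        (simp add: algebra_simps)
  qed
  have "W (- pi / m) \<le> W 0"
  proof (rule DERIV_nonneg_imp_nondecreasing[of "- pi / m" 0 W])
    show "- pi / m \<le> 0" using m by simp
    fix t assume t: "- pi / m \<le> t" "t \<le> 0"
    have q: "m\<^sup>2 \<le> 4 * (c * exp (2 * t)) - k\<^sup>2"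
    proof -
      have "2 * (pi / m) \<le> \<epsilon> / 2"
      proof -
        have "4 * pi \<le> \<epsilon> * m" using e by (simp add: m_def algebra_simps)
        thus ?thesis using m by (simp add: field_simps)
      qed
      moreover have "1 + 2 * t \<le> exp (2 * t)" by (rule exp_ge_add_one_self)
      moreover have "- (pi / m) \<le> t" using t(1) by simp
      ultimately have "1 - \<epsilon> / 2 \<le> exp (2 * t)" by linarith
      hence "k\<^sup>2 * (1 + \<epsilon>) * (1 - \<epsilon> / 2) \<le> k\<^sup>2 * (1 + \<epsilon>) * exp (2 * t)"
        using e by (intro mult_left_mono) auto
      moreover have "4 * (c * exp (2 * t)) = k\<^sup>2 * (1 + \<epsilon>) * exp (2 * t)" by (simp add: c_def)
      moreover have "m\<^sup>2 = k\<^sup>2 * (\<epsilon> / 4)" using e by (simp add: m_def power_mult_distrib power_divide)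
      moreover have "k\<^sup>2 * (\<epsilon> / 4) \<le> k\<^sup>2 * ((1 + \<epsilon>) * (1 - \<epsilon> / 2) - 1)"
      proof (intro mult_left_mono)
        have "\<epsilon> * \<epsilon> \<le> \<epsilon> * (1/2)" using e by (intro mult_left_mono) auto
        moreover have "(1 + \<epsilon>) * (1 - \<epsilon> / 2) - 1 = \<epsilon> / 2 - \<epsilon> * \<epsilon> / 2" by (simp add: field_simps)
        ultimately show "\<epsilon> / 4 \<le> (1 + \<epsilon>) * (1 - \<epsilon> / 2) - 1" by linarith
      qed simp
      ultimately show ?thesis by (simp only: algebra_simps)
    qed
    have "sin (m * t) \<le> 0"
    proof -
      have "0 \<le> sin (- (m * t))"
        using t m by (intro sin_ge_zero) (auto simp: field_simps mult_nonneg_nonpos)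
      thus ?thesis by simp
    qed
    moreover have "(k\<^sup>2 - 4 * (c * exp (2 * t)) + m\<^sup>2) * besg k c t \<le> 0"
      using q g[OF t(2)] by (intro mult_nonpos_nonneg) auto
    ultimately have "0 \<le> (k\<^sup>2 - 4 * (c * exp (2 * t)) + m\<^sup>2) * besg k c t * sin (m * t)"
      by (rule mult_nonpos_nonpos[rotated])
    with dW show "\<exists>z. (W has_real_derivative z) (at t) \<and> 0 \<le> z" by blast
  qed
  moreover have "W 0 = - (besg k c 0 * m)" "W (- pi / m) = besg k c (- pi / m) * m"
    using m by (simp_all add: W_def)
  moreover have "besg k c 0 * m > 0" "besg k c (- pi / m) * m > 0"
    using g[of 0] g[of "- pi / m"] m by simp_all
  ultimately show False by linarith
qed

text \<open>For t \<le> 0 the equation gives g'' \<ge> \<kappa>^2 g, so exp (\<kappa> t) (g' -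
  \<kappa> g) is nondecreasing. It tends to 0 at minus infinity, hence is nonnegative: in the
  classically forbidden region the regular solution grows at least like exp (\<kappa> t).\<close>

lemma besg_log_derivative:
  assumes \<kappa>: "\<kappa> \<ge> 0" "k \<ge> 1" and c: "c > 0" "4 * c \<le> k\<^sup>2 - \<kappa>\<^sup>2" and pos: "\<And>y. 0 \<le> y \<Longrightarrow> y < c \<Longrightarrow> bes k y \<ge> 0"
    and t: "t \<le> 0"
  shows "\<kappa> * besg k c t \<le> besg' k c t"
proof -
  define P where "P t = exp (\<kappa> * t) * (besg' k c t - \<kappa> * besg k c t)" for t
  \<comment> \<open>Positivity is assumed only below c; the endpoint, which is the argument at t =
    0, follows by continuity.\<close>
  have c0: "bes k y \<ge> 0" if "0 \<le> y" "y \<le> c" for y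
  proof (cases "y = c")
    case True
    have "(bes k \<longlongrightarrow> bes k c) (at_left c)"
      using DERIV_isCont[OF bes_has_derivative] by (simp add: isCont_def filterlim_at_split)
    moreover have "eventually (\<lambda>y. bes k y \<ge> 0) (at_left c)"
      using eventually_at_left_real[OF c(1)] by eventually_elim (auto intro: pos)
    ultimately show ?thesis unfolding True by (rule tendsto_lowerbound) simp
  qed (use that pos in auto)
  have dP: "(P has_real_derivative exp (\<kappa> * t) * ((k\<^sup>2 - 4 * (c * exp (2 * t)) - \<kappa>\<^sup>2) * besg k c t)) (at t)" for t
  proof -
    have e: "((\<lambda>t. exp (\<kappa> * t)) has_real_derivative \<kappa> * exp (\<kappa> * t)) (at t)"
      by (rule derivative_eq_intros refl | simp)+
    show ?thesis unfolding P_def[abs_def]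
      by (rule DERIV_cong[OF DERIV_mult[OF e DERIV_diff[OF besg'_has_derivative DERIV_cmult[OF besg_has_derivative]]]])
        (simp add: algebra_simps power2_eq_square)
  qed
  have le: "P a \<le> P t" if "a \<le> t" for a
  proof (rule DERIV_nonneg_imp_nondecreasing[OF that])
    fix x assume "a \<le> x" "x \<le> t"
    hence "exp (2 * x) \<le> 1" using t by simp
    hence x: "c * exp (2 * x) \<le> c" using c(1) mult_left_mono[of "exp (2*x)" 1 c] by simp
    hence "0 \<le> besg k c x" unfolding besg_def using c(1) by (intro mult_nonneg_nonneg c0) auto
    moreover have "0 \<le> k\<^sup>2 - 4 * (c * exp (2 * x)) - \<kappa>\<^sup>2" using x c(2) by simp
    ultimately have "0 \<le> exp (\<kappa> * x) * ((k\<^sup>2 - 4 * (c * exp (2 * x)) - \<kappa>\<^sup>2) * besg k c x)" by simp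
    with dP show "\<exists>z. (P has_real_derivative z) (at x) \<and> 0 \<le> z" by blast
  qed
  \<comment> \<open>All terms carry the factor exp ((\<kappa> + k) t), and k \<ge> 1 makes the
    exponent positive; the remaining factors converge because c exp (2 t) tends to 0.\<close>
  have "(P \<longlongrightarrow> 0) at_bot"
  proof -
    have ex: "((\<lambda>t. exp (b * t)) \<longlongrightarrow> 0) at_bot" if "b > 0" for b :: real
      by (rule filterlim_compose[OF exp_at_bot]) (use that in \<open>auto intro: filterlim_tendsto_pos_mult_at_bot[OF tendsto_const] filterlim_ident\<close>)
    have y: "((\<lambda>t. c * exp (2 * t)) \<longlongrightarrow> 0) at_bot"
      using tendsto_mult[OF tendsto_const ex[of 2], of c] by simp
    have b: "((\<lambda>t. bes k (c * exp (2 * t))) \<longlongrightarrow> bes k 0) at_bot" "((\<lambda>t. bes' k (c * exp (2 * t))) \<longlongrightarrow> bes' k 0) at_bot"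
      using isCont_tendsto_compose[OF DERIV_isCont[OF bes_has_derivative] y]
        isCont_tendsto_compose[OF DERIV_isCont[OF bes'_has_derivative] y] by auto
    have "((\<lambda>t. exp ((\<kappa> + k) * t) * (k * bes k (c * exp (2 * t)) + 2 * (c * exp (2 * t)) * bes' k (c * exp (2 * t)) - \<kappa> * bes k (c * exp (2 * t))))
      \<longlongrightarrow> 0 * (k * bes k 0 + 2 * 0 * bes' k 0 - \<kappa> * bes k 0)) at_bot"
      using \<kappa> by (intro tendsto_intros ex y b) auto
    moreover have "P = (\<lambda>t. exp ((\<kappa> + k) * t) * (k * bes k (c * exp (2 * t)) + 2 * (c * exp (2 * t)) * bes' k (c * exp (2 * t)) - \<kappa> * bes k (c * exp (2 * t))))"
      by (rule ext) (simp add: P_def besg_def besg'_def algebra_simps exp_add)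
    ultimately show ?thesis by simp
  qed
  moreover have "eventually (\<lambda>a. P a \<le> P t) at_bot"
    using eventually_le_at_bot[of t] by eventually_elim (rule le)
  ultimately have "0 \<le> P t" by (rule tendsto_upperbound) simp
  thus ?thesis by (simp add: P_def zero_le_mult_iff)
qed

lemma besg_growth:
  assumes \<kappa>: "\<kappa> \<ge> 0" "k \<ge> 1" and c: "c > 0" "4 * c \<le> k\<^sup>2 - \<kappa>\<^sup>2" and pos: "\<And>y. 0 \<le> y \<Longrightarrow> y < c \<Longrightarrow> bes k y \<ge> 0"
    and t: "t \<le> 0"
  shows "besg k c t \<le> exp (\<kappa> * t) * besg k c 0"
proof -
  have "exp (- \<kappa> * t) * besg k c t \<le> exp (- \<kappa> * 0) * besg k c 0"
  proof (rule DERIV_nonneg_imp_nondecreasing[OF t])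
    fix x assume x: "t \<le> x" "x \<le> 0"
    have e: "((\<lambda>t. exp (- \<kappa> * t)) has_real_derivative - \<kappa> * exp (- \<kappa> * x)) (at x)"
      by (rule derivative_eq_intros refl | simp)+
    have "((\<lambda>t. exp (- \<kappa> * t) * besg k c t) has_real_derivative exp (- \<kappa> * x) * (besg' k c x - \<kappa> * besg k c x)) (at x)"
      by (rule DERIV_cong[OF DERIV_mult[OF e besg_has_derivative]]) (simp add: algebra_simps)
    moreover have "0 \<le> exp (- \<kappa> * x) * (besg' k c x - \<kappa> * besg k c x)"
      using besg_log_derivative[OF \<kappa> c pos x(2)] by simp
    ultimately show "\<exists>y. ((\<lambda>t. exp (- \<kappa> * t) * besg k c t) has_real_derivative y) (at x) \<and> 0 \<le> y" by blast
  qed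
  thus ?thesis by (simp add: exp_minus field_simps)
qed

text \<open>The nonpositive points in a compact interval form a compact set, whose least element is
  taken. Since \<open>bes k 0 = 1\<close>, a negative value there would give an earlier zero, and a
  positive derivative would give negative values just before it.\<close>

lemma bes_first_zero:
  assumes "bes k y0 \<le> 0" "0 \<le> y0"
  shows "\<exists>y1. 0 < y1 \<and> bes k y1 = 0 \<and> (\<forall>y. 0 \<le> y \<and> bes k y \<le> 0 \<longrightarrow> y1 \<le> y) \<and> bes' k y1 \<le> 0"
proof -
  note cont = continuous_on_bes(1)
  define Z where "Z = {0..y0} \<inter> bes k -` {..0}"
  have "compact Z" unfolding Z_def
    by (rule compact_Int_closed) (auto intro!: closed_vimage cont)
  moreover have "Z \<noteq> {}" using assms by (auto simp: Z_def)
  ultimately have "\<exists>y1\<in>Z. \<forall>y\<in>Z. y1 \<le> y" by (rule compact_attains_inf)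
  then obtain y1 where y1: "y1 \<in> Z" "\<And>y. y \<in> Z \<Longrightarrow> y1 \<le> y" by blast
  have min: "y1 \<le> y" if "0 \<le> y" "bes k y \<le> 0" for y
    using y1 that by (cases "y \<le> y0") (auto simp: Z_def)
  have "y1 \<noteq> 0" using y1(1) by (auto simp: Z_def)
  hence p: "0 < y1" using y1(1) by (auto simp: Z_def)
  have z: "bes k y1 = 0"
  proof (rule ccontr)
    assume "bes k y1 \<noteq> 0"
    hence "bes k y1 < 0" using y1(1) by (auto simp: Z_def)
    then obtain y where "0 \<le> y" "y \<le> y1" "bes k y = 0"
      using IVT2'[of "bes k" y1 0 0] p cont by auto
    with min[of y] \<open>bes k y1 < 0\<close> show False by auto
  qed
  have "bes' k y1 \<le> 0"
  proof (rule ccontr)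
    assume "\<not> bes' k y1 \<le> 0"
    then obtain d where d: "d > 0" "\<And>h. 0 < h \<Longrightarrow> h < d \<Longrightarrow> bes k (y1 - h) < bes k y1"
      using DERIV_pos_inc_left[OF bes_has_derivative, of k y1] by auto
    \<comment> \<open>The second bound keeps \<open>y1 - h\<close> positive, as minimality of
      \<open>y1\<close> speaks of nonnegative arguments only.\<close>
    define h where "h = min (d / 2) (y1 / 2)"
    have "0 < h" "h < d" "h < y1" using d p by (auto simp: h_def min_def)
    with d(2)[of h] z min[of "y1 - h"] show False by auto
  qed
  with p z min show ?thesis by blast
qed

text \<open>The matching condition for the logarithmic derivatives at \<open>r = 1\<close> of the Bessel profile inside
  and of \<open>r\<^sup>-\<^sup>1 * sinh (\<kappa> * (ln 2 - ln r))\<close> outside.\<close>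

lemma eigenvalue_exists:
  fixes k :: nat
  assumes k: "k \<ge> 1" "16 * sqrt 2 * pi * 2 \<le> k"
  obtains lam :: real where "real (k\<^sup>2) < lam" "lam \<le> 3 / 2 * k\<^sup>2"
    "\<And>y. 0 \<le> y \<Longrightarrow> y < lam / 4 \<Longrightarrow> bes k y > 0" "bes k (lam / 4) \<ge> 0"
    "\<And>\<epsilon> :: real. 0 < \<epsilon> \<Longrightarrow> \<epsilon> \<le> 1/2 \<Longrightarrow> 8 * pi \<le> k * \<epsilon> * sqrt \<epsilon> \<Longrightarrow> lam \<le> k\<^sup>2 * (1 + \<epsilon>)"
    "\<And>\<kappa>. \<kappa> = sqrt (k\<^sup>2 + 1 - lam / 4) \<Longrightarrow>
      sinh (\<kappa> * ln 2) * (k * bes k (lam / 4) + lam / 2 * bes' k (lam / 4)) =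
      - 4 * (sinh (\<kappa> * ln 2) + \<kappa> * cosh (\<kappa> * ln 2)) * bes k (lam / 4)"
proof -
  \<comment> \<open>The instance \<epsilon> = 1/2 of the Sturm bound; it gives existence of the
    first zero \<open>y1\<close> and 4 \<open>y1\<close> \<le> 3/2 k^2, which keeps the root
    defining \<open>K l\<close> real.\<close>
  have half: "8 * pi \<le> k * (1/2) * sqrt (1/2)"
  proof -
    have "k * (1/2) * sqrt (1/2) = k / (2 * sqrt 2)" by (simp add: real_sqrt_divide)
    moreover have "8 * pi * (2 * sqrt 2) \<le> k" using k(2) pi_gt_zero by (simp add: mult.commute mult.left_commute)
    ultimately show ?thesis by (simp add: pos_le_divide_eq)
  qed
  have ub: "\<exists>y\<in>{0..k\<^sup>2 * (1 + \<epsilon>) / 4}. bes k y \<le> 0" if "0 < \<epsilon>" "\<epsilon> \<le> 1/2" "8 * pi \<le> k * \<epsilon> * sqrt \<epsilon>" for \<epsilon> :: real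
    using bes_not_positive[OF k(1) that] by simp
  obtain y0 where "0 \<le> y0" "bes k y0 \<le> 0" using ub[OF _ _ half] by auto
  then obtain y1 where y1: "0 < y1" "bes k y1 = 0" "\<And>y. 0 \<le> y \<Longrightarrow> bes k y \<le> 0 \<Longrightarrow> y1 \<le> y" "bes' k y1 \<le> 0"
    using bes_first_zero by blast
  have y1e: "4 * y1 \<le> k\<^sup>2 * (1 + \<epsilon>)" if "0 < \<epsilon>" "\<epsilon> \<le> 1/2" "8 * pi \<le> k * \<epsilon> * sqrt \<epsilon>" for \<epsilon> :: real
    using ub[OF that] y1(3) by fastforce
  have y1h: "4 * y1 \<le> 3 / 2 * k\<^sup>2" using y1e[OF _ _ half] by simp
  define K where "K l = sqrt (k\<^sup>2 + 1 - l / 4)" for l :: real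
  \<comment> \<open>The difference of the two logarithmic derivatives with denominators cleared, so
    that it is continuous up to the zero of \<open>bes k\<close>.\<close>
  define D where "D l = sinh (K l * ln 2) * (k * bes k (l / 4) + l / 2 * bes' k (l / 4))
    + 4 * (sinh (K l * ln 2) + K l * cosh (K l * ln 2)) * bes k (l / 4)" for l :: real
  have Kpos: "K l > 0" if "l \<le> 4 * y1" for l
  proof -
    have "0 \<le> real (k\<^sup>2)" by simp
    hence "0 < real (k\<^sup>2) + 1 - l / 4" using that y1h by linarith
    thus ?thesis by (simp add: K_def)
  qed
  have shpos: "sinh (K l * ln 2) > 0" if "l \<le> 4 * y1" for l using Kpos[OF that] by simp
  have cb: "continuous_on A (\<lambda>l. bes k (l / 4))" "continuous_on A (\<lambda>l. bes' k (l / 4))" for A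
    by (auto intro!: continuous_on_compose2[OF continuous_on_bes(1)[of UNIV], of A "\<lambda>l. l / 4"]
        continuous_on_compose2[OF continuous_on_bes(2)[of UNIV], of A "\<lambda>l. l / 4"] continuous_intros)
  have cont: "continuous_on {0..4 * y1} D"
    unfolding D_def[abs_def] K_def
    by (intro continuous_on_add continuous_on_mult continuous_on_sinh continuous_on_cosh continuous_on_real_sqrt
        continuous_on_diff continuous_on_divide continuous_on_const continuous_on_id cb) auto
  \<comment> \<open>Up to k^2 there is no oscillation inside: the logarithmic derivative at r = 1 is
    nonnegative from inside, while the outer profile decreases. So no match is possible
    there.\<close>
  have D0: "D l > 0" if l: "0 \<le> l" "l \<le> 4 * y1" "l \<le> k\<^sup>2" for l
  proof (cases "l = 0")
    case True
    have "K 0 > 0" "sinh (K 0 * ln 2) > 0" using Kpos[of 0] shpos[of 0] y1 by auto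
    moreover have "D 0 = sinh (K 0 * ln 2) * k + 4 * (sinh (K 0 * ln 2) + K 0 * cosh (K 0 * ln 2))"
      by (simp add: D_def)
    ultimately show ?thesis unfolding True using k(1)
      by (auto intro!: add_pos_pos mult_pos_pos)
  next
    case False
    define \<kappa> where "\<kappa> = sqrt (k\<^sup>2 - l)"
    have \<kappa>: "\<kappa> \<ge> 0" "4 * (l / 4) \<le> k\<^sup>2 - \<kappa>\<^sup>2" "l / 4 > 0" using l False by (auto simp: \<kappa>_def)
    have pos: "bes k y \<ge> 0" if "0 \<le> y" "y < l / 4" for y
      using y1(3)[of y] that l(2) by force
    \<comment> \<open>That l/4 lies strictly below the first zero is not known yet. At t = - ln 2
      the argument is l/16, which is below \<open>y1\<close>, and the growth estimate carries the
      strict positivity from there to t = 0.\<close>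
    have ge: "bes k (l / 4) > 0"
    proof -
      have "besg k (l / 4) (- ln 2) \<le> exp (\<kappa> * (- ln 2)) * besg k (l / 4) 0"
        by (rule besg_growth[OF \<kappa>(1) k(1) \<kappa>(3,2) pos]) auto
      moreover have "bes k (l / 4 * exp (2 * (- ln 2))) > 0"
      proof (rule ccontr)
        assume "\<not> ?thesis"
        hence "y1 \<le> l / 4 * exp (2 * (- ln 2))" using l by (intro y1(3)) auto
        also have "\<dots> < l / 4 * 1" using \<kappa>(3) by (intro mult_strict_left_mono) auto
        finally show False using l(2) by simp
      qed
      hence "besg k (l / 4) (- ln 2) > 0" by (simp add: besg_def)
      ultimately have "0 < exp (\<kappa> * (- ln 2)) * besg k (l / 4) 0" by linarith
      hence "0 < besg k (l / 4) 0" by (simp add: zero_less_mult_iff)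
      thus ?thesis by (simp add: besg_def)
    qed
    have "\<kappa> * besg k (l / 4) 0 \<le> besg' k (l / 4) 0"
      by (rule besg_log_derivative[OF \<kappa>(1) k(1) \<kappa>(3,2) pos]) auto
    hence "\<kappa> * bes k (l / 4) \<le> k * bes k (l / 4) + l / 2 * bes' k (l / 4)"
      by (simp add: besg_def besg'_def)
    moreover have "0 \<le> \<kappa> * bes k (l / 4)" using ge \<kappa>(1) by simp
    ultimately have "0 \<le> k * bes k (l / 4) + l / 2 * bes' k (l / 4)" by linarith
    moreover have "0 < 4 * (sinh (K l * ln 2) + K l * cosh (K l * ln 2)) * bes k (l / 4)"
      using Kpos[OF l(2)] shpos[OF l(2)] ge by (intro mult_pos_pos add_pos_pos) auto
    ultimately show ?thesis unfolding D_def using shpos[OF l(2)] by (intro add_nonneg_pos mult_nonneg_nonneg) auto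
  qed
  \<comment> \<open>At the first zero only the derivative term survives, and its sign is that of
    \<open>bes'\<close> there. The intermediate value theorem then applies, and by \<open>D0\<close>
    the root lies beyond k^2.\<close>
  have "D (4 * y1) = sinh (K (4 * y1) * ln 2) * (2 * y1 * bes' k y1)" by (simp add: D_def y1)
  also have "\<dots> \<le> 0" using y1 shpos[of "4 * y1"] by (intro mult_nonneg_nonpos) auto
  finally have "D (4 * y1) \<le> 0" .
  moreover have "0 \<le> D 0" using D0[of 0] y1(1) by auto
  ultimately obtain lam where lam: "0 \<le> lam" "lam \<le> 4 * y1" "D lam = 0"
    using IVT2'[of D "4 * y1" 0 0] cont y1(1) by auto
  show ?thesis
  proof (rule that)
    show "real (k\<^sup>2) < lam" using D0[OF lam(1,2)] lam(3) by (cases "lam \<le> k\<^sup>2") auto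
    show "lam \<le> 3 / 2 * k\<^sup>2" using lam(2) y1h by simp
    show "bes k y > 0" if "0 \<le> y" "y < lam / 4" for y using y1(3)[of y] that lam(2) by force
    show "bes k (lam / 4) \<ge> 0"
    proof (rule ccontr)
      assume n: "\<not> bes k (lam / 4) \<ge> 0"
      hence "y1 \<le> lam / 4" using lam(1) by (intro y1(3)) auto
      hence "lam / 4 = y1" using lam(2) by linarith
      with n y1(2) show False by simp
    qed
    show "lam \<le> k\<^sup>2 * (1 + \<epsilon>)" if "0 < \<epsilon>" "\<epsilon> \<le> 1/2" "8 * pi \<le> k * \<epsilon> * sqrt \<epsilon>" for \<epsilon> :: real
      using y1e[OF that] lam(2) by simp
    fix \<kappa> assume "\<kappa> = sqrt (k\<^sup>2 + 1 - lam / 4)"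
    hence "\<kappa> = K lam" by (simp add: K_def)
    with lam(3) show "sinh (\<kappa> * ln 2) * (k * bes k (lam / 4) + lam / 2 * bes' k (lam / 4)) =
      - 4 * (sinh (\<kappa> * ln 2) + \<kappa> * cosh (\<kappa> * ln 2)) * bes k (lam / 4)"
      by (simp add: D_def algebra_simps)
  qed
qed

section \<open>Smooth cutoffs\<close>

lemma CkR_cong:
  assumes "open I" "\<And>s. s \<in> I \<Longrightarrow> f s = g s" "CkR I m f" shows "CkR I m g"
proof (cases m)
  case 0
  thus ?thesis using assms continuous_on_cong[of I I f g] by simp
next
  case (Suc m')
  from assms(3)[unfolded Suc] obtain f' where f': "\<And>s. s \<in> I \<Longrightarrow> (f has_real_derivative f' s) (at s)" "CkR I m' f'"
    by (rule CkR_SucE) blast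
  have "(g has_real_derivative f' s) (at s)" if "s \<in> I" for s
    by (rule has_field_derivative_transform_within_open[OF f'(1)[OF that] assms(1) that assms(2)])
  thus ?thesis unfolding Suc using f'(2) by (rule CkR_SucI)
qed

lemma smoothR_cong: "open I \<Longrightarrow> (\<And>s. s \<in> I \<Longrightarrow> f s = g s) \<Longrightarrow> smoothR I f \<Longrightarrow> smoothR I g"
  unfolding smoothR_def using CkR_cong[of I f g] by blast

text \<open>The derivatives known on I and on J are a priori unrelated functions;
  \<open>deriv f\<close> agrees with each on its own set and serves on the union.\<close>

lemma CkR_Un:
  assumes "open I" "open J" "CkR I m f" "CkR J m f" shows "CkR (I \<union> J) m f"
  using assms(3,4)
proof (induction m arbitrary: f)
  case 0
  thus ?case using continuous_on_open_Un[OF assms(1,2)] by simp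
next
  case (Suc m)
  obtain f' where f': "\<And>s. s \<in> I \<Longrightarrow> (f has_real_derivative f' s) (at s)" "CkR I m f'"
    using CkR_SucE[OF Suc.prems(1)] by blast
  obtain g' where g': "\<And>s. s \<in> J \<Longrightarrow> (f has_real_derivative g' s) (at s)" "CkR J m g'"
    using CkR_SucE[OF Suc.prems(2)] by blast
  have "CkR I m (deriv f)" "CkR J m (deriv f)"
    using CkR_cong[OF assms(1) _ f'(2), of "deriv f"] CkR_cong[OF assms(2) _ g'(2), of "deriv f"]
      DERIV_imp_deriv[OF f'(1)] DERIV_imp_deriv[OF g'(1)] by auto
  hence "CkR (I \<union> J) m (deriv f)" by (rule Suc.IH)
  moreover have "(f has_real_derivative deriv f s) (at s)" if "s \<in> I \<union> J" for s
    using that f'(1)[of s] g'(1)[of s] DERIV_imp_deriv[of f _ s] by auto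
  ultimately show ?case using CkR_SucI[of "I \<union> J" f "deriv f" m] by blast
qed

lemma smoothR_Un: "open I \<Longrightarrow> open J \<Longrightarrow> smoothR I f \<Longrightarrow> smoothR J f \<Longrightarrow> smoothR (I \<union> J) f"
  unfolding smoothR_def using CkR_Un[of I J _ f] by blast

lemma smoothR_exp: "smoothR I exp"
  by (rule smoothR_seqI[of I "\<lambda>_. exp"]) (rule DERIV_exp)

lemma smoothR_inverse: "0 \<notin> I \<Longrightarrow> smoothR I inverse"
proof -
  assume I: "0 \<notin> I"
  have d: "(inverse has_real_derivative (-1) * (inverse s * inverse s)) (at s)" if "s \<in> I" for s
    using DERIV_inverse[of s UNIV] I that by (auto simp: power2_eq_square)
  have "CkR I m inverse" for m
  proof (induction m)
    case 0
    have "continuous_on I (inverse :: real \<Rightarrow> real)"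
      using I by (intro continuous_on_inverse continuous_on_id) auto
    thus ?case by simp
  next
    case (Suc m)
    show ?case by (rule CkR_SucI[OF d CkR_mult[OF CkR_const CkR_mult[OF Suc Suc]]])
  qed
  thus ?thesis by (simp add: smoothR_def)
qed

lemma smoothR_ln: "smoothR {0<..} ln"
  unfolding smoothR_def
proof
  fix m
  have d: "(ln has_real_derivative inverse s) (at s)" if "s \<in> {0<..}" for s :: real
    using that DERIV_ln by auto
  have i: "CkR {0<..} m inverse" for m using smoothR_inverse[of "{0<..}"] by (simp add: smoothR_def)
  show "CkR {0<..} m ln"
    using CkR_SucI[OF d i] CkR_Suc_D by blast
qed

text \<open>The flat functions \<open>p(1/x) exp(-1/x)\<close>; the derivative of such a function is again one, since
  \<open>y\<^sup>2 (p(y) - p'(y))\<close> is a polynomial in \<open>y = 1/x\<close>.\<close>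

definition flat :: "real poly \<Rightarrow> real \<Rightarrow> real" where
  "flat p x = (if x > 0 then poly p (1 / x) * exp (- (1 / x)) else 0)"

lemma poly_times_exp_tendsto_0: "((\<lambda>y :: real. poly p y * exp (- y)) \<longlongrightarrow> 0) at_top"
proof -
  have "((\<lambda>y. \<Sum>i\<le>degree p. coeff p i * (y ^ i / exp y)) \<longlongrightarrow> (\<Sum>i\<le>degree p. coeff p i * 0)) at_top"
    by (intro tendsto_sum tendsto_mult tendsto_const tendsto_power_div_exp_0)
  moreover have "(\<Sum>i\<le>degree p. coeff p i * (y ^ i / exp y)) = poly p y * exp (- y)" for y :: real
    by (simp add: poly_altdef sum_distrib_right exp_minus divide_inverse mult.assoc)
  ultimately show ?thesis by simp
qed

lemma flat_has_derivative: "(flat p has_real_derivative flat ([:0, 0, 1:] * (p - pderiv p)) x) (at x)"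
proof -
  consider "x > 0" | "x < 0" | "x = 0" by linarith
  thus ?thesis
  proof cases
    case 1
    have "((\<lambda>x. poly p (1 / x) * exp (- (1 / x))) has_real_derivative flat ([:0, 0, 1:] * (p - pderiv p)) x) (at x)"
      using 1 by (auto intro!: derivative_eq_intros DERIV_chain2[OF poly_DERIV] simp: flat_def)
        (simp add: field_simps power2_eq_square)
    thus ?thesis
      by (rule has_field_derivative_transform_within_open[of _ _ _ "{0<..}"]) (use 1 in \<open>auto simp: flat_def\<close>)
  next
    case 2
    have "((\<lambda>_. 0) has_real_derivative flat ([:0, 0, 1:] * (p - pderiv p)) x) (at x)"
      using 2 by (simp add: flat_def)
    thus ?thesis
      by (rule has_field_derivative_transform_within_open[of _ _ _ "{..<0}"]) (use 2 in \<open>auto simp: flat_def\<close>)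
  next
    case 3
    \<comment> \<open>With y = 1/h the difference quotient is y p(y) exp (-y), again a polynomial
      times a decaying exponential. From the left it is identically 0.\<close>
    have "((\<lambda>h. flat p h / h) \<longlongrightarrow> 0) (at_right 0)"
    proof -
      have "filterlim (\<lambda>h. 1 / h) at_top (at_right (0 :: real))"
        using filterlim_inverse_at_top_right by (simp add: inverse_eq_divide)
      from filterlim_compose[OF poly_times_exp_tendsto_0[of "[:0, 1:] * p"] this]
      have "((\<lambda>h. poly ([:0, 1:] * p) (1 / h) * exp (- (1 / h))) \<longlongrightarrow> 0) (at_right 0)" .
      moreover have "eventually (\<lambda>h. poly ([:0, 1:] * p) (1 / h) * exp (- (1 / h)) = flat p h / h) (at_right 0)"
        using eventually_at_right_less[of "0 :: real"] by eventually_elim (simp add: flat_def)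
      ultimately show ?thesis by (rule Lim_transform_eventually)
    qed
    moreover have "((\<lambda>h. flat p h / h) \<longlongrightarrow> 0) (at_left 0)"
    proof (rule Lim_transform_eventually[OF tendsto_const])
      show "eventually (\<lambda>h. 0 = flat p h / h) (at_left 0)"
        using eventually_at_left_real[of "-1" 0] by (auto elim: eventually_mono simp: flat_def)
    qed
    ultimately have "((\<lambda>h. flat p h / h) \<longlongrightarrow> 0) (at 0)"
      by (simp add: filterlim_split_at)
    thus ?thesis using 3 by (simp add: DERIV_def flat_def)
  qed
qed

lemma smoothR_flat: "smoothR I (flat p)"
proof -
  have "CkR I m (flat p)" for m p
  proof (induction m arbitrary: p)
    case 0
    show ?case unfolding CkR.simps
      by (rule DERIV_continuous_on[OF has_field_derivative_at_within[OF flat_has_derivative]])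
  next
    case (Suc m)
    show ?case by (rule CkR_SucI[OF flat_has_derivative Suc])
  qed
  thus ?thesis by (simp add: smoothR_def)
qed

text \<open>Not compactly supported: it rises from 0 on the nonpositive axis to the limit 1 at
  infinity, so that \<open>bump (K * (s - 1))\<close> approaches a step at 1 as K grows. It is
  \<open>flat 1\<close>, written out for the explicit bounds.\<close>

definition bump :: "real \<Rightarrow> real" where
  "bump x = (if x > 0 then exp (- (1 / x)) else 0)"

definition bump' :: "real \<Rightarrow> real" where
  "bump' x = (if x > 0 then (1 / x)\<^sup>2 * exp (- (1 / x)) else 0)"

lemma bump_flat: "bump = flat 1" "bump' = flat [:0, 0, 1:]"
  by (auto simp: fun_eq_iff bump_def bump'_def flat_def power2_eq_square)

lemma bump_has_derivative: "(bump has_real_derivative bump' x) (at x)"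
  using flat_has_derivative[of 1 x] by (simp add: bump_flat)

lemma smoothR_bump: "smoothR I bump"
  by (simp add: bump_flat smoothR_flat)

text \<open>With y = 1/x these come from y exp (-y) \<le> 1 and y^2 exp (-y) \<le> 2. The bounds on
  x \<open>bump' x\<close> are the ones that stay uniform under the rescaling by K.\<close>

lemma bump_bounds:
  "0 \<le> bump x" "bump x \<le> 1" "x > 0 \<Longrightarrow> 1 - bump x \<le> 1 / x"
  "0 \<le> bump' x" "bump' x \<le> 2" "x * bump' x \<le> 1" "x > 0 \<Longrightarrow> x * bump' x \<le> 1 / x"
proof -
  show "0 \<le> bump x" "0 \<le> bump' x" by (auto simp: bump_def bump'_def)
  show "bump x \<le> 1" by (auto simp: bump_def)
  show "1 - bump x \<le> 1 / x" if "x > 0"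
    using exp_ge_add_one_self[of "- (1 / x)"] that by (simp add: bump_def)
  have e: "y * exp (- y) \<le> 1" if "y \<ge> 0" for y :: real
  proof -
    have "y \<le> exp y" using exp_ge_add_one_self[of y] by linarith
    thus ?thesis by (simp add: exp_minus field_simps)
  qed
  have e2: "y\<^sup>2 * exp (- y) \<le> 2" if "y \<ge> 0" for y :: real
  proof -
    have "y\<^sup>2 / 2 \<le> exp y" using exp_lower_Taylor_quadratic[OF that] that by linarith
    thus ?thesis by (simp add: exp_minus field_simps)
  qed
  show "bump' x \<le> 2" using e2[of "1 / x"] by (auto simp: bump'_def)
  have xb: "x * bump' x = 1 / x * exp (- (1 / x))" if "x > 0"
    using that by (simp add: bump'_def power2_eq_square)
  show "x * bump' x \<le> 1" using e[of "1 / x"] xb by (cases "x > 0") (auto simp: bump'_def)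
  show "x * bump' x \<le> 1 / x" if "x > 0"
    unfolding xb[OF that] using that by (intro mult_left_le) auto
qed

lemma bump_tendsto: "(bump \<longlongrightarrow> 1) at_top" "((\<lambda>x. x * bump' x) \<longlongrightarrow> 0) at_top" "(bump' \<longlongrightarrow> 0) at_top"
proof -
  have i: "((\<lambda>x :: real. 1 / x) \<longlongrightarrow> 0) at_top"
    using tendsto_inverse_0_at_top[OF filterlim_ident] by (simp add: inverse_eq_divide)
  have "((\<lambda>x :: real. 1 - 1 / x) \<longlongrightarrow> 1 - 0) at_top" by (intro tendsto_diff tendsto_const i)
  thus "(bump \<longlongrightarrow> 1) at_top"
    by (intro tendsto_sandwich[where f = "\<lambda>x. 1 - 1 / x" and h = "\<lambda>_. 1" and g = bump and c = 1])
       (auto intro!: eventually_mono[OF eventually_gt_at_top[of 0]] simp: bump_bounds(2), use bump_bounds(3) in fastforce)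
  show l: "((\<lambda>x. x * bump' x) \<longlongrightarrow> 0) at_top"
    by (rule tendsto_sandwich[OF _ _ tendsto_const i])
       (auto intro!: eventually_mono[OF eventually_gt_at_top[of 0]] simp: bump_bounds)
  show "(bump' \<longlongrightarrow> 0) at_top"
  proof (rule tendsto_sandwich[OF _ _ tendsto_const l])
    show "eventually (\<lambda>x. bump' x \<le> x * bump' x) at_top"
      using eventually_ge_at_top[of "1 :: real"]
      by eventually_elim (use bump_bounds(4) mult_right_mono[of 1 _ "bump' _"] in auto)
  qed (simp add: bump_bounds)
qed

section \<open>Profiles outside the circle and smooth approximation\<close>

text \<open>In r = sqrt s this is r^(-k-1) sinh (\<kappa> (ln 2 - ln r)). The factor r^(-k) undoes
  the r^k contained in Re (z^k), and the sinh vanishes on the outer circle r = 2.\<close>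

definition shp :: "real \<Rightarrow> nat \<Rightarrow> real \<Rightarrow> real" where
  "shp \<kappa> k s = exp (- (real k + 1) / 2 * ln s) * sinh (\<kappa> * (ln 2 - ln s / 2))"

definition chp :: "real \<Rightarrow> nat \<Rightarrow> real \<Rightarrow> real" where
  "chp \<kappa> k s = exp (- (real k + 1) / 2 * ln s) * cosh (\<kappa> * (ln 2 - ln s / 2))"

definition shp' :: "real \<Rightarrow> nat \<Rightarrow> real \<Rightarrow> real" where
  "shp' \<kappa> k s = - ((real k + 1) * shp \<kappa> k s + \<kappa> * chp \<kappa> k s) / (2 * s)"

definition shp'' :: "real \<Rightarrow> nat \<Rightarrow> real \<Rightarrow> real" where
  "shp'' \<kappa> k s = ((real k + 1) * shp \<kappa> k s + \<kappa> * chp \<kappa> k s) / (2 * s\<^sup>2)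
     + ((real k + 1) * ((real k + 1) * shp \<kappa> k s + \<kappa> * chp \<kappa> k s)
        + \<kappa> * ((real k + 1) * chp \<kappa> k s + \<kappa> * shp \<kappa> k s)) / (4 * s\<^sup>2)"

lemma shp_has_derivative: "s > 0 \<Longrightarrow> (shp \<kappa> k has_real_derivative shp' \<kappa> k s) (at s)"
  and chp_has_derivative: "s > 0 \<Longrightarrow> (chp \<kappa> k has_real_derivative
    - ((real k + 1) * chp \<kappa> k s + \<kappa> * shp \<kappa> k s) / (2 * s)) (at s)"
proof -
  assume s: "s > 0"
  have e: "((\<lambda>s. exp (- (real k + 1) / 2 * ln s)) has_real_derivative
      exp (- (real k + 1) / 2 * ln s) * (- (real k + 1) / 2 * (1 / s))) (at s)"
    by (rule DERIV_fun_exp DERIV_cmult DERIV_ln_divide s)+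
  have i: "((\<lambda>s. \<kappa> * (ln 2 - ln s / 2)) has_real_derivative - \<kappa> / (2 * s)) (at s)"
    by (rule derivative_eq_intros refl s | simp)+
  have dsh: "(sinh has_real_derivative cosh z) (at z)" and dch: "(cosh has_real_derivative sinh z) (at z)" for z :: real
    by (rule derivative_eq_intros refl | simp)+
  have sh: "((\<lambda>s. sinh (\<kappa> * (ln 2 - ln s / 2))) has_real_derivative cosh (\<kappa> * (ln 2 - ln s / 2)) * (- \<kappa> / (2 * s))) (at s)"
    and ch: "((\<lambda>s. cosh (\<kappa> * (ln 2 - ln s / 2))) has_real_derivative sinh (\<kappa> * (ln 2 - ln s / 2)) * (- \<kappa> / (2 * s))) (at s)"
    using DERIV_chain2[OF dsh i] DERIV_chain2[OF dch i] by simp_all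
  show "(shp \<kappa> k has_real_derivative shp' \<kappa> k s) (at s)"
    unfolding shp_def[abs_def] shp'_def chp_def
    by (rule DERIV_cong[OF DERIV_mult[OF e sh]]) (use s in \<open>simp add: field_simps\<close>)
  show "(chp \<kappa> k has_real_derivative - ((real k + 1) * chp \<kappa> k s + \<kappa> * shp \<kappa> k s) / (2 * s)) (at s)"
    unfolding chp_def[abs_def] shp_def
    by (rule DERIV_cong[OF DERIV_mult[OF e ch]]) (use s in \<open>simp add: field_simps\<close>)
qed

lemma shp'_has_derivative:
  assumes s: "s > 0" shows "(shp' \<kappa> k has_real_derivative shp'' \<kappa> k s) (at s)"
proof -
  have d: "((\<lambda>s. - ((real k + 1) * shp \<kappa> k s + \<kappa> * chp \<kappa> k s) / (2 * s)) has_real_derivative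
     ((- ((real k + 1) * shp' \<kappa> k s + \<kappa> * (- ((real k + 1) * chp \<kappa> k s + \<kappa> * shp \<kappa> k s) / (2 * s)))) * (2 * s)
       - (- ((real k + 1) * shp \<kappa> k s + \<kappa> * chp \<kappa> k s)) * 2) / ((2 * s) * (2 * s))) (at s)"
    by (rule DERIV_divide DERIV_minus DERIV_add DERIV_cmult shp_has_derivative[OF s] chp_has_derivative[OF s]
        DERIV_cmult[OF DERIV_ident, of 2, simplified] | use s in simp)+
  show ?thesis unfolding shp'_def[abs_def]
    by (rule DERIV_cong[OF d])
      (use s in \<open>simp add: shp'_def shp''_def power2_eq_square add_divide_distrib diff_divide_distrib ring_distribs\<close>)
qed

text \<open>For u = F(r^2) Re (z^k) one has div (4 r^2 grad u) = 4 r^2 Laplacian u + 8 x . grad u;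
  the two summands on the left are the radial factors of these terms. In ln r this is an equation
  with constant coefficients, whose exponents -1 + \<kappa> and -1 - \<kappa> give the relation for
  \<kappa>.\<close>

lemma shp_ode:
  assumes s: "s > 0" and \<kappa>: "\<kappa>\<^sup>2 = real (k\<^sup>2) + 1 - lam / 4"
  shows "4 * s * (4 * s * shp'' \<kappa> k s + 4 * (real k + 1) * shp' \<kappa> k s)
    + 8 * (2 * s * shp' \<kappa> k s + real k * shp \<kappa> k s) = - (lam * shp \<kappa> k s)"
proof -
  let ?S = "shp \<kappa> k s" and ?C = "chp \<kappa> k s" and ?k = "real k"
  have 1: "2 * s * shp' \<kappa> k s = - ((?k + 1) * ?S + \<kappa> * ?C)" using s by (simp add: shp'_def)
  have "s * s * (A / (2 * s\<^sup>2) + B / (4 * s\<^sup>2)) = A / 2 + B / 4" for A B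
    using s by (simp add: field_simps power2_eq_square)
  hence "s * s * shp'' \<kappa> k s = ((?k + 1) * ?S + \<kappa> * ?C) / 2
     + ((?k + 1) * ((?k + 1) * ?S + \<kappa> * ?C) + \<kappa> * ((?k + 1) * ?C + \<kappa> * ?S)) / 4"
    unfolding shp''_def .
  hence 2: "4 * (s * s * shp'' \<kappa> k s) = 2 * ((?k + 1) * ?S + \<kappa> * ?C)
     + ((?k + 1) * ((?k + 1) * ?S + \<kappa> * ?C) + \<kappa> * ((?k + 1) * ?C + \<kappa> * ?S))"
    by (simp add: field_simps)
  have "4 * s * (4 * s * shp'' \<kappa> k s + 4 * (?k + 1) * shp' \<kappa> k s) + 8 * (2 * s * shp' \<kappa> k s + ?k * ?S)
     = 4 * (4 * (s * s * shp'' \<kappa> k s)) + 8 * (?k + 1) * (2 * s * shp' \<kappa> k s) + 8 * (2 * s * shp' \<kappa> k s) + 8 * ?k * ?S"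
    by (simp add: algebra_simps)
  also have "\<dots> = (4 * \<kappa>\<^sup>2 - 4 * ?k\<^sup>2 - 4) * ?S"
    unfolding 1 2 by (simp add: algebra_simps power2_eq_square)
  also have "4 * \<kappa>\<^sup>2 - 4 * ?k\<^sup>2 - 4 = - lam" using \<kappa> by simp
  finally show ?thesis by simp
qed

lemma smoothR_shp: "smoothR {0<..} (shp \<kappa> k)"
proof -
  have l: "smoothR {0<..} (\<lambda>s. c * ln s)" for c
    by (rule smoothR_mult[OF smoothR_const smoothR_ln])
  have e: "smoothR {0<..} (\<lambda>s. exp (c + d * ln s))" for c d
    by (rule smoothR_comp[OF smoothR_exp[of UNIV] smoothR_add[OF smoothR_const l]]) simp
  have "smoothR {0<..} (\<lambda>s. exp (0 + (- (real k + 1) / 2) * ln s) *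
     (exp (\<kappa> * ln 2 + (- \<kappa> / 2) * ln s) * (1 / 2) - exp (- \<kappa> * ln 2 + (\<kappa> / 2) * ln s) * (1 / 2)))"
    by (intro smoothR_mult smoothR_diff smoothR_const e)
  moreover have "shp \<kappa> k = (\<lambda>s. exp (0 + (- (real k + 1) / 2) * ln s) *
     (exp (\<kappa> * ln 2 + (- \<kappa> / 2) * ln s) * (1 / 2) - exp (- \<kappa> * ln 2 + (\<kappa> / 2) * ln s) * (1 / 2)))"
    by (rule ext) (simp add: shp_def sinh_field_def algebra_simps diff_divide_distrib)
  ultimately show ?thesis by simp
qed

lemma shp_1: "shp \<kappa> k 1 = sinh (\<kappa> * ln 2)" "chp \<kappa> k 1 = cosh (\<kappa> * ln 2)"
  by (simp_all add: shp_def chp_def)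

lemma ln_4: "ln 4 = 2 * ln (2 :: real)"
  using ln_realpow[of 2 2] by simp

lemma shp_4: "shp \<kappa> k 4 = 0"
  by (simp add: shp_def ln_4)

text \<open>Replacing s by s exp (-2 \<theta>) raises the argument a of sinh by \<kappa> \<theta>.
  For a \<ge> 0, that is s \<le> 4, sinh a \<le> cosh a in the addition formula gives sinh (a +
  \<kappa> \<theta>) \<ge> exp (\<kappa> \<theta>) sinh a. The power of s accounts for the remaining
  exponent (k + 1) \<theta>.\<close>

lemma shp_decay:
  assumes "0 \<le> \<kappa>" "0 \<le> \<theta>" "0 < s" "s \<le> 4"
  shows "0 \<le> shp \<kappa> k s" "shp \<kappa> k s \<le> exp (- (\<kappa> + 1 + real k) * \<theta>) * shp \<kappa> k (s * exp (- 2 * \<theta>))"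
proof -
  define a where "a = \<kappa> * (ln 2 - ln s / 2)"
  have "ln s \<le> 2 * ln 2" using assms(3,4) by (simp flip: ln_4)
  hence a: "0 \<le> a" using assms(1) by (simp add: a_def)
  thus "0 \<le> shp \<kappa> k s" by (simp add: shp_def a_def[symmetric])
  have l: "ln (s * exp (- 2 * \<theta>)) = ln s - 2 * \<theta>"
    using assms(3) by (simp add: ln_mult)
  have "sinh (a + \<kappa> * \<theta>) = sinh a * cosh (\<kappa> * \<theta>) + cosh a * sinh (\<kappa> * \<theta>)" by (rule sinh_add)
  moreover have "sinh a * sinh (\<kappa> * \<theta>) \<le> cosh a * sinh (\<kappa> * \<theta>)"
    using assms sinh_le_cosh_real[of a] by (intro mult_right_mono) auto
  moreover have "sinh a * exp (\<kappa> * \<theta>) = sinh a * cosh (\<kappa> * \<theta>) + sinh a * sinh (\<kappa> * \<theta>)"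
    by (simp add: cosh_plus_sinh[symmetric] distrib_left del: cosh_plus_sinh)
  ultimately have *: "sinh a * exp (\<kappa> * \<theta>) \<le> sinh (a + \<kappa> * \<theta>)" by linarith
  have "shp \<kappa> k s = exp (- (\<kappa> + 1 + real k) * \<theta>) * (exp (- (real k + 1) / 2 * (ln s - 2 * \<theta>)) * (sinh a * exp (\<kappa> * \<theta>)))"
    by (simp add: shp_def a_def algebra_simps flip: exp_add)
      (simp add: field_simps)
  also have "\<dots> \<le> exp (- (\<kappa> + 1 + real k) * \<theta>) * (exp (- (real k + 1) / 2 * (ln s - 2 * \<theta>)) * sinh (a + \<kappa> * \<theta>))"
    by (intro mult_left_mono *) auto
  also have "\<dots> = exp (- (\<kappa> + 1 + real k) * \<theta>) * shp \<kappa> k (s * exp (- 2 * \<theta>))"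
  proof -
    have "a + \<kappa> * \<theta> = \<kappa> * (ln 2 - (ln s - 2 * \<theta>) / 2)"
      by (simp add: a_def right_diff_distrib diff_divide_distrib)
    thus ?thesis unfolding shp_def l by simp
  qed
  finally show "shp \<kappa> k s \<le> exp (- (\<kappa> + 1 + real k) * \<theta>) * shp \<kappa> k (s * exp (- 2 * \<theta>))" .
qed

text \<open>Smooth approximation of a kinked profile: \<open>\<alpha>\<close> switches from \<open>f\<close> to \<open>g\<close> just after \<open>1\<close>, and \<open>\<beta>\<close>
  cuts off just before \<open>4\<close>. The derivatives \<open>\<alpha>'\<close>, \<open>\<beta>'\<close> are of size \<open>k\<close>, but they only meet factors which
  are \<open>O(s - 1)\<close> and \<open>O(4 - s)\<close>, respectively.\<close>

lemma smooth_profile_approximation: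
  fixes f f' g g' :: "real \<Rightarrow> real"
  assumes sf: "smoothR UNIV f" and sg: "smoothR {0<..} g"
    and df: "\<And>s. (f has_real_derivative f' s) (at s)"
    and dg: "\<And>s. s > 0 \<Longrightarrow> (g has_real_derivative g' s) (at s)"
    and cf': "continuous_on {0..4} f'" and cg': "continuous_on {1..4} g'"
    and fg: "f 1 = g 1" "g 4 = 0"
  obtains G G' :: "nat \<Rightarrow> real \<Rightarrow> real" and C
  where "\<And>k. smoothR UNIV (G k)" "\<And>k s. (G k has_real_derivative G' k s) (at s)"
    "\<And>k s. s \<ge> 4 - 1 / (real k + 1) \<Longrightarrow> G k s = 0"
    "\<And>s. s < 4 \<Longrightarrow> (\<lambda>k. G k s) \<longlonglongrightarrow> (if s \<le> 1 then f s else g s)"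
    "\<And>s. s < 4 \<Longrightarrow> (\<lambda>k. G' k s) \<longlonglongrightarrow> (if s \<le> 1 then f' s else g' s)"
    "\<And>k s. 0 \<le> s \<Longrightarrow> s < 4 \<Longrightarrow> \<bar>G k s\<bar> \<le> C" "\<And>k s. 0 \<le> s \<Longrightarrow> s < 4 \<Longrightarrow> \<bar>G' k s\<bar> \<le> C"
proof -
  have bd: "\<exists>B. \<forall>s\<in>{a..4}. \<bar>w s\<bar> \<le> B" if "continuous_on {a..4} w" for w :: "real \<Rightarrow> real" and a
  proof -
    have "bounded (w ` {a..4})" by (intro compact_imp_bounded compact_continuous_image that compact_Icc)
    thus ?thesis by (auto simp: bounded_iff)
  qed
  have cf: "continuous_on {0..4} f" and cg: "continuous_on {1..4} g"
    using df dg by (auto intro!: DERIV_continuous_on[of _ f f'] DERIV_continuous_on[of _ g g'] intro: has_field_derivative_at_within)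
  obtain B1 B2 B3 B4 where B: "\<forall>s\<in>{0..4}. \<bar>f s\<bar> \<le> B1" "\<forall>s\<in>{0..4}. \<bar>f' s\<bar> \<le> B2"
    "\<forall>s\<in>{1..4}. \<bar>g s\<bar> \<le> B3" "\<forall>s\<in>{1..4}. \<bar>g' s\<bar> \<le> B4"
    using bd[OF cf] bd[OF cf'] bd[OF cg] bd[OF cg'] by metis
  define M where "M = \<bar>B1\<bar> + \<bar>B2\<bar> + \<bar>B3\<bar> + \<bar>B4\<bar>"
  have Mf: "\<bar>f s\<bar> \<le> M" "\<bar>f' s\<bar> \<le> M" if "0 \<le> s" "s \<le> 4" for s
    using B(1)[rule_format, of s] B(2)[rule_format, of s] that by (auto simp: M_def)
  have Mg: "\<bar>g s\<bar> \<le> M" "\<bar>g' s\<bar> \<le> M" if "1 \<le> s" "s \<le> 4" for s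
    using B(3)[rule_format, of s] B(4)[rule_format, of s] that by (auto simp: M_def)
  have M0: "0 \<le> M" by (simp add: M_def)
  \<comment> \<open>Mean value theorem from the common value at 1; \<open>g4\<close> does the same
    from the zero of g at 4. These are the linear factors that absorb the large derivatives of the
    cutoffs.\<close>
  have gf: "\<bar>g s - f s\<bar> \<le> 2 * M * (s - 1)" if s: "1 < s" "s \<le> 4" for s
  proof -
    have "((\<lambda>s. g s - f s) has_real_derivative g' x - f' x) (at x)" if "1 \<le> x" "x \<le> s" for x
      using that by (intro DERIV_diff df dg) auto
    from MVT2[OF s(1) this] obtain z where z: "1 < z" "z < s" "(g s - f s) - (g 1 - f 1) = (s - 1) * (g' z - f' z)"
      by auto
    have "\<bar>g' z - f' z\<bar> \<le> 2 * M" using Mf(2)[of z] Mg(2)[of z] z s by linarith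
    hence "(s - 1) * \<bar>g' z - f' z\<bar> \<le> (s - 1) * (2 * M)" using s by (intro mult_left_mono) auto
    thus ?thesis using z(3) fg(1) s by (simp add: abs_mult mult_ac)
  qed
  have g4: "\<bar>g s\<bar> \<le> M * (4 - s)" if s: "1 < s" "s < 4" for s
  proof -
    have "(g has_real_derivative g' x) (at x)" if "s \<le> x" "x \<le> 4" for x
      using that s by (intro dg) auto
    from MVT2[OF s(2) this] obtain z where z: "s < z" "z < 4" "g 4 - g s = (4 - s) * g' z" by auto
    have "(4 - s) * \<bar>g' z\<bar> \<le> (4 - s) * M" using s z Mg(2)[of z] by (intro mult_left_mono) auto
    moreover have "\<bar>g s\<bar> = (4 - s) * \<bar>g' z\<bar>" using z(3) fg(2) s by (simp add: abs_mult flip: abs_minus_cancel[of "g s"])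
    ultimately show ?thesis by (simp add: mult.commute)
  qed
  define K where "K k = real k + 1" for k
  have K: "K k > 0" for k by (simp add: K_def)
  have Kinf: "filterlim K at_top sequentially" 
    using filterlim_tendsto_add_at_top[OF tendsto_const filterlim_real_sequentially, of 1]
    by (simp add: K_def[abs_def] add.commute)
  \<comment> \<open>The shift by -1 in \<beta> makes it vanish from s = 4 - 1/K on, so that the
    approximants are supported in a compact part of the open disk.\<close>
  define \<alpha> \<alpha>' \<beta> \<beta>' where "\<alpha> k s = bump (K k * (s - 1))" and "\<alpha>' k s = K k * bump' (K k * (s - 1))"
    and "\<beta> k s = bump (K k * (4 - s) - 1)" and "\<beta>' k s = - (K k * bump' (K k * (4 - s) - 1))" for k s
  have d\<alpha>: "(\<alpha> k has_real_derivative \<alpha>' k s) (at s)" for k s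
  proof -
    have "((\<lambda>s. K k * (s - 1)) has_real_derivative K k) (at s)" by (rule derivative_eq_intros refl | simp)+
    from DERIV_chain2[OF bump_has_derivative this] show ?thesis unfolding \<alpha>_def[abs_def] \<alpha>'_def by (simp add: mult.commute)
  qed
  have d\<beta>: "(\<beta> k has_real_derivative \<beta>' k s) (at s)" for k s
  proof -
    have "((\<lambda>s. K k * (4 - s) - 1) has_real_derivative - K k) (at s)" by (rule derivative_eq_intros refl | simp)+
    from DERIV_chain2[OF bump_has_derivative this] show ?thesis unfolding \<beta>_def[abs_def] \<beta>'_def by (simp add: mult.commute)
  qed
  have \<alpha>0: "\<alpha> k s = 0" "\<alpha>' k s = 0" if "s \<le> 1" for k s
  proof -
    have "K k * (s - 1) \<le> 0" using K[of k] that by (simp add: mult_nonneg_nonpos less_imp_le)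
    thus "\<alpha> k s = 0" "\<alpha>' k s = 0" by (auto simp: \<alpha>_def \<alpha>'_def bump_def bump'_def)
  qed
  have \<alpha>b: "0 \<le> \<alpha> k s" "\<alpha> k s \<le> 1" and \<beta>b: "0 \<le> \<beta> k s" "\<beta> k s \<le> 1" for k s
    by (auto simp: \<alpha>_def \<beta>_def bump_bounds)
  have \<alpha>'b: "0 \<le> \<alpha>' k s" "\<alpha>' k s * (s - 1) \<le> 1" for k s
    using bump_bounds(6)[of "K k * (s - 1)"] bump_bounds(4) K[of k] by (auto simp: \<alpha>'_def mult_ac)
  have \<beta>'b: "\<bar>\<beta>' k s\<bar> * (4 - s) \<le> 3" "\<bar>\<beta>' k s\<bar> \<le> 2 * K k" for k s
  proof -
    let ?x = "K k * (4 - s) - 1"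
    have a: "\<bar>\<beta>' k s\<bar> = K k * bump' ?x" using K[of k] bump_bounds(4) by (simp add: \<beta>'_def abs_mult)
    have "\<bar>\<beta>' k s\<bar> * (4 - s) = ?x * bump' ?x + bump' ?x" unfolding a by (simp add: algebra_simps)
    thus "\<bar>\<beta>' k s\<bar> * (4 - s) \<le> 3" using bump_bounds(5,6)[of ?x] by linarith
    show "\<bar>\<beta>' k s\<bar> \<le> 2 * K k" unfolding a using bump_bounds(5)[of ?x] K[of k] by (simp add: mult.commute)
  qed
  define H H' where "H k s = f s + \<alpha> k s * (g s - f s)"
    and "H' k s = f' s + (\<alpha>' k s * (g s - f s) + \<alpha> k s * (g' s - f' s))" for k s
  \<comment> \<open>Nothing is known about g for s \<le> 0, but there \<alpha> vanishes on the whole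
    neighbourhood s < 1 and H reduces to f.\<close>
  have dH: "(H k has_real_derivative H' k s) (at s)" for k s
  proof (cases "s > 0")
    case True
    show ?thesis unfolding H_def[abs_def] H'_def
      by (rule DERIV_cong[OF DERIV_add[OF df DERIV_mult[OF d\<alpha> DERIV_diff[OF dg[OF True] df]]]]) simp
  next
    case False
    have "(f has_real_derivative H' k s) (at s)" using df[of s] False \<alpha>0[of s k] by (simp add: H'_def)
    thus ?thesis
      by (rule has_field_derivative_transform_within_open[of _ _ _ "{..<1}"]) (use False \<alpha>0 in \<open>auto simp: H_def\<close>)
  qed
  have s\<alpha>: "smoothR I (\<alpha> k)" and s\<beta>: "smoothR I (\<beta> k)" for I k
    unfolding \<alpha>_def[abs_def] \<beta>_def[abs_def]
    by (rule smoothR_comp[OF smoothR_bump[of UNIV]] smoothR_mult smoothR_diff smoothR_const smoothR_id | simp)+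
  have sf': "smoothR {0<..} f"
  proof -
    have "smoothR {0<..} (\<lambda>x. f x)" by (rule smoothR_comp[OF sf smoothR_id]) simp
    thus ?thesis by simp
  qed
  have sH: "smoothR UNIV (H k)" for k
  proof -
    have "smoothR {0<..} (H k)" unfolding H_def[abs_def]
      by (rule smoothR_add[OF sf' smoothR_mult[OF s\<alpha> smoothR_diff[OF sg sf']]])
    moreover have "smoothR {..<1} (H k)"
    proof (rule smoothR_cong[OF open_lessThan])
      have "smoothR {..<1} (\<lambda>x. f x)" by (rule smoothR_comp[OF sf smoothR_id]) simp
      thus "smoothR {..<1} f" by simp
    qed (simp add: H_def \<alpha>0)
    ultimately have "smoothR ({0<..} \<union> {..<1}) (H k)" by (rule smoothR_Un[OF open_greaterThan open_lessThan])
    moreover have "{0<..} \<union> {..<1 :: real} = UNIV" by auto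
    ultimately show ?thesis by simp
  qed
  define G G' where "G k s = \<beta> k s * H k s" and "G' k s = \<beta>' k s * H k s + \<beta> k s * H' k s" for k s
  have Hb: "\<bar>H k s\<bar> \<le> 3 * M" if "0 \<le> s" "s \<le> 4" for k s
  proof (cases "s \<le> 1")
    case True
    thus ?thesis using Mf(1)[OF that] M0 by (simp add: H_def \<alpha>0)
  next
    case False
    have "\<alpha> k s * \<bar>g s - f s\<bar> \<le> 1 * (2 * M)"
      using \<alpha>b[of k s] Mf(1)[OF that] Mg(1)[of s] False that by (intro mult_mono) auto
    hence "\<bar>\<alpha> k s * (g s - f s)\<bar> \<le> 2 * M" using \<alpha>b[of k s] by (simp add: abs_mult)
    thus ?thesis using Mf(1)[OF that] unfolding H_def by linarith
  qed
  have H'b: "\<bar>H' k s\<bar> \<le> 5 * M" if "0 \<le> s" "s \<le> 4" for k s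
  proof (cases "s \<le> 1")
    case True
    thus ?thesis using Mf(2)[OF that] M0 by (simp add: H'_def \<alpha>0)
  next
    case False
    have "\<alpha> k s * \<bar>g' s - f' s\<bar> \<le> 1 * (2 * M)"
      using \<alpha>b[of k s] Mf(2)[OF that] Mg(2)[of s] False that by (intro mult_mono) auto
    hence 1: "\<bar>\<alpha> k s * (g' s - f' s)\<bar> \<le> 2 * M" using \<alpha>b[of k s] by (simp add: abs_mult)
    have "\<alpha>' k s * \<bar>g s - f s\<bar> \<le> \<alpha>' k s * (2 * M * (s - 1))"
      using \<alpha>'b(1) gf[of s] False that by (intro mult_left_mono) auto
    also have "\<dots> = 2 * M * (\<alpha>' k s * (s - 1))" by simp
    also have "\<dots> \<le> 2 * M * 1" using \<alpha>'b(2)[of k s] M0 by (intro mult_left_mono) auto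
    finally have "\<bar>\<alpha>' k s * (g s - f s)\<bar> \<le> 2 * M" using \<alpha>'b(1)[of k s] by (simp add: abs_mult)
    thus ?thesis using 1 Mf(2)[OF that] unfolding H'_def by linarith
  qed
  \<comment> \<open>Near 4 the function H is not exactly g, because \<alpha> only tends to 1. The
    part of H along g is controlled by its zero at 4; the part along f carries 1 - \<alpha>, which
    is O(1/K) and compensates a \<beta>' of size 2 K.\<close>
  have \<beta>H: "\<bar>\<beta>' k s\<bar> * \<bar>H k s\<bar> \<le> 6 * M" if s: "0 \<le> s" "s < 4" for k s
  proof (cases "s \<le> 2")
    case True
    have "\<bar>\<beta>' k s\<bar> * 2 \<le> \<bar>\<beta>' k s\<bar> * (4 - s)" using True by (intro mult_left_mono) auto
    hence "\<bar>\<beta>' k s\<bar> \<le> 2" using \<beta>'b(1)[of k s] by linarith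
    hence "\<bar>\<beta>' k s\<bar> * \<bar>H k s\<bar> \<le> 2 * (3 * M)" using Hb[of s k] s by (intro mult_mono) auto
    thus ?thesis by simp
  next
    case False
    have "H k s = (1 - \<alpha> k s) * f s + \<alpha> k s * g s" by (simp add: H_def algebra_simps)
    hence "\<bar>H k s\<bar> \<le> (1 - \<alpha> k s) * \<bar>f s\<bar> + \<alpha> k s * \<bar>g s\<bar>"
      using abs_triangle_ineq[of "(1 - \<alpha> k s) * f s" "\<alpha> k s * g s"] \<alpha>b[of k s] by (simp add: abs_mult)
    hence "\<bar>\<beta>' k s\<bar> * \<bar>H k s\<bar> \<le> \<bar>\<beta>' k s\<bar> * ((1 - \<alpha> k s) * \<bar>f s\<bar> + \<alpha> k s * \<bar>g s\<bar>)"
      by (intro mult_left_mono) auto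
    also have "\<dots> = \<bar>\<beta>' k s\<bar> * (1 - \<alpha> k s) * \<bar>f s\<bar> + \<alpha> k s * (\<bar>\<beta>' k s\<bar> * \<bar>g s\<bar>)" by (simp add: algebra_simps)
    also have "\<dots> \<le> 2 * M + 3 * M"
    proof (rule add_mono)
      have "1 - \<alpha> k s \<le> 1 / (K k * (s - 1))" unfolding \<alpha>_def using False K[of k] by (intro bump_bounds(3)) auto
      also have "\<dots> \<le> 1 / (K k * 1)" using False K[of k] by (intro divide_left_mono mult_left_mono) auto
      finally have "\<bar>\<beta>' k s\<bar> * (1 - \<alpha> k s) \<le> (2 * K k) * (1 / K k)"
        using \<beta>'b(2)[of k s] \<alpha>b[of k s] by (intro mult_mono) auto
      also have "\<dots> = 2" using K[of k] by simp
      finally show "\<bar>\<beta>' k s\<bar> * (1 - \<alpha> k s) * \<bar>f s\<bar> \<le> 2 * M"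
        using Mf(1)[of s] s \<alpha>b[of k s] by (intro mult_mono) auto
      have "\<bar>\<beta>' k s\<bar> * \<bar>g s\<bar> \<le> \<bar>\<beta>' k s\<bar> * (M * (4 - s))"
        using g4[of s] False s by (intro mult_left_mono) auto
      also have "\<dots> = M * (\<bar>\<beta>' k s\<bar> * (4 - s))" by simp
      also have "\<dots> \<le> M * 3" using \<beta>'b(1)[of k s] M0 by (intro mult_left_mono)
      finally have le: "\<bar>\<beta>' k s\<bar> * \<bar>g s\<bar> \<le> M * 3" .
      have "\<alpha> k s * (\<bar>\<beta>' k s\<bar> * \<bar>g s\<bar>) \<le> 1 * (M * 3)"
        by (rule mult_mono[OF \<alpha>b(2) le]) simp_all
      thus "\<alpha> k s * (\<bar>\<beta>' k s\<bar> * \<bar>g s\<bar>) \<le> 3 * M" by simp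
    qed
    finally show ?thesis using M0 by linarith
  qed
  have lim\<alpha>: "(\<lambda>k. \<alpha> k s) \<longlonglongrightarrow> (if s \<le> 1 then 0 else 1)" "(\<lambda>k. \<alpha>' k s) \<longlonglongrightarrow> 0" for s
  proof -
    show "(\<lambda>k. \<alpha> k s) \<longlonglongrightarrow> (if s \<le> 1 then 0 else 1)"
    proof (cases "s \<le> 1")
      case False
      hence "filterlim (\<lambda>k. K k * (s - 1)) at_top sequentially"
        by (intro filterlim_at_top_mult_tendsto_pos[OF tendsto_const _ Kinf]) auto
      from filterlim_compose[OF bump_tendsto(1) this] False show ?thesis by (simp add: \<alpha>_def)
    qed (simp add: \<alpha>0)
    show "(\<lambda>k. \<alpha>' k s) \<longlonglongrightarrow> 0"
    proof (cases "s \<le> 1")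
      case False
      hence "filterlim (\<lambda>k. K k * (s - 1)) at_top sequentially"
        by (intro filterlim_at_top_mult_tendsto_pos[OF tendsto_const _ Kinf]) auto
      from tendsto_divide[OF filterlim_compose[OF bump_tendsto(2) this] tendsto_const[of "s - 1"]] False
      show ?thesis by (simp add: \<alpha>'_def)
    qed (simp add: \<alpha>0)
  qed
  have lim\<beta>: "(\<lambda>k. \<beta> k s) \<longlonglongrightarrow> 1" "(\<lambda>k. \<beta>' k s) \<longlonglongrightarrow> 0" if "s < 4" for s
  proof -
    have "filterlim (\<lambda>k. K k * (4 - s)) at_top sequentially"
      using that by (intro filterlim_at_top_mult_tendsto_pos[OF tendsto_const _ Kinf]) auto
    from filterlim_tendsto_add_at_top[OF tendsto_const this, of "-1"]
    have x: "filterlim (\<lambda>k. K k * (4 - s) - 1) at_top sequentially" by simp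
    from filterlim_compose[OF bump_tendsto(1) x] show "(\<lambda>k. \<beta> k s) \<longlonglongrightarrow> 1" by (simp add: \<beta>_def)
    let ?x = "\<lambda>k. K k * (4 - s) - 1"
    have "(\<lambda>k. - ((?x k * bump' (?x k) + bump' (?x k)) / (4 - s))) \<longlonglongrightarrow> - ((0 + 0) / (4 - s))"
      using that by (intro tendsto_intros filterlim_compose[OF bump_tendsto(2) x] filterlim_compose[OF bump_tendsto(3) x]) auto
    moreover have "\<beta>' k s = - ((?x k * bump' (?x k) + bump' (?x k)) / (4 - s))" for k
      using that by (simp add: \<beta>'_def field_simps)
    ultimately show "(\<lambda>k. \<beta>' k s) \<longlonglongrightarrow> 0" by simp
  qed
  have limH: "(\<lambda>k. H k s) \<longlonglongrightarrow> (if s \<le> 1 then f s else g s)" for s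
  proof -
    have "(\<lambda>k. f s + \<alpha> k s * (g s - f s)) \<longlonglongrightarrow> f s + (if s \<le> 1 then 0 else 1) * (g s - f s)"
      by (intro tendsto_add tendsto_mult tendsto_const lim\<alpha>)
    moreover have "f s + (if s \<le> 1 then 0 else 1) * (g s - f s) = (if s \<le> 1 then f s else g s)" by simp
    ultimately show ?thesis by (simp add: H_def)
  qed
  have limH': "(\<lambda>k. H' k s) \<longlonglongrightarrow> (if s \<le> 1 then f' s else g' s)" for s
  proof -
    have "(\<lambda>k. f' s + (\<alpha>' k s * (g s - f s) + \<alpha> k s * (g' s - f' s)))
      \<longlonglongrightarrow> f' s + (0 * (g s - f s) + (if s \<le> 1 then 0 else 1) * (g' s - f' s))"
      by (intro tendsto_add tendsto_mult tendsto_const lim\<alpha>)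
    moreover have "f' s + (0 * (g s - f s) + (if s \<le> 1 then 0 else 1) * (g' s - f' s)) = (if s \<le> 1 then f' s else g' s)" by simp
    ultimately show ?thesis by (simp add: H'_def)
  qed
  show ?thesis
  proof (rule that[of G G' "11 * M"])
    show "smoothR UNIV (G k)" for k unfolding G_def[abs_def] by (rule smoothR_mult[OF s\<beta> sH])
    show "(G k has_real_derivative G' k s) (at s)" for k s unfolding G_def[abs_def] G'_def
      by (rule DERIV_cong[OF DERIV_mult[OF d\<beta> dH]]) simp
    show "G k s = 0" if "s \<ge> 4 - 1 / (real k + 1)" for k s
    proof -
      have "K k * (4 - s) \<le> K k * (1 / K k)" using that K[of k] by (intro mult_left_mono) (auto simp: K_def)
      hence "K k * (4 - s) - 1 \<le> 0" using K[of k] by simp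
      thus ?thesis by (simp add: G_def \<beta>_def bump_def)
    qed
    show "(\<lambda>k. G k s) \<longlonglongrightarrow> (if s \<le> 1 then f s else g s)" if "s < 4" for s
      using tendsto_mult[OF lim\<beta>(1)[OF that] limH[of s]] by (simp add: G_def)
    show "(\<lambda>k. G' k s) \<longlonglongrightarrow> (if s \<le> 1 then f' s else g' s)" if "s < 4" for s
      using tendsto_add[OF tendsto_mult[OF lim\<beta>(2)[OF that] limH[of s]] tendsto_mult[OF lim\<beta>(1)[OF that] limH'[of s]]]
      by (simp add: G'_def)
    show "\<bar>G k s\<bar> \<le> 11 * M" if "0 \<le> s" "s < 4" for k s
    proof -
      have "\<beta> k s * \<bar>H k s\<bar> \<le> 1 * (3 * M)" using \<beta>b[of k s] Hb[of s k] that by (intro mult_mono) auto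
      thus ?thesis using \<beta>b[of k s] M0 by (simp add: G_def abs_mult)
    qed
    show "\<bar>G' k s\<bar> \<le> 11 * M" if "0 \<le> s" "s < 4" for k s
    proof -
      have "\<beta> k s * \<bar>H' k s\<bar> \<le> 1 * (5 * M)" using \<beta>b[of k s] H'b[of s k] that by (intro mult_mono) auto
      hence "\<bar>\<beta> k s * H' k s\<bar> \<le> 5 * M" using \<beta>b[of k s] by (simp add: abs_mult)
      moreover have "\<bar>\<beta>' k s * H k s\<bar> \<le> 6 * M" using \<beta>H[OF that, of k] by (simp add: abs_mult)
      ultimately show ?thesis unfolding G'_def by linarith
    qed
  qed
qed

section \<open>The harmonic polynomials Re (z^k) and Im (z^k) and their derivatives\<close>

definition sq :: "pt \<Rightarrow> real" where "sq x = (x 0)\<^sup>2 + (x 1)\<^sup>2"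

definition rp :: "nat \<Rightarrow> pt \<Rightarrow> real" where "rp k x = Re (Complex (x 0) (x 1) ^ k)"

definition ip :: "nat \<Rightarrow> pt \<Rightarrow> real" where "ip k x = Im (Complex (x 0) (x 1) ^ k)"

text \<open>Real part of k z^(k-1), respectively of k z^(k-1) times the imaginary unit. At k = 0 the
  factor k makes the truncated exponent harmless.\<close>

definition drp :: "nat \<Rightarrow> nat \<Rightarrow> pt \<Rightarrow> real" where
  "drp i k x = (if i = 0 then k * rp (k - 1) x else - (k * ip (k - 1) x))"

definition dip :: "nat \<Rightarrow> nat \<Rightarrow> pt \<Rightarrow> real" where
  "dip i k x = (if i = 0 then k * ip (k - 1) x else k * rp (k - 1) x)"

lemma sq_nonneg: "0 \<le> sq x" by (simp add: sq_def)

lemma sq_scale: "sq (\<lambda>i. c * x i) = c\<^sup>2 * sq x"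
  by (simp add: sq_def power_mult_distrib distrib_left)

lemma Complex_scale: "Complex (c * a) (c * b) = of_real c * Complex a b"
  by (simp add: complex_eq_iff)

lemma rp_scale: "rp k (\<lambda>i. c * x i) = c ^ k * rp k x"
  by (simp add: rp_def Complex_scale power_mult_distrib flip: of_real_power)

lemma rp_ip_Suc: "rp (Suc k) x = x 0 * rp k x - x 1 * ip k x" "ip (Suc k) x = x 0 * ip k x + x 1 * rp k x"
  by (simp_all add: rp_def ip_def)

lemma rp_ip_pred:
  assumes "k \<ge> 1"
  shows "rp k x = x 0 * rp (k - 1) x - x 1 * ip (k - 1) x" "ip k x = x 0 * ip (k - 1) x + x 1 * rp (k - 1) x"
  using assms rp_ip_Suc[of "k - 1" x] by simp_all

lemma continuous_on_sq: "continuous_on A sq"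
  unfolding sq_def[abs_def] by (intro continuous_intros continuous_on_coord)

lemma smooth_on_sq: "openin (Euclidean_space n) W \<Longrightarrow> smooth_on n W sq"
  unfolding sq_def[abs_def] power2_eq_square by (intro smooth_on_add smooth_on_mult smooth_on_coord)

lemma smooth_on_rp_ip:
  assumes W: "openin (Euclidean_space n) W"
  shows "smooth_on n W (rp k) \<and> smooth_on n W (ip k)"
proof (induction k)
  case 0
  have "rp 0 = (\<lambda>_. 1)" "ip 0 = (\<lambda>_. 0)" by (auto simp: rp_def ip_def)
  thus ?case using smooth_on_const[OF W] by simp
next
  case (Suc k)
  have "rp (Suc k) = (\<lambda>x. x 0 * rp k x - x 1 * ip k x)" "ip (Suc k) = (\<lambda>x. x 0 * ip k x + x 1 * rp k x)"
    by (auto simp: rp_ip_Suc)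
  thus ?case using Suc smooth_on_coord[OF W] smooth_on_diff smooth_on_add smooth_on_mult by simp
qed

lemmas smooth_on_rp = smooth_on_rp_ip[THEN conjunct1] and smooth_on_ip = smooth_on_rp_ip[THEN conjunct2]

lemma has_partial_rp_ip:
  assumes i: "i < 2"
  shows "has_partial W i (rp k) (drp i k)" "has_partial W i (ip k) (dip i k)"
proof -
  have z0: "((\<lambda>t. Complex t b ^ k) has_vector_derivative k * Complex a b ^ (k - 1)) (at a)" for a b
  proof -
    have "((\<lambda>w. (w + \<i> * of_real b) ^ k) has_field_derivative k * (of_real a + \<i> * of_real b) ^ (k - 1)) (at (of_real a))"
      by (rule derivative_eq_intros refl | simp)+
    from has_vector_derivative_real_field[OF this] show ?thesis by (simp add: Complex_eq)
  qed
  have z1: "((\<lambda>t. Complex a t ^ k) has_vector_derivative k * Complex a b ^ (k - 1) * \<i>) (at b)" for a b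
  proof -
    have "((\<lambda>w. (of_real a + \<i> * w) ^ k) has_field_derivative k * (of_real a + \<i> * of_real b) ^ (k - 1) * \<i>) (at (of_real b))"
      by (rule derivative_eq_intros refl | simp)+
    from has_vector_derivative_real_field[OF this] show ?thesis by (simp add: Complex_eq)
  qed
  have "i = 0 \<or> i = 1" using i by auto
  thus "has_partial W i (rp k) (drp i k)" "has_partial W i (ip k) (dip i k)"
    using z0 z1 unfolding has_vector_derivative_complex_iff has_partial_def
    by (auto simp: rp_def ip_def drp_def dip_def)
qed

lemma has_partial_sq: "i < 2 \<Longrightarrow> has_partial W i sq (\<lambda>x. 2 * x i)"
proof -
  assume "i < 2"
  hence "i = 0 \<or> i = 1" by auto
  thus ?thesis unfolding has_partial_def sq_def
    by (auto intro!: derivative_eq_intros)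
qed

lemma radial_has_partial:
  assumes i: "i < 2" and d: "\<And>x. x \<in> W \<Longrightarrow> (F has_real_derivative F' (sq x)) (at (sq x))" and p: "has_partial W i p p'"
  shows "has_partial W i (\<lambda>x. F (sq x) * p x) (\<lambda>x. 2 * x i * F' (sq x) * p x + F (sq x) * p' x)"
  using has_partial_mult[OF has_partial_comp[OF has_partial_sq[OF i] d] p] by (simp add: mult_ac)

lemma has_partial_drp_dip:
  assumes i: "i < 2" "j < 2"
  shows "has_partial W j (drp i k)
      (\<lambda>x. if i = 0 then k * drp j (k - 1) x else - (k * dip j (k - 1) x))"
    "has_partial W j (dip i k) (\<lambda>x. if i = 0 then k * dip j (k - 1) x else k * drp j (k - 1) x)"
proof -
  have r: "has_partial W j (\<lambda>x. c * rp (k - 1) x) (\<lambda>x. c * drp j (k - 1) x)"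
    and s: "has_partial W j (\<lambda>x. c * ip (k - 1) x) (\<lambda>x. c * dip j (k - 1) x)" for c :: real
    using has_partial_mult[OF has_partial_const[of W j c] has_partial_rp_ip(1)[OF i(2), of W "k - 1"]]
      has_partial_mult[OF has_partial_const[of W j c] has_partial_rp_ip(2)[OF i(2), of W "k - 1"]] by simp_all
  show "has_partial W j (drp i k) (\<lambda>x. if i = 0 then k * drp j (k - 1) x else - (k * dip j (k - 1) x))"
    using r[of k] s[of "- k"] by (cases "i = 0") (simp_all add: drp_def[abs_def])
  show "has_partial W j (dip i k) (\<lambda>x. if i = 0 then k * dip j (k - 1) x else k * drp j (k - 1) x)"
    using s[of k] r[of k] by (cases "i = 0") (simp_all add: dip_def[abs_def])
qed

section \<open>Polar geometry of the disk\<close>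

definition disk :: "real \<Rightarrow> pt set" where "disk c = {x \<in> Rn 2. sq x < c}"
definition cdisk :: "real \<Rightarrow> pt set" where "cdisk c = {x \<in> Rn 2. sq x \<le> c}"
definition annulus :: "pt set" where "annulus = {x \<in> Rn 2. 1 < sq x \<and> sq x < 4}"
definition circle :: "pt set" where "circle = {x \<in> Rn 2. sq x = 1}"
definition punctured :: "pt set" where "punctured = {x \<in> Rn 2. 0 < sq x}"

definition emb :: "complex \<Rightarrow> pt" where
  "emb z = (\<lambda>i. if i = 0 then Re z else if i = 1 then Im z else 0)"

lemma continuous_on_emb: "continuous_on A emb"
proof (rule continuous_on_coordinatewise_then_product)
  fix i show "continuous_on A (\<lambda>z. emb z i)"
    by (cases "i = 0"; cases "i = 1") (auto simp: emb_def intro: continuous_intros)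
qed

lemma emb_Complex: "x \<in> Rn 2 \<Longrightarrow> emb (Complex (x 0) (x 1)) = x"
  by (auto simp: emb_def Rn_iff fun_eq_iff)

lemma emb_in_Rn: "emb z \<in> Rn 2" by (simp add: emb_def Rn_iff)

lemma sq_emb: "sq (emb z) = (cmod z)\<^sup>2"
  by (simp add: sq_def emb_def cmod_power2)

lemma cdisk_emb: "r \<ge> 0 \<Longrightarrow> cdisk (r\<^sup>2) = emb ` cball 0 r"
proof (intro equalityI subsetI)
  fix x assume r: "r \<ge> 0" and x: "x \<in> cdisk (r\<^sup>2)"
  hence e: "emb (Complex (x 0) (x 1)) = x" using emb_Complex[of x] by (simp add: cdisk_def)
  have "(cmod (Complex (x 0) (x 1)))\<^sup>2 \<le> r\<^sup>2" using x sq_emb[of "Complex (x 0) (x 1)"] unfolding e by (simp add: cdisk_def)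
  hence "Complex (x 0) (x 1) \<in> cball 0 r" using r by (simp add: power2_le_iff_abs_le)
  with e show "x \<in> emb ` cball 0 r" by (metis imageI)
next
  fix x assume "r \<ge> 0" "x \<in> emb ` cball 0 r"
  thus "x \<in> cdisk (r\<^sup>2)" by (auto simp: cdisk_def sq_emb emb_in_Rn intro!: power_mono)
qed

lemma cdisk4: "cdisk 4 = emb ` cball 0 2"
  using cdisk_emb[of 2] by simp

lemma compact_cdisk4: "compact (cdisk 4)"
  unfolding cdisk4 by (intro compact_continuous_image continuous_on_emb compact_cball)

lemma open_sq: "openin (Euclidean_space 2) {x \<in> Rn 2. sq x \<in> T}" if "open T"
  unfolding openin_Rn_iff
  by (rule exI[of _ "sq -` T"]) (use open_vimage[OF that continuous_on_sq] in auto)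

lemma closed_sq: "closed {x \<in> Rn 2. sq x \<in> T}" if "closed T"
proof -
  have "{x \<in> Rn 2. sq x \<in> T} = Rn 2 \<inter> sq -` T" by auto
  thus ?thesis using closed_vimage[OF that continuous_on_sq] closed_Rn[of 2] by auto
qed

lemma openin_disk: "openin (Euclidean_space 2) (disk c)"
  using open_sq[of "{..<c}"] by (simp add: disk_def)

lemma openin_annulus: "openin (Euclidean_space 2) annulus"
  using open_sq[of "{1<..<4}"] by (simp add: annulus_def)

lemma openin_punctured: "openin (Euclidean_space 2) punctured"
  using open_sq[of "{0<..}"] by (simp add: punctured_def)

lemma closed_circle: "closed circle"
  using closed_sq[of "{1}"] by (simp add: circle_def)

lemma circle_borel: "circle \<in> sets borel"
  using closed_circle by simp

lemma compact_sq: "compact {x \<in> Rn 2. sq x \<in> T}" if "closed T" "T \<subseteq> {..4}"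
proof -
  have "{x \<in> Rn 2. sq x \<in> T} = cdisk 4 \<inter> {x \<in> Rn 2. sq x \<in> T}" using that by (auto simp: cdisk_def)
  thus ?thesis using compact_Int_closed[OF compact_cdisk4 closed_sq[OF that(1)]] by simp
qed

lemma compact_circle: "compact circle"
  using compact_sq[of "{1}"] by (simp add: circle_def)

lemma openin_Rn2: "openin (Euclidean_space 2) (Rn 2)" by simp

lemma compactly_in_disk: "c \<le> 4 \<Longrightarrow> compactly_in 2 (disk c) (Rn 2)"
  unfolding compactly_in_def using openin_disk compact_cdisk4
  by (intro conjI exI[of _ "cdisk 4"]) (auto simp: disk_def cdisk_def)

lemma compactly_in_annulus: "compactly_in 2 annulus punctured"
proof -
  have "compact {x \<in> Rn 2. sq x \<in> {1..4}}" by (rule compact_sq) auto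
  thus ?thesis unfolding compactly_in_def using openin_annulus
    by (intro conjI exI[of _ "{x \<in> Rn 2. sq x \<in> {1..4}}"]) (auto simp: annulus_def punctured_def)
qed

lemma bounded_dom_disk4: "bounded_dom 2 (disk 4)"
  using compactly_in_bounded_dom[OF compactly_in_disk[of 4]] by simp

lemma disk_borel: "disk c \<in> sets borel"
  by (rule openin_Rn_borel[OF openin_disk])

lemma sq_upd: "i < 2 \<Longrightarrow> sq (x(i := t)) = t\<^sup>2 + (x (1 - i))\<^sup>2"
proof -
  assume "i < 2" hence "i = 0 \<or> i = 1" by auto
  thus ?thesis by (auto simp: sq_def)
qed

lemma finite_line_circle: "i < 2 \<Longrightarrow> finite {t. sq (x(i := t)) = 1}"
proof -
  assume i: "i < 2"
  have "{t. sq (x(i := t)) = 1} \<subseteq> {sqrt (1 - (x (1 - i))\<^sup>2), - sqrt (1 - (x (1 - i))\<^sup>2)}"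
  proof
    fix t assume "t \<in> {t. sq (x(i := t)) = 1}"
    hence "t\<^sup>2 = 1 - (x (1 - i))\<^sup>2" using sq_upd[OF i, of x t] by simp
    hence "\<bar>t\<bar> = sqrt (1 - (x (1 - i))\<^sup>2)" by (metis real_sqrt_abs)
    thus "t \<in> {sqrt (1 - (x (1 - i))\<^sup>2), - sqrt (1 - (x (1 - i))\<^sup>2)}" by (auto simp: abs_if split: if_splits)
  qed
  thus ?thesis by (rule finite_subset) simp
qed

lemma circle_null: "circle \<in> null_sets (leb 2)"
proof (rule null_sets_leb_line[OF circle_borel, of 0])
  fix x assume x: "x \<in> Rn 2"
  have "{t. x(0 := t) \<in> circle} \<subseteq> {t. sq (x(0 := t)) = 1}" by (auto simp: circle_def)
  thus "countable {t. x(0 := t) \<in> circle}"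
    using finite_line_circle[of 0 x] by (auto intro: countable_finite finite_subset)
qed simp

section \<open>Gluing along the circle\<close>

definition glue :: "(pt \<Rightarrow> real) \<Rightarrow> (pt \<Rightarrow> real) \<Rightarrow> pt \<Rightarrow> real" where
  "glue v w x = (if sq x \<le> 1 then v x else w x)"

lemma glue_bounded_meas:
  assumes v: "smooth_on 2 (Rn 2) v" and w: "smooth_on 2 punctured w"
  shows "bounded_meas (disk 4) (glue v w)"
proof -
  let ?A = "disk 4 \<inter> {x \<in> Rn 2. sq x \<in> {..1}}" and ?B = "disk 4 - {x \<in> Rn 2. sq x \<in> {..1}}"
  have c: "{x \<in> Rn 2. sq x \<in> {..1}} \<in> sets borel" using closed_sq[of "{..1}"] by simp
  have AB: "?A \<in> sets borel" "?B \<in> sets borel" using c disk_borel by auto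
  have A: "bounded_meas ?A v"
    by (rule bounded_meas_continuous[OF AB(1) continuous_on_subset[OF smooth_onD(2)[OF v]] compact_cdisk4])
      (auto simp: cdisk_def disk_def)
  have K: "compact {x \<in> Rn 2. sq x \<in> {1..4}}" by (rule compact_sq) auto
  have "continuous_on {x \<in> Rn 2. sq x \<in> {1..4}} w"
    by (rule continuous_on_subset[OF smooth_onD(2)[OF w]]) (auto simp: punctured_def)
  hence B: "bounded_meas ?B w"
    by (rule bounded_meas_continuous[OF AB(2) _ K]) (auto simp: disk_def)
  obtain C D where CD: "\<forall>x\<in>?A. \<bar>v x\<bar> \<le> C" "\<forall>x\<in>?B. \<bar>w x\<bar> \<le> D" using A B by (auto simp: bounded_meas_def)
  have "\<bar>glue v w x\<bar> \<le> \<bar>C\<bar> + \<bar>D\<bar>" if "x \<in> disk 4" for x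
    using CD that by (cases "sq x \<le> 1") (force simp: glue_def disk_def)+
  moreover have "(\<lambda>x. indicator ?A x * v x + indicator ?B x * w x) \<in> borel_measurable borel"
    by (rule borel_measurable_add[OF bounded_measD[OF A] bounded_measD[OF B]])
  moreover have "(\<lambda>x. indicator ?A x * v x + indicator ?B x * w x) = (\<lambda>x. indicator (disk 4) x * glue v w x)"
    by (rule ext) (auto simp: indicator_def glue_def disk_def)
  ultimately show ?thesis unfolding bounded_meas_def by auto
qed

text \<open>Agreement on the circle makes the glued function continuous, and a line meets the circle
  in at most two points, which form the exceptional set; derivatives may jump there.\<close>

lemma glue_line_deriv:
  assumes v: "smooth_on 2 (Rn 2) v" and w: "smooth_on 2 punctured w" and i: "i < 2"
    and eq: "\<And>x. x \<in> circle \<Longrightarrow> v x = w x"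
  shows "line_deriv 2 (disk 4) i (glue v w) (glue (partial i v) (partial i w))"
  unfolding line_deriv_def
proof (intro conjI ballI)
  let ?A = "{x \<in> Rn 2. sq x \<in> {..1}}" and ?B = "{x \<in> Rn 2. sq x \<in> {1..4}}"
  have "continuous_on (?A \<union> ?B) (\<lambda>x. if sq x \<le> 1 then v x else w x)"
  proof (rule continuous_on_If)
    show "closed ?A" "closed ?B" by (rule closed_sq, simp)+
    show "continuous_on ?A v" by (rule continuous_on_subset[OF smooth_onD(2)[OF v]]) auto
    show "continuous_on ?B w" by (rule continuous_on_subset[OF smooth_onD(2)[OF w]]) (auto simp: punctured_def)
    show "v x = w x" if "x \<in> ?A" "\<not> sq x \<le> 1" for x using that by simp
    show "v x = w x" if "x \<in> ?B" "sq x \<le> 1" for x using that eq by (auto simp: circle_def)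
  qed
  thus "continuous_on (disk 4) (glue v w)"
    unfolding glue_def[abs_def] by (rule continuous_on_subset) (auto simp: disk_def)
  fix x assume x: "x \<in> Rn 2"
  show "\<exists>E. finite E \<and> (\<forall>t. x(i := t) \<in> disk 4 \<and> t \<notin> E \<longrightarrow>
      ((\<lambda>t. glue v w (x(i := t))) has_real_derivative glue (partial i v) (partial i w) (x(i := t))) (at t))"
  proof (intro exI[of _ "{t. sq (x(i := t)) = 1}"] conjI allI impI finite_line_circle i)
    fix t assume t: "x(i := t) \<in> disk 4 \<and> t \<notin> {t. sq (x(i := t)) = 1}"
    have line: "((\<lambda>t. f (x(i := t))) has_real_derivative partial i f (x(i := t))) (at t)"
      if "smooth_on 2 W f" "x(i := t) \<in> W" for f W
    proof -
      from smooth_onD(3)[OF that(1) i] that(2)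
      have "((\<lambda>t'. f ((x(i := t))(i := t'))) has_real_derivative partial i f (x(i := t))) (at ((x(i := t)) i))"
        unfolding has_partial_def by blast
      thus ?thesis by simp
    qed
    have R: "x(i := t) \<in> Rn 2" for t using upd_in_Rn[OF x i] .
    have cont: "continuous_on UNIV (\<lambda>t. sq (x(i := t)))"
      by (rule continuous_on_compose2[OF continuous_on_sq[of UNIV] continuous_on_upd]) simp
    consider "sq (x(i := t)) < 1" | "sq (x(i := t)) > 1" using t by fastforce
    thus "((\<lambda>t. glue v w (x(i := t))) has_real_derivative glue (partial i v) (partial i w) (x(i := t))) (at t)"
    proof cases
      case 1
      have o: "open {t. sq (x(i := t)) < 1}"
        using open_vimage[OF open_lessThan cont] by (simp add: vimage_def)
      show ?thesis
        by (rule has_field_derivative_transform_within_open[OF _ o, where f = "\<lambda>t. v (x(i := t))"])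
           (use 1 line[OF v R] in \<open>auto simp: glue_def\<close>)
    next
      case 2
      have o: "open {t. 1 < sq (x(i := t))}"
        using open_vimage[OF open_greaterThan cont] by (simp add: vimage_def)
      have "x(i := t) \<in> punctured" using 2 R[of t] by (simp add: punctured_def)
      note lw = line[OF w this]
      show ?thesis
        by (rule has_field_derivative_transform_within_open[OF _ o, where f = "\<lambda>t. w (x(i := t))"])
           (use 2 lw in \<open>auto simp: glue_def\<close>)
    qed
  qed
qed

lemma glue_weak_derivative:
  assumes v: "smooth_on 2 (Rn 2) v" and w: "smooth_on 2 punctured w" and i: "i < 2"
    and eq: "\<And>x. x \<in> circle \<Longrightarrow> v x = w x" and t: "test_function 2 (disk 4) \<phi>"
  shows "(LINT x:disk 4|leb 2. glue v w x * partial i \<phi> x)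
    = - (LINT x:disk 4|leb 2. glue (partial i v) (partial i w) x * \<phi> x)"
  by (rule weak_derivative_line_deriv[OF openin_disk bounded_dom_disk4 i glue_bounded_meas[OF v w]
      glue_bounded_meas[OF smooth_onD(4)[OF v i] smooth_onD(4)[OF w i]] glue_line_deriv[OF v w i eq] t])

lemma glue_has_weak_gradient:
  assumes v: "smooth_on 2 (Rn 2) v" and w: "smooth_on 2 punctured w"
    and eq: "\<And>x. x \<in> circle \<Longrightarrow> v x = w x"
  shows "has_weak_gradient 2 (disk 4) (glue v w) (\<lambda>i. glue (partial i v) (partial i w))"
  by (rule has_weak_gradient_line_deriv[OF openin_disk bounded_dom_disk4 glue_bounded_meas[OF v w]])
    (use glue_bounded_meas smooth_onD(4)[OF v] smooth_onD(4)[OF w] glue_line_deriv[OF v w _ eq] in auto)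

section \<open>The disk as a transmission geometry\<close>

lemma interior_cdisk: "Euclidean_space 2 interior_of (cdisk 4) = disk 4"
proof (rule interior_of_unique)
  show "disk 4 \<subseteq> cdisk 4" by (auto simp: disk_def cdisk_def)
  show "openin (Euclidean_space 2) (disk 4)" by (rule openin_disk)
  fix U assume U: "U \<subseteq> cdisk 4" "openin (Euclidean_space 2) U"
  show "U \<subseteq> disk 4"
  proof
    fix x assume x: "x \<in> U"
    obtain T where T: "open T" "U = Rn 2 \<inter> T" using U(2) unfolding openin_Rn_iff by blast
    have xc: "x \<in> Rn 2" "sq x \<le> 4" using U(1) x by (auto simp: cdisk_def)
    \<comment> \<open>A point of an open subset can be pushed outwards by a factor 1 + e/2 without
      leaving it, so its own radius must be strictly below 2.\<close>
    have c: "continuous_on UNIV (\<lambda>c. (\<lambda>i. c * x i))"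
      by (rule continuous_on_coordinatewise_then_product) (intro continuous_intros)
    have "open ((\<lambda>c. (\<lambda>i. c * x i)) -` T)" by (rule open_vimage[OF T(1) c])
    moreover have "1 \<in> (\<lambda>c. (\<lambda>i. c * x i)) -` T" using x T by simp
    ultimately have "\<exists>e>0. \<forall>c. dist c 1 < e \<longrightarrow> c \<in> (\<lambda>c. (\<lambda>i. c * x i)) -` T"
      unfolding open_dist by (rule bspec)
    then obtain e where e: "e > 0" "\<And>c. dist c 1 < e \<Longrightarrow> (\<lambda>i. c * x i) \<in> T" by auto
    have "(\<lambda>i. (1 + e / 2) * x i) \<in> U"
      using e xc(1) T(2) by (auto simp: dist_real_def Rn_iff)
    hence "(1 + e / 2)\<^sup>2 * sq x \<le> 4" using U(1) by (auto simp: cdisk_def sq_scale)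
    moreover have "1 < (1 + e / 2)\<^sup>2" using e by (simp add: one_less_power)
    ultimately have "sq x < 4"
      using mult_strict_right_mono[of 1 "(1 + e / 2)\<^sup>2" "sq x"] by (cases "0 < sq x"; linarith)
    thus "x \<in> disk 4" using xc by (simp add: disk_def)
  qed
qed

lemma regular_radial:
  assumes W: "openin (Euclidean_space 2) W" "W \<subseteq> punctured"
  shows "regular_function 2 W (\<lambda>x. sq x - c)" "i < 2 \<Longrightarrow> x \<in> W \<Longrightarrow> partial i (\<lambda>x. sq x - c) x = 2 * x i"
proof -
  have p: "partial i (\<lambda>x. sq x - c) x = 2 * x i" if "i < 2" "x \<in> W" for i x
    using has_partial_imp_partial[OF has_partial_add[OF has_partial_sq[OF that(1)] has_partial_const[of W i "- c"]] that(2)]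
    by simp
  show "regular_function 2 W (\<lambda>x. sq x - c)"
    unfolding regular_function_def
  proof (intro conjI ballI)
    show "smooth_on 2 W (\<lambda>x. sq x - c)" by (intro smooth_on_diff smooth_on_sq smooth_on_const W)
    fix x assume x: "x \<in> W"
    hence "0 < sq x" using W(2) by (auto simp: punctured_def)
    hence "x 0 \<noteq> 0 \<or> x 1 \<noteq> 0" by (auto simp: sq_def)
    thus "\<exists>i<2. partial i (\<lambda>x. sq x - c) x \<noteq> 0"
    proof
      assume "x 0 \<noteq> 0" thus ?thesis using p[of 0 x] x by (intro exI[of _ 0]) simp
    next
      assume "x 1 \<noteq> 0" thus ?thesis using p[of 1 x] x by (intro exI[of _ 1]) simp
    qed
  qed
  show "i < 2 \<Longrightarrow> x \<in> W \<Longrightarrow> partial i (\<lambda>x. sq x - c) x = 2 * x i" by (rule p)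
qed

lemma circle_local_equation: "p \<in> circle \<Longrightarrow> local_equation 2 circle p punctured (\<lambda>x. sq x - 1)"
  unfolding local_equation_def using regular_radial(1)[OF openin_punctured subset_refl]
  by (auto simp: circle_def punctured_def)

lemma L2_set_2: "L2_set f {..<2} = sqrt ((f 0)\<^sup>2 + (f (1 :: nat))\<^sup>2)"
  by (simp add: L2_set_def numeral_2_eq_2)

lemma disk_geometry: "transmission_geometry 2 (cdisk 4) circle (disk 1) annulus (\<lambda>x. x)"
  unfolding transmission_geometry_def interior_cdisk
proof (intro conjI)
  show "compactin (Euclidean_space 2) (cdisk 4)"
    using compact_cdisk4 by (auto simp: compactin_Rn_iff cdisk_def)
  have "connected (cdisk 4)" unfolding cdisk4
    by (intro connected_continuous_image continuous_on_emb) simp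
  thus "connectedin (Euclidean_space 2) (cdisk 4)"
    by (auto simp: Euclidean_space_top_of_set connectedin_subtopology cdisk_def topspace_Euclidean_space)
  show "has_smooth_boundary 2 (cdisk 4)"
    unfolding has_smooth_boundary_def
  proof
    fix p assume p: "p \<in> Euclidean_space 2 frontier_of (cdisk 4)"
    have "closedin (Euclidean_space 2) (cdisk 4)"
      using compact_imp_closed[OF compact_cdisk4] by (auto simp: closedin_Euclidean_space_iff cdisk_def)
    hence "p \<in> cdisk 4" "p \<notin> disk 4"
      using p by (auto simp: frontier_of_def interior_cdisk closure_of_closedin)
    hence "p \<in> punctured" by (auto simp: cdisk_def disk_def punctured_def)
    thus "\<exists>U \<rho>. p \<in> U \<and> regular_function 2 U \<rho> \<and> cdisk 4 \<inter> U = {x \<in> U. \<rho> x \<le> 0}"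
      using regular_radial(1)[OF openin_punctured subset_refl, of 4]
      by (intro exI[of _ punctured] exI[of _ "\<lambda>x. sq x - 4"]) (auto simp: cdisk_def punctured_def)
  qed
  have "emb 1 \<in> circle" by (simp add: circle_def emb_in_Rn sq_emb)
  thus "circle \<noteq> {}" by blast
  show "circle \<subseteq> disk 4" by (auto simp: circle_def disk_def)
  show "compactin (Euclidean_space 2) circle"
    using compact_circle by (auto simp: compactin_Rn_iff circle_def)
  show "smooth_hypersurface 2 circle"
    unfolding smooth_hypersurface_def using circle_local_equation by (auto simp: circle_def)
  show "openin (Euclidean_space 2) (disk 1)" "openin (Euclidean_space 2) annulus"
    by (rule openin_disk openin_annulus)+
  show "disk 1 \<inter> annulus = {}" "disk 4 - circle = disk 1 \<union> annulus"
    by (auto simp: disk_def annulus_def circle_def)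
  show "unit_normal_field 2 circle (\<lambda>x. x)"
    unfolding unit_normal_field_def
  proof (intro ballI conjI)
    fix p assume p: "p \<in> circle"
    thus "p \<in> Rn 2" "L2_set p {..<2} = 1" by (auto simp: circle_def sq_def L2_set_2)
    have "p \<in> punctured" using p by (auto simp: circle_def punctured_def)
    hence "\<forall>i<2. p i = 1 / 2 * partial i (\<lambda>x. sq x - 1) p"
      using regular_radial(2)[OF openin_punctured subset_refl] by simp
    with circle_local_equation[OF p]
    show "\<exists>U \<rho> a. local_equation 2 circle p U \<rho> \<and> (\<forall>i<2. p i = a * partial i \<rho> p)" by blast
  qed
  show "normal_from_to circle (\<lambda>x. x) (disk 1) annulus"
    unfolding normal_from_to_def
  proof
    fix p assume p: "p \<in> circle"
    show "\<exists>\<epsilon>>0. \<forall>t\<in>{0<..<\<epsilon>}. (\<lambda>i. p i + t * p i) \<in> annulus \<and> (\<lambda>i. p i - t * p i) \<in> disk 1"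
    \<comment> \<open>For t < 1 the two points have radii 1 + t and 1 - t, which stay below the
      outer radius 2 and in the unit disk.\<close>
    proof (intro exI[of _ "1"] conjI ballI)
      fix t :: real assume t: "t \<in> {0<..<1}"
      have "(\<lambda>i. p i + t * p i) = (\<lambda>i. (1 + t) * p i)" "(\<lambda>i. p i - t * p i) = (\<lambda>i. (1 - t) * p i)"
        by (auto simp: algebra_simps)
      moreover have "1 < (1 + t)\<^sup>2" "(1 - t)\<^sup>2 < 1"
        using t by (auto intro!: one_less_power simp: abs_square_less_1)
      moreover have "(1 + t)\<^sup>2 < 2\<^sup>2" using t by (intro power_strict_mono) auto
      ultimately show "(\<lambda>i. p i + t * p i) \<in> annulus" "(\<lambda>i. p i - t * p i) \<in> disk 1"
        using p sq_scale[of "1 + t" p] sq_scale[of "1 - t" p] by (auto simp: annulus_def disk_def circle_def Rn_iff)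
    qed simp
  qed
qed

lemma disk_coefficient: "transmission_coefficient 2 circle (disk 1) annulus (\<lambda>_. 1) (\<lambda>x. 4 * sq x)"
  unfolding transmission_coefficient_def
proof (intro conjI ballI)
  have c: "closedin (Euclidean_space 2) {x \<in> Rn 2. sq x \<in> {1..4}}"
    using closed_sq[of "{1..4}"] by (auto simp: closedin_Euclidean_space_iff)
  have sub: "Euclidean_space 2 closure_of annulus \<subseteq> {x \<in> Rn 2. sq x \<in> {1..4}}"
    by (rule closure_of_minimal[OF _ c]) (auto simp: annulus_def)
  show "smooth_up_to_boundary 2 (disk 1) (\<lambda>_. 1)"
    unfolding smooth_up_to_boundary_def
    by (intro exI[of _ "Rn 2"] conjI closure_of_subset_topspace smooth_on_const openin_Rn2)
  show "smooth_up_to_boundary 2 annulus (\<lambda>x. 4 * sq x)"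
    unfolding smooth_up_to_boundary_def
    by (intro exI[of _ "Rn 2"] conjI closure_of_subset_topspace smooth_on_mult smooth_on_const smooth_on_sq openin_Rn2)
  show "4 * sq x > 0" if "x \<in> Euclidean_space 2 closure_of annulus" for x
    using sub that by force
  show "1 \<noteq> 4 * sq x" if "x \<in> circle" for x using that by (auto simp: circle_def)
qed simp

section \<open>Trapped modes\<close>

definition rgrad :: "(real \<Rightarrow> real) \<Rightarrow> (real \<Rightarrow> real) \<Rightarrow> nat \<Rightarrow> nat \<Rightarrow> pt \<Rightarrow> real" where
  "rgrad F F' k i x = 2 * x i * F' (sq x) * rp k x + F (sq x) * drp i k x"

text \<open>The second derivative taken twice in direction i. The conditional is the second
  derivative of Re (z^k), obtained by differentiating \<open>drp i k\<close> once more.\<close>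

definition rhess :: "(real \<Rightarrow> real) \<Rightarrow> (real \<Rightarrow> real) \<Rightarrow> (real \<Rightarrow> real) \<Rightarrow> nat \<Rightarrow> nat \<Rightarrow> pt \<Rightarrow> real" where
  "rhess F F' F'' k i x = 2 * (F' (sq x) * rp k x)
     + 2 * x i * (2 * x i * F'' (sq x) * rp k x + F' (sq x) * drp i k x)
     + (2 * x i * F' (sq x) * drp i k x
        + F (sq x) * (if i = 0 then k * drp 0 (k - 1) x else - (k * dip 1 (k - 1) x)))"

lemma has_partial_rgrad:
  assumes i: "i < 2" and d: "\<And>x. x \<in> W \<Longrightarrow> (F has_real_derivative F' (sq x)) (at (sq x))"
  shows "has_partial W i (\<lambda>x. F (sq x) * rp k x) (rgrad F F' k i)"
  using radial_has_partial[OF i d has_partial_rp_ip(1)[OF i], of W k] by (simp add: rgrad_def[abs_def])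

lemma has_partial_rhess:
  assumes i: "i < 2" and d: "\<And>x. x \<in> W \<Longrightarrow> (F has_real_derivative F' (sq x)) (at (sq x))"
    and d': "\<And>x. x \<in> W \<Longrightarrow> (F' has_real_derivative F'' (sq x)) (at (sq x))"
  shows "has_partial W i (rgrad F F' k i) (rhess F F' F'' k i)"
proof -
  have a: "has_partial W i (\<lambda>x. 2 * x i) (\<lambda>_. 2)"
    using has_partial_mult[OF has_partial_const[of W i 2] has_partial_coord[of W i i]] by simp
  have b: "has_partial W i (\<lambda>x. 2 * x i * (F' (sq x) * rp k x))
     (\<lambda>x. 2 * (F' (sq x) * rp k x) + 2 * x i * (2 * x i * F'' (sq x) * rp k x + F' (sq x) * drp i k x))"
    by (rule has_partial_mult[OF a radial_has_partial[OF i d' has_partial_rp_ip(1)[OF i]]])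
  have c: "has_partial W i (\<lambda>x. F (sq x) * drp i k x) (\<lambda>x. 2 * x i * F' (sq x) * drp i k x
      + F (sq x) * (if i = 0 then k * drp i (k - 1) x else - (k * dip i (k - 1) x)))"
    by (rule radial_has_partial[OF i d has_partial_drp_dip(1)[OF i i]])
  have "i = 0 \<or> i = 1" using i by auto
  thus ?thesis using has_partial_add[OF b c] by (auto simp: rgrad_def[abs_def] rhess_def[abs_def] mult_ac)
qed

text \<open>Euler's identity for a homogeneous polynomial of degree k.\<close>

lemma euler_rp:
  assumes "k \<ge> 1" shows "x 0 * drp 0 k x + x 1 * drp 1 k x = k * rp k x"
proof -
  have "x 0 * drp 0 k x + x 1 * drp 1 k x = k * (x 0 * rp (k - 1) x - x 1 * ip (k - 1) x)"
    by (simp add: drp_def algebra_simps)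
  thus ?thesis by (simp only: rp_ip_pred(1)[OF assms, symmetric])
qed

text \<open>The Laplacian of F(s) p for p harmonic and homogeneous of degree k: F alone gives 4 s
  F'' + 4 F', the mixed term gives 4 k F' by Euler's identity, and the Laplacian of p
  vanishes.\<close>

lemma rhess_sum:
  assumes "k \<ge> 1"
  shows "rhess F F' F'' k 0 x + rhess F F' F'' k 1 x = (4 * sq x * F'' (sq x) + 4 * (real k + 1) * F' (sq x)) * rp k x"
proof -
  have h: "k * drp 0 (k - 1) x - k * dip 1 (k - 1) x = 0" by (simp add: drp_def dip_def)
  have "rhess F F' F'' k 0 x + rhess F F' F'' k 1 x =
     4 * F' (sq x) * rp k x + 4 * ((x 0)\<^sup>2 + (x 1)\<^sup>2) * F'' (sq x) * rp k x
     + 4 * F' (sq x) * (x 0 * drp 0 k x + x 1 * drp 1 k x) + F (sq x) * (k * drp 0 (k - 1) x - k * dip 1 (k - 1) x)"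
    by (simp add: rhess_def algebra_simps power2_eq_square)
  thus ?thesis unfolding h euler_rp[OF assms] sq_def[symmetric] by (simp add: algebra_simps)
qed

lemma rgrad_radial:
  assumes "k \<ge> 1"
  shows "x 0 * rgrad F F' k 0 x + x 1 * rgrad F F' k 1 x = (2 * sq x * F' (sq x) + k * F (sq x)) * rp k x"
proof -
  have "x 0 * rgrad F F' k 0 x + x 1 * rgrad F F' k 1 x =
     2 * ((x 0)\<^sup>2 + (x 1)\<^sup>2) * F' (sq x) * rp k x + F (sq x) * (x 0 * drp 0 k x + x 1 * drp 1 k x)"
    by (simp add: rgrad_def algebra_simps power2_eq_square)
  thus ?thesis unfolding euler_rp[OF assms] sq_def[symmetric] by (simp add: algebra_simps)
qed

lemma smooth_on_cong:
  assumes "smooth_on n W f" "\<And>x. x \<in> W \<Longrightarrow> f x = g x" shows "smooth_on n W g"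
  using assms Ck_cong[of n W f g] unfolding smooth_on_iff_Ck by blast

lemma bounded_meas_indicator:
  assumes "\<Omega> \<in> sets borel" "A \<in> sets borel" shows "bounded_meas \<Omega> (indicator A)"
proof -
  have "(\<lambda>x. indicator \<Omega> x * indicator A x :: real) \<in> borel_measurable borel"
    by (intro borel_measurable_times borel_measurable_indicator assms)
  moreover have "\<forall>x\<in>\<Omega>. \<bar>indicator A x :: real\<bar> \<le> 1" by (simp add: indicator_def)
  ultimately show ?thesis unfolding bounded_meas_def by blast
qed

lemma set_integral_cong_null:
  fixes a b :: "pt \<Rightarrow> real"
  assumes "bounded_meas \<Omega> a" "bounded_meas \<Omega> b" "N \<in> null_sets (leb n)" "\<And>x. x \<in> \<Omega> - N \<Longrightarrow> a x = b x"
  shows "(LINT x:\<Omega>|leb n. a x) = (LINT x:\<Omega>|leb n. b x)"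
  unfolding set_lebesgue_integral_def real_scaleR_def
proof (rule integral_cong_AE)
  show "AE x in leb n. indicator \<Omega> x * a x = indicator \<Omega> x * b x"
    using AE_not_in[OF assms(3)] by eventually_elim (use assms(4) in \<open>auto simp: indicator_def\<close>)
qed (rule measurable_leb[OF bounded_measD] assms)+

lemma space_surface_measure: "space (surface_measure n S) = S"
  unfolding surface_measure_def by (rule space_measure_of) auto

lemma abs_mult_le: "\<bar>a\<bar> \<le> A \<Longrightarrow> \<bar>b\<bar> \<le> B \<Longrightarrow> \<bar>a * b\<bar> \<le> A * (B :: real)"
  unfolding abs_mult by (intro mult_mono) auto

text \<open>Collects what membership in the domain and the eigenvalue equation need, apart from
  Bessel functions. \<open>flux\<close> compares r d/dr of both halves at r = 1 with the
  coefficients 1 and 4; \<open>ode_f\<close> and \<open>ode_g\<close> are the radial forms of the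
  equations with coefficient 1 and 4 r^2.\<close>

locale trapped_mode =
  fixes k :: nat and lam :: real and f f' f'' g g' g'' :: "real \<Rightarrow> real"
  assumes k: "k \<ge> 1"
    and smooth_f: "smoothR UNIV f" and smooth_g: "smoothR {0<..} g"
    and df: "\<And>s. (f has_real_derivative f' s) (at s)" and df': "\<And>s. (f' has_real_derivative f'' s) (at s)"
    and dg: "\<And>s. s > 0 \<Longrightarrow> (g has_real_derivative g' s) (at s)"
    and dg': "\<And>s. s > 0 \<Longrightarrow> (g' has_real_derivative g'' s) (at s)"
    and match: "f 1 = g 1" and dirichlet: "g 4 = 0"
    and flux: "2 * f' 1 + k * f 1 = 4 * (2 * g' 1 + k * g 1)"
    and ode_f: "\<And>s. 4 * s * f'' s + 4 * (real k + 1) * f' s = - (lam * f s)"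
    and ode_g: "\<And>s. s > 0 \<Longrightarrow> 4 * s * (4 * s * g'' s + 4 * (real k + 1) * g' s)
      + 8 * (2 * s * g' s + real k * g s) = - (lam * g s)"
begin

text \<open>Both halves are kept as functions beyond their own domains: \<open>um\<close> is smooth
  on the plane and \<open>up\<close> on the plane without the origin. Hence each is smooth across
  the circle, where the traces are taken.\<close>

definition um :: "pt \<Rightarrow> real" where "um x = f (sq x) * rp k x"
definition up :: "pt \<Rightarrow> real" where "up x = g (sq x) * rp k x"
definition u :: "pt \<Rightarrow> real" where "u = glue um up"

lemma u_eq: "u x = (if sq x \<le> 1 then f (sq x) else g (sq x)) * rp k x"
  by (simp add: u_def glue_def um_def up_def)

lemma smooth_um: "smooth_on 2 (Rn 2) um"
  unfolding um_def[abs_def]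
  by (rule smooth_on_mult[OF smooth_on_comp[OF smooth_f smooth_on_sq[OF openin_Rn2]] smooth_on_rp[OF openin_Rn2]]) simp

lemma smooth_up: "smooth_on 2 punctured up"
  unfolding up_def[abs_def]
  by (rule smooth_on_mult[OF smooth_on_comp[OF smooth_g smooth_on_sq[OF openin_punctured]] smooth_on_rp[OF openin_punctured]])
    (auto simp: punctured_def)

lemma partial_um: "i < 2 \<Longrightarrow> partial i um x = rgrad f f' k i x"
  using has_partial_imp_partial[OF has_partial_rgrad[of i UNIV f f' k], of x] df by (simp add: um_def[abs_def])

lemma partial_up: "i < 2 \<Longrightarrow> x \<in> punctured \<Longrightarrow> partial i up x = rgrad g g' k i x"
  using has_partial_imp_partial[OF has_partial_rgrad[of i punctured g g' k], of x] dg
  by (simp add: up_def[abs_def] punctured_def)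

lemma um_up_circle: "x \<in> circle \<Longrightarrow> um x = up x"
  by (simp add: um_def up_def circle_def match)

lemma um_u: "x \<in> disk 1 \<Longrightarrow> um x = u x" and up_u: "x \<in> annulus \<Longrightarrow> up x = u x"
  by (auto simp: u_def glue_def disk_def annulus_def)

lemma circle_subset: "circle \<subseteq> Rn 2" "circle \<subseteq> punctured"
  by (auto simp: circle_def punctured_def)

lemma continuity_u: "continuity_condition 2 circle (disk 1) annulus u"
  unfolding continuity_condition_def
proof (intro exI conjI)
  show "has_trace 2 (disk 1) circle u um"
    by (rule smooth_on_has_trace[OF smooth_um compactly_in_disk um_u circle_borel circle_subset(1)]) auto
  show "has_trace 2 annulus circle u up"
    by (rule smooth_on_has_trace[OF smooth_up compactly_in_annulus up_u circle_borel circle_subset(2)])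
  show "AE x in surface_measure 2 circle. um x = up x"
    by (rule AE_I2) (simp add: space_surface_measure um_up_circle)
qed

lemma flux_u: "flux_condition 2 circle (disk 1) annulus (\<lambda>x. x) (\<lambda>_. 1) (\<lambda>x. 4 * sq x) u"
  unfolding flux_condition_def
proof (intro exI conjI)
  show "has_normal_trace 2 (disk 1) circle (\<lambda>x. x) u (\<lambda>x. \<Sum>i<2. x i * partial i um x)"
    by (rule smooth_on_has_normal_trace[OF smooth_um compactly_in_disk um_u circle_borel circle_subset(1)]) auto
  show "has_normal_trace 2 annulus circle (\<lambda>x. x) u (\<lambda>x. \<Sum>i<2. x i * partial i up x)"
    by (rule smooth_on_has_normal_trace[OF smooth_up compactly_in_annulus up_u circle_borel circle_subset(2)])
  show "AE x in surface_measure 2 circle. 1 * (\<Sum>i<2. x i * partial i um x) = 4 * sq x * (\<Sum>i<2. x i * partial i up x)"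
  proof (rule AE_I2)
    fix x assume "x \<in> space (surface_measure 2 circle)"
    hence x: "x \<in> circle" by (simp add: space_surface_measure)
    hence s: "sq x = 1" and xp: "x \<in> punctured" using circle_subset by (auto simp: circle_def)
    have "(\<Sum>i<2. x i * partial i um x) = (2 * f' 1 + k * f 1) * rp k x"
      using rgrad_radial[OF k, of x f f'] s by (simp add: numeral_2_eq_2 partial_um)
    moreover have "(\<Sum>i<2. x i * partial i up x) = (2 * g' 1 + k * g 1) * rp k x"
      using rgrad_radial[OF k, of x g g'] s xp by (simp add: numeral_2_eq_2 partial_up)
    ultimately show "1 * (\<Sum>i<2. x i * partial i um x) = 4 * sq x * (\<Sum>i<2. x i * partial i up x)"
      unfolding s flux by simp
  qed
qed

lemma weak_gradient_u: "has_weak_gradient 2 (disk 4) u (\<lambda>i. glue (partial i um) (partial i up))"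
  unfolding u_def by (rule glue_has_weak_gradient[OF smooth_um smooth_up um_up_circle])

lemma bounded_meas_u: "bounded_meas (disk 4) u"
  unfolding u_def by (rule glue_bounded_meas[OF smooth_um smooth_up])

lemma H1_u: "H1 2 (disk 4) u"
  unfolding H1_def using L2_on_bounded_meas[OF bounded_dom_disk4 bounded_meas_u] weak_gradient_u by blast

text \<open>The smoothed profiles times Re (z^k) are test functions; values and derivatives converge
  pointwise and are bounded uniformly in j, so dominated convergence gives convergence in
  H1.\<close>

lemma H10_u: "H10 2 (disk 4) u"
proof -
  have cf': "continuous_on {0..4} f'"
    by (rule DERIV_continuous_on[OF has_field_derivative_at_within[OF df']])
  have cg': "continuous_on {1..4} g'"
    by (rule DERIV_continuous_on[OF has_field_derivative_at_within[OF dg']]) simp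
  obtain G G' C where G: "\<And>j. smoothR UNIV (G j)" "\<And>j s. (G j has_real_derivative G' j s) (at s)"
    "\<And>j s. s \<ge> 4 - 1 / (real j + 1) \<Longrightarrow> G j s = 0"
    "\<And>s. s < 4 \<Longrightarrow> (\<lambda>j. G j s) \<longlonglongrightarrow> (if s \<le> 1 then f s else g s)"
    "\<And>s. s < 4 \<Longrightarrow> (\<lambda>j. G' j s) \<longlonglongrightarrow> (if s \<le> 1 then f' s else g' s)"
    "\<And>j s. 0 \<le> s \<Longrightarrow> s < 4 \<Longrightarrow> \<bar>G j s\<bar> \<le> C" "\<And>j s. 0 \<le> s \<Longrightarrow> s < 4 \<Longrightarrow> \<bar>G' j s\<bar> \<le> C"
    using smooth_profile_approximation[OF smooth_f smooth_g df dg cf' cg' match dirichlet] by blast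
  define \<phi> where "\<phi> j x = G j (sq x) * rp k x" for j :: nat and x
  have s\<phi>: "smooth_on 2 (Rn 2) (\<phi> j)" for j
    unfolding \<phi>_def[abs_def]
    by (rule smooth_on_mult[OF smooth_on_comp[OF G(1) smooth_on_sq[OF openin_Rn2]] smooth_on_rp[OF openin_Rn2]]) simp
  have p\<phi>: "partial i (\<phi> j) x = rgrad (G j) (G' j) k i x" if "i < 2" for i j x
    using has_partial_imp_partial[OF has_partial_rgrad[OF that G(2)], of x UNIV] by (simp add: \<phi>_def[abs_def])
  have test: "test_function 2 (disk 4) (\<phi> j)" for j
    unfolding test_function_def
  proof (intro conjI s\<phi> exI[of _ "{x \<in> Rn 2. sq x \<in> {..4 - 1 / (real j + 1)}}"] ballI)
    show "{x \<in> Rn 2. sq x \<in> {..4 - 1 / (real j + 1)}} \<subseteq> disk 4"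
      by (auto simp: disk_def intro: le_less_trans)
    show "compactin (Euclidean_space 2) {x \<in> Rn 2. sq x \<in> {..4 - 1 / (real j + 1)}}"
      unfolding compactin_Rn_iff by (intro conjI compact_sq) (auto intro: order_trans)
    show "\<phi> j x = 0" if "x \<in> Rn 2 - {x \<in> Rn 2. sq x \<in> {..4 - 1 / (real j + 1)}}" for x
    proof -
      have "4 - 1 / (real j + 1) \<le> sq x" using that by auto
      thus ?thesis by (simp add: \<phi>_def G(3))
    qed
  qed
  have db: "disk 4 \<in> sets borel" by (rule disk_borel)
  have bm: "bounded_meas (disk 4) h" if "smooth_on 2 (Rn 2) h" for h
    by (rule smooth_on_bounded_meas[OF that compactly_in_disk]) simp
  have cb: "\<exists>B. \<forall>x\<in>disk 4. \<bar>h x\<bar> \<le> B" if "bounded_meas (disk 4) h" for h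
    using that by (simp add: bounded_meas_def)
  obtain R where R: "\<forall>x\<in>disk 4. \<bar>rp k x\<bar> \<le> R" using cb[OF bm[OF smooth_on_rp[OF openin_Rn2]]] by blast
  obtain U where U: "\<forall>x\<in>disk 4. \<bar>u x\<bar> \<le> U" using cb[OF bounded_meas_u] by blast
  have s: "0 \<le> sq x" "sq x < 4" if "x \<in> disk 4" for x using that by (auto simp: disk_def sq_nonneg)
  have lim0: "(\<lambda>j. L2_norm 2 (disk 4) (\<lambda>x. \<phi> j x - u x)) \<longlonglongrightarrow> 0"
  proof (rule L2_norm_tendsto_0[OF bounded_dom_disk4, where C = "C * R + U"])
    show "bounded_meas (disk 4) (\<lambda>x. \<phi> j x - u x)" for j
      by (rule bounded_meas_diff[OF db bm[OF s\<phi>] bounded_meas_u])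
    show "\<bar>\<phi> j x - u x\<bar> \<le> C * R + U" if "x \<in> disk 4" for j x
      using abs_mult_le[OF G(6)[OF s[OF that], of j] R[rule_format, OF that]] U[rule_format, OF that]
      unfolding \<phi>_def by linarith
    show "(\<lambda>j. \<phi> j x - u x) \<longlonglongrightarrow> 0" if "x \<in> disk 4" for x
      using tendsto_diff[OF tendsto_mult[OF G(4)[OF s(2)[OF that]] tendsto_const[of "rp k x"]] tendsto_const[of "u x"]]
      by (simp add: \<phi>_def u_eq)
  qed
  have lim1: "(\<lambda>j. L2_norm 2 (disk 4) (\<lambda>x. partial i (\<phi> j) x - glue (partial i um) (partial i up) x)) \<longlonglongrightarrow> 0"
    if i: "i < 2" for i
  proof -
    have "drp i k = partial i (rp k)"
      using has_partial_imp_partial[OF has_partial_rp_ip(1)[OF i, of UNIV k]] by (auto simp: fun_eq_iff)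
    hence "smooth_on 2 (Rn 2) (drp i k)" using smooth_onD(4)[OF smooth_on_rp[OF openin_Rn2] i] by simp
    then obtain R' where R': "\<forall>x\<in>disk 4. \<bar>drp i k x\<bar> \<le> R'" using cb[OF bm] by blast
    obtain X where X: "\<forall>x\<in>disk 4. \<bar>2 * x i\<bar> \<le> X"
      using cb[OF bm[OF smooth_on_mult[OF smooth_on_const[OF openin_Rn2] smooth_on_coord[OF openin_Rn2]]]] by blast
    have bg: "bounded_meas (disk 4) (glue (partial i um) (partial i up))"
      by (rule glue_bounded_meas[OF smooth_onD(4)[OF smooth_um i] smooth_onD(4)[OF smooth_up i]])
    then obtain V where V: "\<forall>x\<in>disk 4. \<bar>glue (partial i um) (partial i up) x\<bar> \<le> V" using cb by blast
    show ?thesis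
    proof (rule L2_norm_tendsto_0[OF bounded_dom_disk4, where C = "X * C * R + C * R' + V"])
      show "bounded_meas (disk 4) (\<lambda>x. partial i (\<phi> j) x - glue (partial i um) (partial i up) x)" for j
        by (rule bounded_meas_diff[OF db bm[OF smooth_onD(4)[OF s\<phi> i]] bg])
      show "\<bar>partial i (\<phi> j) x - glue (partial i um) (partial i up) x\<bar> \<le> X * C * R + C * R' + V" if x: "x \<in> disk 4" for j x
      proof -
        have "\<bar>2 * x i * G' j (sq x) * rp k x\<bar> \<le> X * C * R"
          by (intro abs_mult_le X[rule_format, OF x] G(7)[OF s[OF x]] R[rule_format, OF x])
        moreover have "\<bar>G j (sq x) * drp i k x\<bar> \<le> C * R'"
          by (intro abs_mult_le G(6)[OF s[OF x]] R'[rule_format, OF x])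
        ultimately show ?thesis using V[rule_format, OF x] unfolding p\<phi>[OF i] rgrad_def by linarith
      qed
      show "(\<lambda>j. partial i (\<phi> j) x - glue (partial i um) (partial i up) x) \<longlonglongrightarrow> 0" if x: "x \<in> disk 4" for x
      proof -
        have "glue (partial i um) (partial i up) x = 2 * x i * (if sq x \<le> 1 then f' (sq x) else g' (sq x)) * rp k x
            + (if sq x \<le> 1 then f (sq x) else g (sq x)) * drp i k x"
        proof (cases "sq x \<le> 1")
          case False
          hence "x \<in> punctured" using x by (simp add: disk_def punctured_def)
          thus ?thesis using False by (simp add: glue_def partial_up[OF i] rgrad_def)
        qed (simp add: glue_def partial_um[OF i] rgrad_def)
        moreover have "(\<lambda>j. 2 * x i * G' j (sq x) * rp k x + G j (sq x) * drp i k x) \<longlonglongrightarrow>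
            2 * x i * (if sq x \<le> 1 then f' (sq x) else g' (sq x)) * rp k x
            + (if sq x \<le> 1 then f (sq x) else g (sq x)) * drp i k x"
          by (intro tendsto_add tendsto_mult tendsto_const G(4)[OF s(2)[OF x]] G(5)[OF s(2)[OF x]])
        ultimately show ?thesis unfolding p\<phi>[OF i] rgrad_def by (simp only: LIM_zero)
      qed
    qed
  qed
  have "H1_approximates 2 (disk 4) \<phi> u"
    unfolding H1_approximates_def using lim0 lim1 weak_gradient_u by blast
  thus ?thesis unfolding H10_def using H1_u test by blast
qed

lemma operator_domain_u:
  "u \<in> operator_domain 2 (cdisk 4) circle (disk 1) annulus (\<lambda>x. x) (\<lambda>_. 1) (\<lambda>x. 4 * sq x)"
proof -
  have "H2 2 (disk 1) u" by (rule smooth_on_H2[OF smooth_um compactly_in_disk um_u]) auto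
  moreover have "H2 2 annulus u" by (rule smooth_on_H2[OF smooth_up compactly_in_annulus up_u])
  ultimately show ?thesis using H10_u flux_u by (simp add: operator_domain_def interior_cdisk)
qed

text \<open>On the annulus the flux \<open>c \<nabla>u\<close> is split into a field \<open>H\<close> which continues the flux inside the
  circle continuously, and the divergence-free field \<open>(\<partial>\<^sub>1 \<psi>, - \<partial>\<^sub>0 \<psi>)\<close>. As \<open>\<psi>\<close> vanishes on the circle,
  the latter is weakly divergence-free after extension by \<open>0\<close>, so that only \<open>H\<close> contributes.\<close>

definition psi :: "pt \<Rightarrow> real" where
  "psi x = (3 / 2 * k * f 1) * (sq x - 1) * ip k x"

definition dpsi :: "nat \<Rightarrow> pt \<Rightarrow> real" where
  "dpsi i x = (3 / 2 * k * f 1) * (2 * x i * ip k x + (sq x - 1) * dip i k x)"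

text \<open>Signs of the rotated gradient with components - d_1 psi and d_0 psi, which is added to
  the outer flux to obtain \<open>Hp\<close>.\<close>

definition sgn2 :: "nat \<Rightarrow> real" where "sgn2 i = (if i = 0 then -1 else 1)"

definition Hp :: "nat \<Rightarrow> pt \<Rightarrow> real" where
  "Hp i x = 4 * sq x * rgrad g g' k i x + sgn2 i * dpsi (1 - i) x"

lemma has_partial_psi: "i < 2 \<Longrightarrow> has_partial W i psi (dpsi i)"
proof -
  assume i: "i < 2"
  have a: "has_partial W i (\<lambda>x. sq x - 1) (\<lambda>x. 2 * x i)"
    using has_partial_add[OF has_partial_sq[OF i] has_partial_const[of W i "- 1"]] by simp
  have "has_partial W i (\<lambda>x. (3 / 2 * k * f 1) * ((sq x - 1) * ip k x)) (dpsi i)"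
    using has_partial_mult[OF has_partial_const[of W i "3 / 2 * k * f 1"] has_partial_mult[OF a has_partial_rp_ip(2)[OF i, of W k]]]
    by (simp add: dpsi_def[abs_def])
  thus ?thesis by (simp add: psi_def[abs_def] mult.assoc)
qed

lemma smooth_psi: "smooth_on 2 (Rn 2) psi"
  unfolding psi_def[abs_def]
  by (intro smooth_on_mult smooth_on_diff smooth_on_const smooth_on_sq smooth_on_ip openin_Rn2)

lemma smooth_on_punctured: "smooth_on 2 (Rn 2) h \<Longrightarrow> smooth_on 2 punctured h"
  unfolding smooth_on_iff_Ck
proof (intro conjI allI openin_punctured)
  fix m assume "openin (Euclidean_space 2) (Rn 2) \<and> (\<forall>m. Ck 2 (Rn 2) m h)"
  moreover have "Ck 2 punctured m h" if "Ck 2 (Rn 2) m h" for h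
    using that
  proof (induction m arbitrary: h)
    case 0 thus ?case using continuous_on_subset[of "Rn 2" h punctured] by (auto simp: punctured_def)
  next
    case (Suc m)
    have c: "continuous_on punctured h"
      using Ck_continuous[OF Suc.prems] continuous_on_subset[of "Rn 2" h punctured] by (auto simp: punctured_def)
    have "\<exists>d. has_partial punctured i h d \<and> Ck 2 punctured m d" if "i < 2" for i
    proof -
      have "\<exists>d. has_partial (Rn 2) i h d \<and> Ck 2 (Rn 2) m d" using Suc.prems that by simp
      then obtain d where "has_partial (Rn 2) i h d" "Ck 2 (Rn 2) m d" by blast
      thus ?thesis using Suc.IH by (intro exI[of _ d]) (auto simp: has_partial_def punctured_def)
    qed
    thus ?case using c by simp
  qed
  ultimately show "Ck 2 punctured m h" by blast
qed

lemma partial_psi: "i < 2 \<Longrightarrow> partial i psi = dpsi i"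
  using has_partial_imp_partial[OF has_partial_psi[of i UNIV]] by (auto simp: fun_eq_iff)

lemma smooth_Hp: "i < 2 \<Longrightarrow> smooth_on 2 punctured (Hp i)"
proof -
  assume i: "i < 2"
  have j: "1 - i < 2" by simp
  have "smooth_on 2 punctured (dpsi (1 - i))"
    using smooth_onD(4)[OF smooth_on_punctured[OF smooth_psi] j] by (simp add: partial_psi)
  hence "smooth_on 2 punctured (\<lambda>x. 4 * sq x * partial i up x + sgn2 i * dpsi (1 - i) x)"
    by (intro smooth_on_add smooth_on_mult smooth_on_const smooth_on_sq openin_punctured smooth_onD(4)[OF smooth_up i])
  thus ?thesis by (rule smooth_on_cong) (simp add: Hp_def partial_up[OF i])
qed

text \<open>The normal components agree by the flux condition. The tangential parts of 4 grad
  \<open>up\<close> and grad \<open>um\<close> differ by - 3 k f(1) Im (z^k). On the circle psi has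
  radial derivative 3 k f(1) Im (z^k), which explains its factor 3/2 k f(1): its rotated gradient
  cancels the difference.\<close>

lemma Hp_circle:
  assumes x: "x \<in> circle" and i: "i < 2" shows "partial i um x = Hp i x"
proof -
  have s: "sq x = 1" using x by (simp add: circle_def)
  have ss: "x 0 * x 0 + x 1 * x 1 = 1" using s by (simp add: sq_def power2_eq_square)
  let ?r = "rp (k - 1) x" and ?q = "ip (k - 1) x"
  have r: "?r = x 0 * rp k x + x 1 * ip k x"
  proof -
    have "x 0 * rp k x + x 1 * ip k x = (x 0 * x 0 + x 1 * x 1) * ?r"
      unfolding rp_ip_pred[OF k, of x] by (simp add: algebra_simps)
    thus ?thesis by (simp only: ss mult_1_left)
  qed
  have q: "?q = x 0 * ip k x - x 1 * rp k x"
  proof -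
    have "x 0 * ip k x - x 1 * rp k x = (x 0 * x 0 + x 1 * x 1) * ?q"
      unfolding rp_ip_pred[OF k, of x] by (simp add: algebra_simps)
    thus ?thesis by (simp only: ss mult_1_left)
  qed
  have fl: "8 * g' 1 - 2 * f' 1 = - 3 * k * f 1" using flux match by (simp add: algebra_simps)
  have "i = 0 \<or> i = 1" using i by auto
  thus ?thesis
  proof
    assume [simp]: "i = 0"
    have "Hp 0 x - partial 0 um x = x 0 * rp k x * (8 * g' 1 - 2 * f' 1) + 3 * k * f 1 * (?r - x 1 * ip k x)"
      by (simp add: Hp_def partial_um rgrad_def s dpsi_def sgn2_def drp_def dip_def match algebra_simps)
    also have "\<dots> = 0" unfolding fl r by (simp add: algebra_simps)
    finally show ?thesis by simp
  next
    assume [simp]: "i = 1"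
    have "Hp 1 x - partial 1 um x = x 1 * rp k x * (8 * g' 1 - 2 * f' 1) - 3 * k * f 1 * (?q - x 0 * ip k x)"
      by (simp add: Hp_def partial_um rgrad_def s dpsi_def sgn2_def drp_def dip_def match algebra_simps)
    also have "\<dots> = 0" unfolding fl q by (simp add: algebra_simps)
    finally show ?thesis by simp
  qed
qed

lemma partial_dpsi_commute: "partial 0 (dpsi 1) x = partial 1 (dpsi 0) x" if "x \<in> Rn 2"
  using smooth_on_partial_commute[OF smooth_psi _ _ that, of 0 1] by (simp add: partial_psi)

lemma divergence_minus: "x \<in> Rn 2 \<Longrightarrow> partial 0 (partial 0 um) x + partial 1 (partial 1 um) x = - (lam * um x)"
proof -
  have "partial i (partial i um) x = rhess f f' f'' k i x" if "i < 2" for i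
  proof -
    have "partial i um = rgrad f f' k i" using partial_um[OF that] by auto
    thus ?thesis using has_partial_imp_partial[OF has_partial_rhess[OF that, of UNIV f f' f'' k], of x] df df' by simp
  qed
  thus ?thesis using rhess_sum[OF k, of f f' f'' x] ode_f[of "sq x"] by (simp add: um_def)
qed

text \<open>The rotated gradient drops out by symmetry of second derivatives, leaving 4 s times the
  Laplacian plus 8 x . grad, which \<open>ode_g\<close> evaluates.\<close>

lemma divergence_plus: "x \<in> punctured \<Longrightarrow> partial 0 (Hp 0) x + partial 1 (Hp 1) x = - (lam * up x)"
proof -
  assume x: "x \<in> punctured"
  hence xR: "x \<in> Rn 2" and s: "sq x > 0" by (auto simp: punctured_def)
  have p: "partial i (Hp i) x = 8 * x i * rgrad g g' k i x + 4 * sq x * rhess g g' g'' k i x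
      + sgn2 i * partial i (dpsi (1 - i)) x" if i: "i < 2" for i
  proof -
    have a: "has_partial punctured i (\<lambda>x. 4 * sq x) (\<lambda>x. 8 * x i)"
      using has_partial_mult[OF has_partial_const[of punctured i 4] has_partial_sq[OF i]] by simp
    have b: "has_partial punctured i (rgrad g g' k i) (rhess g g' g'' k i)"
      by (rule has_partial_rhess[OF i dg dg']) (auto simp: punctured_def)
    have "smooth_on 2 (Rn 2) (dpsi (1 - i))"
      using smooth_onD(4)[OF smooth_psi, of "1 - i"] by (simp add: partial_psi)
    from smooth_onD(3)[OF smooth_on_punctured[OF this] i]
    have c: "has_partial punctured i (dpsi (1 - i)) (partial i (dpsi (1 - i)))" .
    show ?thesis
      using has_partial_imp_partial[OF has_partial_add[OF has_partial_mult[OF a b]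
          has_partial_mult[OF has_partial_const[of punctured i "sgn2 i"] c]] x]
      by (simp add: Hp_def[abs_def])
  qed
  have "partial 0 (Hp 0) x + partial 1 (Hp 1) x = 8 * (x 0 * rgrad g g' k 0 x + x 1 * rgrad g g' k 1 x)
    + 4 * sq x * (rhess g g' g'' k 0 x + rhess g g' g'' k 1 x)"
    using p[of 0] p[of 1] partial_dpsi_commute[OF xR] by (simp add: sgn2_def algebra_simps)
  also have "\<dots> = (4 * sq x * (4 * sq x * g'' (sq x) + 4 * (real k + 1) * g' (sq x))
      + 8 * (2 * sq x * g' (sq x) + k * g (sq x))) * rp k x"
    unfolding rhess_sum[OF k] rgrad_radial[OF k] by (simp add: algebra_simps)
  also have "\<dots> = - (lam * up x)" unfolding ode_g[OF s] by (simp add: up_def)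
  finally show ?thesis .
qed

text \<open>The flux c grad u has a tangential jump, so its components cannot be integrated by parts
  along axis-parallel lines. Subtracting the rotated gradient of psi, extended by 0 inside, leaves
  the continuous field \<open>GH\<close>, for which this works.\<close>

lemma minus_Delta_u:
  "minus_Delta_eq 2 (disk 4) (pw_coeff (disk 1) annulus (\<lambda>_. 1) (\<lambda>x. 4 * sq x)) u (\<lambda>x. lam * u x)"
proof -
  define c where "c = pw_coeff (disk 1) annulus (\<lambda>_. 1) (\<lambda>x. 4 * sq x)"
  define Gu where "Gu i = glue (partial i um) (partial i up)" for i
  define GH where "GH i = glue (partial i um) (Hp i)" for i
  define Gd where "Gd i = glue (partial i (partial i um)) (partial i (Hp i))" for i
  define P0 where "P0 i = glue (partial i (\<lambda>_. 0)) (partial i psi)" for i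
  have db: "disk 4 \<in> sets borel" by (rule disk_borel)
  have z: "smooth_on 2 (Rn 2) (\<lambda>_. 0)" by (rule smooth_on_const[OF openin_Rn2])
  note psiP = smooth_on_punctured[OF smooth_psi]
  have bGu: "bounded_meas (disk 4) (Gu i)" if "i < 2" for i
    unfolding Gu_def by (rule glue_bounded_meas[OF smooth_onD(4)[OF smooth_um that] smooth_onD(4)[OF smooth_up that]])
  have bGH: "bounded_meas (disk 4) (GH i)" if "i < 2" for i
    unfolding GH_def by (rule glue_bounded_meas[OF smooth_onD(4)[OF smooth_um that] smooth_Hp[OF that]])
  have bGd: "bounded_meas (disk 4) (Gd i)" if "i < 2" for i
    unfolding Gd_def
    by (rule glue_bounded_meas[OF smooth_onD(4)[OF smooth_onD(4)[OF smooth_um that] that] smooth_onD(4)[OF smooth_Hp[OF that] that]])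
  have bP0: "bounded_meas (disk 4) (P0 i)" if "i < 2" for i
    unfolding P0_def by (rule glue_bounded_meas[OF smooth_onD(4)[OF z that] smooth_onD(4)[OF psiP that]])
  have bc: "bounded_meas (disk 4) c"
  proof -
    have "bounded_meas (disk 4) sq" by (rule smooth_on_bounded_meas[OF smooth_on_sq[OF openin_Rn2] compactly_in_disk]) simp
    thus ?thesis unfolding c_def pw_coeff_def[abs_def]
      by (intro bounded_meas_add bounded_meas_mult bounded_meas_indicator bounded_meas_const db disk_borel openin_Rn_borel[OF openin_annulus])
  qed
  \<comment> \<open>On the circle itself \<open>pw_coeff\<close> is 0 and the identity can fail,
    hence the restriction to its complement, whose removal costs a null set.\<close>
  have cG: "c x * Gu i x = GH i x - sgn2 i * P0 (1 - i) x" if x: "x \<in> disk 4 - circle" and i: "i < 2" for x i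
  proof (cases "sq x < 1")
    case True
    hence "c x = 1" using x by (auto simp: c_def pw_coeff_def disk_def annulus_def indicator_def)
    moreover have "partial (1 - i) (\<lambda>_. 0) x = 0"
      using has_partial_imp_partial[OF has_partial_const[of UNIV "1 - i" 0]] by simp
    ultimately show ?thesis using True by (simp add: Gu_def GH_def P0_def glue_def)
  next
    case False
    hence s: "sq x > 1" "x \<in> punctured" using x by (auto simp: disk_def circle_def punctured_def)
    hence "c x = 4 * sq x" using x by (auto simp: c_def pw_coeff_def disk_def annulus_def indicator_def)
    thus ?thesis using s i by (simp add: Gu_def GH_def P0_def glue_def Hp_def partial_up partial_psi)
  qed
  have "has_weak_divergence 2 (disk 4) (\<lambda>i x. c x * Gu i x) (\<lambda>x. - (lam * u x))"
    unfolding has_weak_divergence_def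
  proof (intro allI impI)
    fix \<phi> assume t: "test_function 2 (disk 4) \<phi>"
    have bt: "bounded_meas (disk 4) h" if "test_function 2 (disk 4) h" for h
      by (rule test_function_bounded_meas[OF that db]) (auto simp: disk_def)
    note tp = test_function_partial[OF t]
    have si: "set_integrable (leb 2) (disk 4) h" if "bounded_meas (disk 4) h" for h
      by (rule set_integrable_bounded_meas[OF bounded_dom_disk4 that])
    \<comment> \<open>The derivative on psi is moved back to the test function, which is allowed
      because psi extended by 0 is continuous across the circle.\<close>
    have e: "(LINT x:disk 4|leb 2. c x * Gu i x * partial i \<phi> x) =
       - (LINT x:disk 4|leb 2. Gd i x * \<phi> x)
       + sgn2 i * (LINT x:disk 4|leb 2. glue (\<lambda>_. 0) psi x * partial (1 - i) (partial i \<phi>) x)" if i: "i < 2" for i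
    proof -
      have j: "1 - i < 2" by simp
      have b1: "bounded_meas (disk 4) (\<lambda>x. GH i x * partial i \<phi> x)"
        and b2: "bounded_meas (disk 4) (\<lambda>x. sgn2 i * (P0 (1 - i) x * partial i \<phi> x))"
        by (intro bounded_meas_mult bounded_meas_const db bGH bP0 bt tp i j)+
      have "(LINT x:disk 4|leb 2. c x * Gu i x * partial i \<phi> x)
        = (LINT x:disk 4|leb 2. GH i x * partial i \<phi> x - sgn2 i * (P0 (1 - i) x * partial i \<phi> x))"
      proof (rule set_integral_cong_null[OF _ _ circle_null])
        show "bounded_meas (disk 4) (\<lambda>x. c x * Gu i x * partial i \<phi> x)"
          by (intro bounded_meas_mult bc bGu bt tp i)
        show "bounded_meas (disk 4) (\<lambda>x. GH i x * partial i \<phi> x - sgn2 i * (P0 (1 - i) x * partial i \<phi> x))"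
          by (rule bounded_meas_diff[OF db b1 b2])
        show "c x * Gu i x * partial i \<phi> x = GH i x * partial i \<phi> x - sgn2 i * (P0 (1 - i) x * partial i \<phi> x)"
          if "x \<in> disk 4 - circle" for x
          unfolding cG[OF that i] by (simp add: algebra_simps)
      qed
      also have "\<dots> = (LINT x:disk 4|leb 2. GH i x * partial i \<phi> x)
        - sgn2 i * (LINT x:disk 4|leb 2. P0 (1 - i) x * partial i \<phi> x)"
        using set_integral_diff(2)[OF si[OF b1] si[OF b2]] by simp
      also have "(LINT x:disk 4|leb 2. GH i x * partial i \<phi> x) = - (LINT x:disk 4|leb 2. Gd i x * \<phi> x)"
        unfolding GH_def Gd_def
        by (rule glue_weak_derivative[OF smooth_onD(4)[OF smooth_um i] smooth_Hp[OF i] i Hp_circle[OF _ i] t])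
      also have "(LINT x:disk 4|leb 2. P0 (1 - i) x * partial i \<phi> x)
        = - (LINT x:disk 4|leb 2. glue (\<lambda>_. 0) psi x * partial (1 - i) (partial i \<phi>) x)"
        unfolding P0_def
        using glue_weak_derivative[OF z psiP j _ tp[OF i]] by (simp add: psi_def circle_def)
      finally show ?thesis by simp
    qed
    \<comment> \<open>The psi terms for i = 0 and i = 1 carry opposite signs \<open>sgn2\<close>, so
      they cancel by symmetry of the second derivatives of the test function.\<close>
    have "(LINT x:disk 4|leb 2. glue (\<lambda>_. 0) psi x * partial 1 (partial 0 \<phi>) x)
       = (LINT x:disk 4|leb 2. glue (\<lambda>_. 0) psi x * partial 0 (partial 1 \<phi>) x)"
    proof (rule set_integral_cong_on)
      fix x assume "x \<in> disk 4"
      thus "glue (\<lambda>_. 0) psi x * partial 1 (partial 0 \<phi>) x = glue (\<lambda>_. 0) psi x * partial 0 (partial 1 \<phi>) x"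
        using smooth_on_partial_commute[of 2 \<phi> 1 0 x] t by (simp add: test_function_def disk_def)
    qed
    hence "(\<Sum>i<2. LINT x:disk 4|leb 2. c x * Gu i x * partial i \<phi> x)
       = - ((LINT x:disk 4|leb 2. Gd 0 x * \<phi> x) + (LINT x:disk 4|leb 2. Gd 1 x * \<phi> x))"
      using e[of 0] e[of 1] by (simp add: numeral_2_eq_2 sgn2_def)
    also have "(LINT x:disk 4|leb 2. Gd 0 x * \<phi> x) + (LINT x:disk 4|leb 2. Gd 1 x * \<phi> x)
       = (LINT x:disk 4|leb 2. Gd 0 x * \<phi> x + Gd 1 x * \<phi> x)"
      by (rule set_integral_add(2)[symmetric]) (intro si bounded_meas_mult bGd bt t, simp)+
    also have "\<dots> = (LINT x:disk 4|leb 2. - (lam * u x) * \<phi> x)"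
    proof (rule set_integral_cong_on)
      fix x assume x: "x \<in> disk 4"
      have "Gd 0 x + Gd 1 x = - (lam * u x)"
      proof (cases "sq x \<le> 1")
        case True
        thus ?thesis using divergence_minus[of x] x by (simp add: Gd_def glue_def u_def disk_def)
      next
        case False
        hence "x \<in> punctured" using x by (simp add: disk_def punctured_def)
        thus ?thesis using divergence_plus[of x] False by (simp add: Gd_def glue_def u_def)
      qed
      thus "Gd 0 x * \<phi> x + Gd 1 x * \<phi> x = - (lam * u x) * \<phi> x" by (metis distrib_right)
    qed
    finally show "(\<Sum>i<2. LINT x:disk 4|leb 2. c x * Gu i x * partial i \<phi> x)
       = - (LINT x:disk 4|leb 2. - (lam * u x) * \<phi> x)" .
  qed
  moreover have "has_weak_gradient 2 (disk 4) u Gu" unfolding Gu_def by (rule weak_gradient_u)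
  moreover have "L2_on 2 (disk 4) (\<lambda>x. lam * u x)"
    by (rule L2_on_bounded_meas[OF bounded_dom_disk4 bounded_meas_mult[OF bounded_meas_const[OF db] bounded_meas_u]])
  ultimately show ?thesis unfolding minus_Delta_eq_def c_def using H1_u by blast
qed

end

section \<open>Exponential decay\<close>

text \<open>The set contains the trace on \<open>Rn n\<close> of an open box around x, whose sides
  have positive length. It serves to show that a mode does not vanish almost everywhere.\<close>

lemma emeasure_leb_open_pos:
  assumes W: "openin (Euclidean_space n) W" and x: "x \<in> W"
  shows "emeasure (leb n) W \<noteq> 0"
proof -
  obtain T where T: "open T" "W = Rn n \<inter> T" using W unfolding openin_Rn_iff by blast
  have "openin (product_topology (\<lambda>_. euclidean) UNIV) T" using T(1) by (simp add: open_fun_def)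
  from product_topology_open_contains_basis[OF this, of x] x T(2)
  obtain X where X: "x \<in> (\<Pi>\<^sub>E i\<in>UNIV. X i)" "\<And>i. open (X i)" "(\<Pi>\<^sub>E i\<in>UNIV. X i) \<subseteq> T" by auto
  have xn: "x i = 0" if "i \<ge> n" for i using x T(2) that by (auto simp: Rn_iff)
  have xX: "x i \<in> X i" for i using X(1) by (auto simp: PiE_def)
  have pos: "emeasure lborel (X i) \<noteq> 0" for i
  proof -
    obtain e where e: "e > 0" "ball (x i) e \<subseteq> X i" using X(2) xX open_contains_ball by blast
    have "emeasure lborel (ball (x i) e) \<le> emeasure lborel (X i)"
      using e X(2) by (intro emeasure_mono) auto
    moreover have "emeasure lborel (ball (x i) e) \<noteq> 0"
      using e(1) by (simp add: ball_eq_greaterThanLessThan)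
    ultimately show ?thesis by auto
  qed
  have sub: "(\<Pi>\<^sub>E i\<in>{..<n}. X i) \<subseteq> ext0 n -` W \<inter> space (lebP {..<n})"
  proof
    fix y assume y: "y \<in> (\<Pi>\<^sub>E i\<in>{..<n}. X i)"
    have "ext0 n y i \<in> X i" for i
      using y xX[of i] xn[of i] by (cases "i < n") (auto simp: ext0_def PiE_def)
    hence "ext0 n y \<in> T" using X(3) by (auto simp: PiE_def)
    thus "y \<in> ext0 n -` W \<inter> space (lebP {..<n})"
      using T(2) ext0_in_Rn y by (auto simp: space_PiM PiE_def)
  qed
  have Wb: "W \<in> sets borel" by (rule openin_Rn_borel[OF W])
  have "emeasure (lebP {..<n}) (\<Pi>\<^sub>E i\<in>{..<n}. X i) = (\<Prod>i<n. emeasure lborel (X i))"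
    using X(2) by (intro lebP.emeasure_PiM) auto
  hence "emeasure (lebP {..<n}) (\<Pi>\<^sub>E i\<in>{..<n}. X i) \<noteq> 0" using pos by simp
  moreover have "emeasure (lebP {..<n}) (\<Pi>\<^sub>E i\<in>{..<n}. X i) \<le> emeasure (lebP {..<n}) (ext0 n -` W \<inter> space (lebP {..<n}))"
    by (rule emeasure_mono[OF sub measurable_sets[OF ext0_measurable Wb]])
  moreover have "emeasure (leb n) W = emeasure (lebP {..<n}) (ext0 n -` W \<inter> space (lebP {..<n}))"
    unfolding leb_eq using Wb by (simp add: emeasure_distr)
  ultimately show ?thesis by auto
qed

lemma bounded_dom_cdisk4: "bounded_dom 2 (cdisk 4)"
  using bounded_domI[OF _ compact_cdisk4, of "cdisk 4" 2] compact_imp_closed[OF compact_cdisk4]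
  by (auto simp: cdisk_def)

text \<open>The pointwise bound along the dilation is squared and integrated; the substitution in
  dimension 2 divides by c^2, whence the factor (q/c)^2.\<close>

lemma set_integral_square_scale:
  assumes v: "bounded_meas (cdisk 4) v" and A: "A \<in> sets borel" "A \<subseteq> cdisk 4" and c: "c > 0" and q: "q \<ge> 0"
    and le: "\<And>x. x \<in> A \<Longrightarrow> (\<lambda>i. c * x i) \<in> cdisk 4 \<and> \<bar>v x\<bar> \<le> q * \<bar>v (\<lambda>i. c * x i)\<bar>"
  shows "(LINT x:A|leb 2. (v x)\<^sup>2) \<le> (q / c)\<^sup>2 * (LINT x:cdisk 4|leb 2. (v x)\<^sup>2)"
proof -
  define w where "w x = indicator (cdisk 4) x * (v x)\<^sup>2" for x
  have b2: "bounded_meas (cdisk 4) (\<lambda>x. (v x)\<^sup>2)"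
    unfolding power2_eq_square by (rule bounded_meas_mult[OF v v])
  have wm: "w \<in> borel_measurable borel" unfolding w_def[abs_def] by (rule bounded_measD[OF b2])
  have wi: "integrable (leb 2) w"
    using set_integrable_bounded_meas[OF bounded_dom_cdisk4 b2] by (simp add: set_integrable_def w_def[abs_def])
  have w0: "0 \<le> w x" for x by (simp add: w_def)
  define J where "J = (\<integral>x. w x \<partial>leb 2)"
  have J: "J = (LINT x:cdisk 4|leb 2. (v x)\<^sup>2)" by (simp add: J_def w_def set_lebesgue_integral_def)
  have J0: "0 \<le> J" unfolding J_def using w0 by (simp add: integral_nonneg_AE)
  have nJ: "(\<integral>\<^sup>+x. ennreal (w x) \<partial>leb 2) = ennreal J"
    unfolding J_def by (rule nn_integral_eq_integral[OF wi]) (simp add: w0)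
  have ewm: "(\<lambda>x. ennreal (w x)) \<in> borel_measurable borel" using wm by simp
  have sm: "(\<lambda>x :: pt. (\<lambda>i. c * x i)) \<in> borel \<rightarrow>\<^sub>M borel"
    by (rule measurable_coordinatewise_then_product) measurable
  have sw: "(\<lambda>x. ennreal (w (\<lambda>i. c * x i))) \<in> borel_measurable (leb 2)"
    by (rule measurable_leb[OF measurable_compose[OF sm ewm]])
  have "ennreal J = ennreal (c\<^sup>2) * (\<integral>\<^sup>+x. ennreal (w (\<lambda>i. c * x i)) \<partial>leb 2)"
    using nn_integral_leb_scale[OF ewm c, of 2] nJ by simp
  hence "ennreal (1 / c\<^sup>2) * ennreal J = ennreal (1 / c\<^sup>2) * ennreal (c\<^sup>2) * (\<integral>\<^sup>+x. ennreal (w (\<lambda>i. c * x i)) \<partial>leb 2)"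
    by (simp add: mult.assoc)
  also have "ennreal (1 / c\<^sup>2) * ennreal (c\<^sup>2) = 1"
    using c by (simp flip: ennreal_mult add: ennreal_1[symmetric] del: ennreal_1)
  finally have Z: "(\<integral>\<^sup>+x. ennreal (w (\<lambda>i. c * x i)) \<partial>leb 2) = ennreal (J / c\<^sup>2)"
    using J0 by (simp flip: ennreal_mult)
  have bA: "bounded_meas A (\<lambda>x. (v x)\<^sup>2)" by (rule bounded_meas_subset[OF b2 A(2,1)])
  have dA: "bounded_dom 2 A"
  proof -
    obtain b where "\<forall>x\<in>cdisk 4. \<forall>i<2. \<bar>x i\<bar> \<le> b" using bounded_dom_cdisk4 by (auto simp: bounded_dom_def)
    hence "\<forall>x\<in>A. \<forall>i<2. \<bar>x i\<bar> \<le> b" using A(2) by blast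
    moreover have "A \<subseteq> Rn 2" using A(2) by (auto simp: cdisk_def)
    ultimately show ?thesis using A(1) unfolding bounded_dom_def by blast
  qed
  have iA: "integrable (leb 2) (\<lambda>x. indicator A x * (v x)\<^sup>2)"
    using set_integrable_bounded_meas[OF dA bA] by (simp add: set_integrable_def)
  have "ennreal (\<integral>x. indicator A x * (v x)\<^sup>2 \<partial>leb 2) = (\<integral>\<^sup>+x. ennreal (indicator A x * (v x)\<^sup>2) \<partial>leb 2)"
    by (rule nn_integral_eq_integral[OF iA, symmetric]) simp
  also have "\<dots> \<le> (\<integral>\<^sup>+x. ennreal (q\<^sup>2) * ennreal (w (\<lambda>i. c * x i)) \<partial>leb 2)"
  proof (rule nn_integral_mono)
    fix x
    show "ennreal (indicator A x * (v x)\<^sup>2) \<le> ennreal (q\<^sup>2) * ennreal (w (\<lambda>i. c * x i))"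
    proof (cases "x \<in> A")
      case True
      have "(v x)\<^sup>2 \<le> (q * \<bar>v (\<lambda>i. c * x i)\<bar>)\<^sup>2" using le[OF True] by (metis abs_ge_zero power2_abs power_mono)
      also have "\<dots> = q\<^sup>2 * w (\<lambda>i. c * x i)" using le[OF True] by (simp add: w_def power_mult_distrib)
      finally show ?thesis using True w0 by (simp flip: ennreal_mult add: ennreal_leI)
    qed simp
  qed
  also have "\<dots> = ennreal (q\<^sup>2) * ennreal (J / c\<^sup>2)"
    unfolding Z[symmetric] by (rule nn_integral_cmult[OF sw])
  also have "\<dots> = ennreal ((q / c)\<^sup>2 * J)"
    using J0 by (simp flip: ennreal_mult add: power_divide)
  finally have "(\<integral>x. indicator A x * (v x)\<^sup>2 \<partial>leb 2) \<le> (q / c)\<^sup>2 * J"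
    using J0 by (simp add: ennreal_le_iff)
  thus ?thesis unfolding J by (simp add: set_lebesgue_integral_def)
qed

text \<open>The radius is at most exp (-2 \<theta>), so that after dilation by exp \<theta> it is
  still at most exp (-\<theta>) and the point stays clear of the oscillating zone. In
  \<open>outer_part\<close> radii are at least exp \<theta>, and contraction by exp (-\<theta>) at
  most reaches the circle, as the outer profile decays up to it.\<close>

definition inner_part :: "real \<Rightarrow> pt set" where
  "inner_part \<theta> = {x \<in> Rn 2. sq x \<in> {..exp (- 4 * \<theta>)}}"

definition outer_part :: "real \<Rightarrow> pt set" where
  "outer_part \<theta> = {x \<in> Rn 2. sq x \<in> {exp (2 * \<theta>)..4}}"

lemma L2_norm_le_inner_outer:
  assumes v: "bounded_meas (cdisk 4) v" and n1: "L2_norm 2 (cdisk 4) v = 1" and \<theta>: "\<theta> \<ge> 0"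
    and \<omega>: "\<omega> \<in> sets (leb 2)" "\<omega> \<subseteq> inner_part \<theta> \<union> outer_part \<theta>" and q: "q1 \<ge> 0" "q2 \<ge> 0"
    and i: "\<And>x. x \<in> inner_part \<theta> \<Longrightarrow> \<bar>v x\<bar> \<le> q1 * \<bar>v (\<lambda>i. exp \<theta> * x i)\<bar>"
    and o: "\<And>x. x \<in> outer_part \<theta> \<Longrightarrow> \<bar>v x\<bar> \<le> q2 * \<bar>v (\<lambda>i. exp (- \<theta>) * x i)\<bar>"
  shows "L2_norm 2 \<omega> v \<le> q1 + exp \<theta> * q2"
proof -
  let ?A = "inner_part \<theta>" and ?B = "outer_part \<theta>"
  have J: "(LINT x:cdisk 4|leb 2. (v x)\<^sup>2) = 1" using n1 by (simp add: L2_norm_def)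
  have e1: "exp (- 4 * \<theta>) \<le> 1" using \<theta> by simp
  have A: "?A \<in> sets borel" "?A \<subseteq> cdisk 4"
  proof -
    show "?A \<in> sets borel" unfolding inner_part_def
      by (rule borel_closed[OF closed_sq]) simp
    show "?A \<subseteq> cdisk 4"
    proof
      fix x assume "x \<in> ?A"
      hence x: "x \<in> Rn 2" "sq x \<le> exp (- 4 * \<theta>)" unfolding inner_part_def by blast+
      hence "sq x \<le> 4" using e1 by linarith
      with x(1) show "x \<in> cdisk 4" unfolding cdisk_def by blast
    qed
  qed
  have B: "?B \<in> sets borel" "?B \<subseteq> cdisk 4"
    using closed_sq[of "{exp (2 * \<theta>)..4}"] by (auto simp: outer_part_def cdisk_def)
  have IA: "(LINT x:?A|leb 2. (v x)\<^sup>2) \<le> q1\<^sup>2"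
  proof -
    have "(\<lambda>i. exp \<theta> * x i) \<in> cdisk 4" if "x \<in> ?A" for x
    proof -
      have "(exp \<theta>)\<^sup>2 * sq x \<le> (exp \<theta>)\<^sup>2 * exp (- 4 * \<theta>)"
        using that by (intro mult_left_mono) (auto simp: inner_part_def)
      also have "\<dots> = exp (- 2 * \<theta>)" by (simp add: power2_eq_square flip: exp_add)
      also have "\<dots> \<le> 1" using \<theta> by simp
      finally show ?thesis using that by (auto simp: cdisk_def sq_scale inner_part_def Rn_iff)
    qed
    from set_integral_square_scale[OF v A _ q(1), of "exp \<theta>"] this i
    have "(LINT x:?A|leb 2. (v x)\<^sup>2) \<le> (q1 / exp \<theta>)\<^sup>2 * 1" unfolding J by simp
    also have "(q1 / exp \<theta>)\<^sup>2 \<le> q1\<^sup>2"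
    proof (rule power_mono)
      have "q1 * 1 \<le> q1 * exp \<theta>" using q(1) \<theta> by (intro mult_left_mono) auto
      thus "q1 / exp \<theta> \<le> q1" by (simp add: divide_le_eq)
    qed (use q(1) in simp)
    finally show ?thesis by simp
  qed
  have IB: "(LINT x:?B|leb 2. (v x)\<^sup>2) \<le> (exp \<theta> * q2)\<^sup>2"
  proof -
    have "(\<lambda>i. exp (- \<theta>) * x i) \<in> cdisk 4" if "x \<in> ?B" for x
    proof -
      have "(exp (- \<theta>))\<^sup>2 * sq x \<le> 1 * 4"
        using that \<theta> by (intro mult_mono) (auto simp: outer_part_def power_le_one sq_nonneg)
      thus ?thesis using that by (auto simp: cdisk_def sq_scale outer_part_def Rn_iff)
    qed
    from set_integral_square_scale[OF v B _ q(2), of "exp (- \<theta>)"] this o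
    have "(LINT x:?B|leb 2. (v x)\<^sup>2) \<le> (q2 / exp (- \<theta>))\<^sup>2 * 1" unfolding J by simp
    thus ?thesis by (simp add: exp_minus divide_inverse mult.commute)
  qed
  have b2: "bounded_meas (cdisk 4) (\<lambda>x. (v x)\<^sup>2)"
    unfolding power2_eq_square by (rule bounded_meas_mult[OF v v])
  have si: "set_integrable (leb 2) (cdisk 4) (\<lambda>x. (v x)\<^sup>2)"
    by (rule set_integrable_bounded_meas[OF bounded_dom_cdisk4 b2])
  have s\<omega>: "set_integrable (leb 2) \<omega> (\<lambda>x. (v x)\<^sup>2)"
    by (rule set_integrable_subset[OF si \<omega>(1)]) (use \<omega>(2) A B in blast)
  have sA: "set_integrable (leb 2) ?A (\<lambda>x. (v x)\<^sup>2)" and sB: "set_integrable (leb 2) ?B (\<lambda>x. (v x)\<^sup>2)"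
    using set_integrable_subset[OF si sets_leb[OF A(1)] A(2)] set_integrable_subset[OF si sets_leb[OF B(1)] B(2)] by auto
  have "(LINT x:\<omega>|leb 2. (v x)\<^sup>2) \<le> (\<integral>x. indicator ?A x *\<^sub>R (v x)\<^sup>2 + indicator ?B x *\<^sub>R (v x)\<^sup>2 \<partial>leb 2)"
    unfolding set_lebesgue_integral_def
  proof (rule integral_mono)
    show "integrable (leb 2) (\<lambda>x. indicator \<omega> x *\<^sub>R (v x)\<^sup>2)" using s\<omega> by (simp add: set_integrable_def)
    show "integrable (leb 2) (\<lambda>x. indicator ?A x *\<^sub>R (v x)\<^sup>2 + indicator ?B x *\<^sub>R (v x)\<^sup>2)"
      using sA sB by (intro Bochner_Integration.integrable_add) (simp_all add: set_integrable_def)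
    show "indicator \<omega> x *\<^sub>R (v x)\<^sup>2 \<le> indicator ?A x *\<^sub>R (v x)\<^sup>2 + indicator ?B x *\<^sub>R (v x)\<^sup>2" for x
      using \<omega>(2) by (auto simp: indicator_def)
  qed
  also have "\<dots> = (LINT x:?A|leb 2. (v x)\<^sup>2) + (LINT x:?B|leb 2. (v x)\<^sup>2)"
    unfolding set_lebesgue_integral_def
    using sA sB by (intro Bochner_Integration.integral_add) (simp_all add: set_integrable_def)
  also have "\<dots> \<le> q1\<^sup>2 + (exp \<theta> * q2)\<^sup>2" using IA IB by simp
  finally have "L2_norm 2 \<omega> v \<le> sqrt (q1\<^sup>2 + (exp \<theta> * q2)\<^sup>2)" unfolding L2_norm_def by simp
  also have "\<dots> \<le> q1 + exp \<theta> * q2" using q by (intro sqrt_sum_squares_le_sum) auto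
  finally show ?thesis .
qed

lemma L2_norm_subset_le:
  assumes v: "bounded_meas (cdisk 4) v" and \<omega>: "\<omega> \<in> sets (leb 2)" "\<omega> \<subseteq> cdisk 4"
  shows "L2_norm 2 \<omega> v \<le> L2_norm 2 (cdisk 4) v"
proof -
  have si: "set_integrable (leb 2) (cdisk 4) (\<lambda>x. (v x)\<^sup>2)"
    unfolding power2_eq_square
    by (rule set_integrable_bounded_meas[OF bounded_dom_cdisk4 bounded_meas_mult[OF v v]])
  have "(LINT x:\<omega>|leb 2. (v x)\<^sup>2) \<le> (LINT x:cdisk 4|leb 2. (v x)\<^sup>2)"
    unfolding set_lebesgue_integral_def
  proof (rule integral_mono)
    show "integrable (leb 2) (\<lambda>x. indicator \<omega> x *\<^sub>R (v x)\<^sup>2)"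
      using set_integrable_subset[OF si \<omega>] by (simp add: set_integrable_def)
    show "indicator \<omega> x *\<^sub>R (v x)\<^sup>2 \<le> indicator (cdisk 4) x *\<^sub>R (v x)\<^sup>2" for x
      using \<omega>(2) by (auto simp: indicator_def)
  qed (use si in \<open>simp add: set_integrable_def\<close>)
  thus ?thesis by (simp add: L2_norm_def)
qed

lemma (in trapped_mode) bounded_meas_cdisk_u: "bounded_meas (cdisk 4) u"
proof -
  have z: "u x = 0" if "x \<in> cdisk 4" "x \<notin> disk 4" for x
  proof -
    have "sq x = 4" using that by (auto simp: cdisk_def disk_def)
    thus ?thesis by (simp add: u_eq dirichlet)
  qed
  have e: "(\<lambda>x. indicator (disk 4) x * u x) = (\<lambda>x. indicator (cdisk 4) x * u x)"
    using z by (auto simp: indicator_def fun_eq_iff disk_def cdisk_def)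
  obtain C where C: "\<forall>x\<in>disk 4. \<bar>u x\<bar> \<le> C" using bounded_meas_u by (auto simp: bounded_meas_def)
  have "\<bar>u x\<bar> \<le> \<bar>C\<bar>" if "x \<in> cdisk 4" for x
    using C z[OF that] by (cases "x \<in> disk 4") force+
  thus ?thesis using bounded_measD[OF bounded_meas_u] unfolding e bounded_meas_def by blast
qed

section \<open>Normalised Bessel modes and their pointwise decay\<close>

text \<open>Continuity at r = 1 fixes the amplitude \<alpha> of the outer profile, and the matching
  condition is then the flux condition. The factor N is left free for the normalisation.\<close>

lemma trapped_mode_bessel:
  fixes k :: nat and lam \<kappa> N :: real
  assumes k: "k \<ge> 1" and lam: "lam \<le> 3 / 2 * real (k\<^sup>2)" and \<kappa>: "\<kappa> = sqrt (k\<^sup>2 + 1 - lam / 4)"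
    and m: "sinh (\<kappa> * ln 2) * (k * bes k (lam / 4) + lam / 2 * bes' k (lam / 4)) =
      - 4 * (sinh (\<kappa> * ln 2) + \<kappa> * cosh (\<kappa> * ln 2)) * bes k (lam / 4)"
    and \<alpha>: "\<alpha> = bes k (lam / 4) / sinh (\<kappa> * ln 2)"
  shows "trapped_mode k lam (\<lambda>s. N * bes k (lam / 4 * s)) (\<lambda>s. N * (bes' k (lam / 4 * s) * (lam / 4)))
    (\<lambda>s. N * ((bes (Suc (Suc k)) (lam / 4 * s) / (real (Suc k) * real (Suc (Suc k)))) * (lam / 4) * (lam / 4)))
    (\<lambda>s. N * \<alpha> * shp \<kappa> k s) (\<lambda>s. N * \<alpha> * shp' \<kappa> k s) (\<lambda>s. N * \<alpha> * shp'' \<kappa> k s)"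
proof -
  have "0 \<le> real (k\<^sup>2)" by simp
  hence kp: "0 < real (k\<^sup>2) + 1 - lam / 4" using lam by linarith
  hence \<kappa>2: "\<kappa>\<^sup>2 = real (k\<^sup>2) + 1 - lam / 4" and \<kappa>0: "\<kappa> > 0" unfolding \<kappa> by simp_all
  define S where "S = sinh (\<kappa> * ln 2)"
  have S: "S > 0" using \<kappa>0 by (simp add: S_def)
  have l: "((\<lambda>s. lam / 4 * s) has_real_derivative lam / 4) (at s)" for s
    using DERIV_cmult[OF DERIV_ident, of "lam / 4" s] by simp
  have \<alpha>S: "\<alpha> * S = bes k (lam / 4)" using S unfolding \<alpha> S_def[symmetric] by simp
  show ?thesis
  proof
    show "k \<ge> 1" by (rule k)
    show "smoothR UNIV (\<lambda>s. N * bes k (lam / 4 * s))"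
      by (rule smoothR_mult[OF smoothR_const smoothR_comp[OF smoothR_bes[of UNIV] smoothR_mult[OF smoothR_const smoothR_id]]]) simp
    show "smoothR {0<..} (\<lambda>s. N * \<alpha> * shp \<kappa> k s)" by (rule smoothR_mult[OF smoothR_const smoothR_shp])
    show "((\<lambda>s. N * bes k (lam / 4 * s)) has_real_derivative N * (bes' k (lam / 4 * s) * (lam / 4))) (at s)" for s
      by (rule DERIV_cmult[OF DERIV_chain2[OF bes_has_derivative l]])
    show "((\<lambda>s. N * (bes' k (lam / 4 * s) * (lam / 4))) has_real_derivative
      N * ((bes (Suc (Suc k)) (lam / 4 * s) / (real (Suc k) * real (Suc (Suc k)))) * (lam / 4) * (lam / 4))) (at s)" for s
      by (rule DERIV_cmult[OF DERIV_cmult_right[OF DERIV_chain2[OF bes'_has_derivative l]]])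
    show "((\<lambda>s. N * \<alpha> * shp \<kappa> k s) has_real_derivative N * \<alpha> * shp' \<kappa> k s) (at s)" if "s > 0" for s
      by (rule DERIV_cmult[OF shp_has_derivative[OF that]])
    show "((\<lambda>s. N * \<alpha> * shp' \<kappa> k s) has_real_derivative N * \<alpha> * shp'' \<kappa> k s) (at s)" if "s > 0" for s
      by (rule DERIV_cmult[OF shp'_has_derivative[OF that]])
    show "N * bes k (lam / 4 * 1) = N * \<alpha> * shp \<kappa> k 1"
      using \<alpha>S by (simp add: shp_1 S_def)
    show "N * \<alpha> * shp \<kappa> k 4 = 0" by (simp add: shp_4)
    show "2 * (N * (bes' k (lam / 4 * 1) * (lam / 4))) + real k * (N * bes k (lam / 4 * 1)) =
      4 * (2 * (N * \<alpha> * shp' \<kappa> k 1) + real k * (N * \<alpha> * shp \<kappa> k 1))"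
    proof -
      define c where "c = cosh (\<kappa> * ln 2)"
      have "S * (k * bes k (lam / 4) + lam / 2 * bes' k (lam / 4)) = S * (- 4 * \<alpha> * (S + \<kappa> * c))"
        using m unfolding S_def[symmetric] c_def[symmetric] \<alpha>S[symmetric] by (simp add: algebra_simps)
      hence "k * bes k (lam / 4) + lam / 2 * bes' k (lam / 4) = - 4 * \<alpha> * (S + \<kappa> * c)"
        using S by (simp only: mult_cancel_left) auto
      hence eq: "N * (k * bes k (lam / 4) + lam / 2 * bes' k (lam / 4)) = N * (- 4 * \<alpha> * (S + \<kappa> * c))" by simp
      have h: "2 * shp' \<kappa> k 1 = - ((real k + 1) * S + \<kappa> * c)" by (simp add: shp'_def shp_1 S_def c_def)
      have "4 * (2 * (N * \<alpha> * shp' \<kappa> k 1) + real k * (N * \<alpha> * shp \<kappa> k 1)) = 4 * N * \<alpha> * (2 * shp' \<kappa> k 1 + real k * S)"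
        by (simp add: shp_1 S_def[symmetric] algebra_simps)
      also have "\<dots> = N * (- 4 * \<alpha> * (S + \<kappa> * c))" unfolding h by (simp add: algebra_simps)
      also have "\<dots> = 2 * (N * (bes' k (lam / 4 * 1) * (lam / 4))) + real k * (N * bes k (lam / 4 * 1))"
        unfolding eq[symmetric] by (simp add: algebra_simps)
      finally show ?thesis by simp
    qed
    fix s :: real
    let ?y = "lam / 4 * s" and ?b2 = "bes (Suc (Suc k)) (lam / 4 * s) / (real (Suc k) * real (Suc (Suc k)))"
    have "4 * s * (N * (?b2 * (lam / 4) * (lam / 4))) + 4 * (real k + 1) * (N * (bes' k ?y * (lam / 4)))
       = N * lam * (?y * ?b2 + (real k + 1) * bes' k ?y)"
      by (simp only: algebra_simps) simp
    also have "?y * ?b2 + (real k + 1) * bes' k ?y = - bes k ?y" using bes_ode[of ?y k] by linarith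
    finally show "4 * s * (N * (?b2 * (lam / 4) * (lam / 4))) + 4 * (real k + 1) * (N * (bes' k ?y * (lam / 4)))
      = - (lam * (N * bes k ?y))" by simp
    assume s: "s > 0"
    have "4 * s * (4 * s * (N * \<alpha> * shp'' \<kappa> k s) + 4 * (real k + 1) * (N * \<alpha> * shp' \<kappa> k s)) +
         8 * (2 * s * (N * \<alpha> * shp' \<kappa> k s) + real k * (N * \<alpha> * shp \<kappa> k s))
       = N * \<alpha> * (4 * s * (4 * s * shp'' \<kappa> k s + 4 * (real k + 1) * shp' \<kappa> k s)
          + 8 * (2 * s * shp' \<kappa> k s + real k * shp \<kappa> k s))"
      by (simp only: algebra_simps)
    also have "\<dots> = - (lam * (N * \<alpha> * shp \<kappa> k s))" unfolding shp_ode[OF s \<kappa>2] by simp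
    finally show "4 * s * (4 * s * (N * \<alpha> * shp'' \<kappa> k s) + 4 * (real k + 1) * (N * \<alpha> * shp' \<kappa> k s)) +
         8 * (2 * s * (N * \<alpha> * shp' \<kappa> k s) + real k * (N * \<alpha> * shp \<kappa> k s)) = - (lam * (N * \<alpha> * shp \<kappa> k s))" .
  qed
qed

lemma normalized_mode_exists:
  fixes k :: nat
  assumes k: "k \<ge> 256"
  shows "\<exists>lam v. real (k\<^sup>2) < lam \<and> lam \<le> 3 / 2 * real (k\<^sup>2) \<and>
    (\<forall>\<epsilon>::real. 0 < \<epsilon> \<and> \<epsilon> \<le> 1/2 \<and> 8 * pi \<le> k * \<epsilon> * sqrt \<epsilon> \<longrightarrow> lam \<le> k\<^sup>2 * (1 + \<epsilon>)) \<and>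
    v \<in> operator_domain 2 (cdisk 4) circle (disk 1) annulus (\<lambda>x. x) (\<lambda>_. 1) (\<lambda>x. 4 * sq x) \<and>
    continuity_condition 2 circle (disk 1) annulus v \<and>
    flux_condition 2 circle (disk 1) annulus (\<lambda>x. x) (\<lambda>_. 1) (\<lambda>x. 4 * sq x) v \<and>
    minus_Delta_eq 2 (disk 4) (pw_coeff (disk 1) annulus (\<lambda>_. 1) (\<lambda>x. 4 * sq x)) v (\<lambda>x. lam * v x) \<and>
    bounded_meas (cdisk 4) v \<and> L2_norm 2 (cdisk 4) v = 1 \<and>
    (\<forall>\<theta>>0. \<forall>\<kappa>\<ge>0. lam * exp (- 2 * \<theta>) \<le> real (k\<^sup>2) - \<kappa>\<^sup>2 \<longrightarrow>
       (\<forall>x\<in>inner_part \<theta>. \<bar>v x\<bar> \<le> exp (- \<kappa> * \<theta>) * \<bar>v (\<lambda>i. exp \<theta> * x i)\<bar>)) \<and>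
    (\<forall>\<theta>>0. \<forall>x\<in>outer_part \<theta>. \<bar>v x\<bar> \<le> exp (- real k * \<theta> / 2) * \<bar>v (\<lambda>i. exp (- \<theta>) * x i)\<bar>)"
proof -
  have k1: "k \<ge> 1" using k by simp
  \<comment> \<open>Origin of 256: it is 16 * 2 times this crude bound 8.\<close>
  have "sqrt 2 * pi \<le> 2 * 4" using sqrt2_less_2 pi_less_4 pi_gt_zero by (intro mult_mono) auto
  hence k2: "16 * sqrt 2 * pi * 2 \<le> k" using k by linarith
  obtain lam :: real where lam: "real (k\<^sup>2) < lam" "lam \<le> 3 / 2 * k\<^sup>2"
    "\<And>y. 0 \<le> y \<Longrightarrow> y < lam / 4 \<Longrightarrow> bes k y > 0" "bes k (lam / 4) \<ge> 0"
    "\<And>\<epsilon> :: real. 0 < \<epsilon> \<Longrightarrow> \<epsilon> \<le> 1/2 \<Longrightarrow> 8 * pi \<le> k * \<epsilon> * sqrt \<epsilon> \<Longrightarrow> lam \<le> k\<^sup>2 * (1 + \<epsilon>)"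
    "\<And>\<kappa>. \<kappa> = sqrt (k\<^sup>2 + 1 - lam / 4) \<Longrightarrow>
      sinh (\<kappa> * ln 2) * (k * bes k (lam / 4) + lam / 2 * bes' k (lam / 4)) =
      - 4 * (sinh (\<kappa> * ln 2) + \<kappa> * cosh (\<kappa> * ln 2)) * bes k (lam / 4)"
  proof (rule eigenvalue_exists[OF k1 k2], goal_cases)
    case (1 lam)
    show ?case by (rule 1(1)[OF 1(2-7)])
  qed
  define \<kappa>0 where "\<kappa>0 = sqrt (k\<^sup>2 + 1 - lam / 4)"
  define \<alpha> where "\<alpha> = bes k (lam / 4) / sinh (\<kappa>0 * ln 2)"
  define f where "f N s = N * bes k (lam / 4 * s)" for N s
  define g where "g N s = N * \<alpha> * shp \<kappa>0 k s" for N s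
  have T: "\<exists>f' f'' g' g''. trapped_mode k lam (f N) f' f'' (g N) g' g''" for N
    using trapped_mode_bessel[OF k1 lam(2) \<kappa>0_def lam(6)[OF \<kappa>0_def] \<alpha>_def, of N] unfolding f_def g_def by blast
  define U where "U N x = (if sq x \<le> 1 then f N (sq x) else g N (sq x)) * rp k x" for N x
  have all: "U N \<in> operator_domain 2 (cdisk 4) circle (disk 1) annulus (\<lambda>x. x) (\<lambda>_. 1) (\<lambda>x. 4 * sq x)"
    "continuity_condition 2 circle (disk 1) annulus (U N)"
    "flux_condition 2 circle (disk 1) annulus (\<lambda>x. x) (\<lambda>_. 1) (\<lambda>x. 4 * sq x) (U N)"
    "minus_Delta_eq 2 (disk 4) (pw_coeff (disk 1) annulus (\<lambda>_. 1) (\<lambda>x. 4 * sq x)) (U N) (\<lambda>x. lam * U N x)"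
    "bounded_meas (cdisk 4) (U N)" for N
  proof -
    obtain f' f'' g' g'' where t: "trapped_mode k lam (f N) f' f'' (g N) g' g''" using T by blast
    interpret trapped_mode k lam "f N" f' f'' "g N" g' g'' by (rule t)
    have "u = U N" by (rule ext) (simp add: u_eq U_def)
    thus "U N \<in> operator_domain 2 (cdisk 4) circle (disk 1) annulus (\<lambda>x. x) (\<lambda>_. 1) (\<lambda>x. 4 * sq x)"
      "continuity_condition 2 circle (disk 1) annulus (U N)"
      "flux_condition 2 circle (disk 1) annulus (\<lambda>x. x) (\<lambda>_. 1) (\<lambda>x. 4 * sq x) (U N)"
      "minus_Delta_eq 2 (disk 4) (pw_coeff (disk 1) annulus (\<lambda>_. 1) (\<lambda>x. 4 * sq x)) (U N) (\<lambda>x. lam * U N x)"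
      "bounded_meas (cdisk 4) (U N)"
      using operator_domain_u continuity_u flux_u minus_Delta_u bounded_meas_cdisk_u by simp_all
  qed
  have UN: "U N x = N * U 1 x" for N x by (simp add: U_def f_def g_def)
  have lamp: "lam > 0" using lam(1) k1 by (auto intro: order_le_less_trans[of 0 "real (k\<^sup>2)"])
  have "L2_norm 2 (cdisk 4) (U 1) \<noteq> 0"
  proof
    assume n0: "L2_norm 2 (cdisk 4) (U 1) = 0"
    have b2: "bounded_meas (cdisk 4) (\<lambda>x. (U 1 x)\<^sup>2)"
      unfolding power2_eq_square by (rule bounded_meas_mult[OF all(5) all(5)])
    have i2: "integrable (leb 2) (\<lambda>x. indicator (cdisk 4) x * (U 1 x)\<^sup>2)"
      using set_integrable_bounded_meas[OF bounded_dom_cdisk4 b2] by (simp add: set_integrable_def)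
    have "(\<integral>x. indicator (cdisk 4) x * (U 1 x)\<^sup>2 \<partial>leb 2) = 0"
      using n0 by (simp add: L2_norm_def set_lebesgue_integral_def)
    hence ae: "AE x in leb 2. indicator (cdisk 4) x * (U 1 x)\<^sup>2 = 0"
      using integral_nonneg_eq_0_iff_AE[OF i2] by simp
    \<comment> \<open>On the open unit disk the profile is positive because its argument stays below
      lam/4, so the mode vanishes only where Re (z^k) does. A null norm would make this nonempty
      open set a null set.\<close>
    define W where "W = {x \<in> Rn 2. sq x < 1} \<inter> {x \<in> Rn 2. rp k x \<noteq> 0}"
    have oW: "openin (Euclidean_space 2) W"
    proof -
      have c: "continuous_on (Rn 2) (rp k)" by (rule smooth_onD(2)[OF smooth_on_rp[OF openin_Rn2]])
      have "openin (top_of_set (Rn 2)) (Rn 2 \<inter> rp k -` (- {0}))"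
        by (rule continuous_openin_preimage_gen[OF c open_Compl[OF closed_singleton]])
      then obtain T where "open T" "Rn 2 \<inter> rp k -` (- {0}) = Rn 2 \<inter> T" unfolding openin_open by blast
      hence "openin (Euclidean_space 2) {x \<in> Rn 2. rp k x \<noteq> 0}"
        unfolding openin_Rn_iff by (intro exI[of _ T]) auto
      thus ?thesis unfolding W_def using openin_disk[of 1] by (intro openin_Int) (auto simp: disk_def)
    qed
    have "emb (1 / 2) \<in> W"
    proof -
      have "Complex (Re (1 / 2)) (Im (1 / 2)) = complex_of_real (1 / 2)" by (simp add: complex_eq_iff)
      hence "rp k (emb (1 / 2)) = Re (complex_of_real (1 / 2) ^ k)" by (simp add: rp_def emb_def)
      also have "\<dots> = (1 / 2) ^ k" by (simp only: of_real_power[symmetric] Re_complex_of_real)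
      finally have "rp k (emb (1 / 2)) \<noteq> 0" by simp
      moreover have "sq (emb (1 / 2)) < 1" by (simp add: sq_emb norm_divide power_divide)
      ultimately show ?thesis using emb_in_Rn by (simp add: W_def)
    qed
    hence "emeasure (leb 2) W \<noteq> 0" by (rule emeasure_leb_open_pos[OF oW])
    moreover have "AE x in leb 2. x \<notin> W"
      using ae
    proof eventually_elim
      case (elim x)
      show "x \<notin> W"
      proof
        assume x: "x \<in> W"
        hence s: "0 \<le> sq x" "sq x < 1" "x \<in> Rn 2" "rp k x \<noteq> 0" by (auto simp: W_def sq_nonneg)
        have "lam / 4 * sq x < lam / 4 * 1" using s lamp by (intro mult_strict_left_mono) auto
        hence "bes k (lam / 4 * sq x) > 0" using lamp s by (intro lam(3)) auto
        hence "U 1 x \<noteq> 0" using s by (simp add: U_def f_def)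
        moreover have "x \<in> cdisk 4" using s by (simp add: cdisk_def)
        ultimately show False using elim by simp
      qed
    qed
    hence "W \<in> null_sets (leb 2)" using sets_leb[OF openin_Rn_borel[OF oW]] by (subst AE_iff_null_sets) auto
    ultimately show False by auto
  qed
  moreover have "0 \<le> L2_norm 2 (cdisk 4) (U 1)" unfolding L2_norm_def
    by (rule real_sqrt_ge_zero) (simp add: set_lebesgue_integral_def integral_nonneg_AE)
  ultimately have np: "0 < L2_norm 2 (cdisk 4) (U 1)" by simp
  define N where "N = 1 / L2_norm 2 (cdisk 4) (U 1)"
  have N: "N > 0" using np by (simp add: N_def)
  have "L2_norm 2 (cdisk 4) (U N) = N * L2_norm 2 (cdisk 4) (U 1)"
  proof -
    have "(LINT x:cdisk 4|leb 2. (U N x)\<^sup>2) = (LINT x:cdisk 4|leb 2. N\<^sup>2 * (U 1 x)\<^sup>2)"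
      by (rule set_integral_cong_on) (simp add: UN[of N] power_mult_distrib)
    also have "\<dots> = N\<^sup>2 * (LINT x:cdisk 4|leb 2. (U 1 x)\<^sup>2)" by simp
    finally show ?thesis using N by (simp add: L2_norm_def real_sqrt_mult)
  qed
  hence n1: "L2_norm 2 (cdisk 4) (U N) = 1" using np by (simp add: N_def)
  have inner: "\<bar>U N x\<bar> \<le> exp (- \<kappa> * \<theta>) * \<bar>U N (\<lambda>i. exp \<theta> * x i)\<bar>"
    if \<theta>: "\<theta> > 0" and \<kappa>: "\<kappa> \<ge> 0" "lam * exp (- 2 * \<theta>) \<le> real (k\<^sup>2) - \<kappa>\<^sup>2" and x: "x \<in> inner_part \<theta>" for \<theta> \<kappa> x
  proof -
    define s where "s = sq x"
    have s: "0 \<le> s" "s \<le> exp (- 4 * \<theta>)" using x by (auto simp: s_def inner_part_def sq_nonneg)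
    define y where "y = lam / 4 * s"
    have ee: "exp (2 * \<theta>) * s \<le> exp (- 2 * \<theta>)"
    proof -
      have "exp (2 * \<theta>) * s \<le> exp (2 * \<theta>) * exp (- 4 * \<theta>)" using s by (intro mult_left_mono) auto
      thus ?thesis by (simp flip: exp_add)
    qed
    have e1: "exp (- 2 * \<theta>) < 1" "exp (- 4 * \<theta>) < 1" using \<theta> by simp_all
    have bpos: "0 < bes k z" if "0 \<le> z" "z \<le> y * exp (2 * \<theta>)" for z
    proof (rule lam(3))
      have "y * exp (2 * \<theta>) = lam / 4 * (exp (2 * \<theta>) * s)" by (simp add: y_def)
      also have "\<dots> \<le> lam / 4 * exp (- 2 * \<theta>)" using ee lamp by (intro mult_left_mono) auto
      also have "\<dots> < lam / 4 * 1" using e1 lamp by (intro mult_strict_left_mono) auto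
      finally show "z < lam / 4" using that(2) by simp
    qed (rule that)
    have main: "bes k y * \<bar>rp k x\<bar> \<le> exp (- \<kappa> * \<theta>) * (bes k (y * exp (2 * \<theta>)) * (exp \<theta> ^ k * \<bar>rp k x\<bar>))"
    \<comment> \<open>At the origin Re (z^k) vanishes since k \<ge> 1; the growth estimate below
      asks for a positive c.\<close>
    proof (cases "s = 0")
      case True
      hence "x 0 = 0" "x 1 = 0" using sum_power2_eq_zero_iff[of "x 0" "x 1"] by (auto simp: s_def sq_def)
      hence "Complex (x 0) (x 1) = 0" by (simp add: complex_eq_iff)
      hence "rp k x = 0" using k1 by (simp add: rp_def zero_power)
      thus ?thesis by simp
    next
      case False
      \<comment> \<open>With this c the dilated point corresponds to t = 0 and x itself to t =
        -\<theta> in the logarithmic variable, and the hypothesis on \<kappa> becomes 4 c \<le> k^2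
        - \<kappa>^2.\<close>
      define c where "c = y * exp (2 * \<theta>)"
      have c: "c > 0" using False s lamp by (simp add: c_def y_def)
      have c4: "4 * c \<le> real (k\<^sup>2) - \<kappa>\<^sup>2"
      proof -
        have "4 * c = lam * (exp (2 * \<theta>) * s)" by (simp add: c_def y_def)
        also have "\<dots> \<le> lam * exp (- 2 * \<theta>)" using ee lamp by (intro mult_left_mono) auto
        finally show ?thesis using \<kappa>(2) by simp
      qed
      have "besg k c (- \<theta>) \<le> exp (\<kappa> * (- \<theta>)) * besg k c 0"
        using \<theta> c4 bpos by (intro besg_growth[OF \<kappa>(1) k1 c]) (auto simp: c_def less_imp_le)
      moreover have "c * exp (2 * (- \<theta>)) = y" by (simp add: c_def mult.assoc flip: exp_add)
      ultimately have "exp (k * (- \<theta>)) * bes k y \<le> exp (- \<kappa> * \<theta>) * bes k c" by (simp add: besg_def)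
      hence le: "exp (k * \<theta>) * (exp (k * (- \<theta>)) * bes k y) \<le> exp (k * \<theta>) * (exp (- \<kappa> * \<theta>) * bes k c)"
        by (intro mult_left_mono) auto
      have "bes k y = exp (k * \<theta>) * (exp (k * (- \<theta>)) * bes k y)" by (simp add: mult.assoc[symmetric] flip: exp_add)
      also note le
      also have "exp (k * \<theta>) * (exp (- \<kappa> * \<theta>) * bes k c) = exp (- \<kappa> * \<theta>) * (bes k c * exp (k * \<theta>))"
        by (simp only: mult_ac)
      finally have "bes k y \<le> exp (- \<kappa> * \<theta>) * (bes k c * exp (k * \<theta>))" .
      hence "bes k y * \<bar>rp k x\<bar> \<le> exp (- \<kappa> * \<theta>) * (bes k c * exp (k * \<theta>)) * \<bar>rp k x\<bar>"
        by (intro mult_right_mono) auto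
      thus ?thesis by (simp add: c_def mult_ac flip: exp_of_nat_mult)
    qed
    have ly: "lam / 4 * ((exp \<theta>)\<^sup>2 * s) = y * exp (2 * \<theta>)" by (simp add: y_def power2_eq_square flip: exp_add)
    have l1: "(exp \<theta>)\<^sup>2 * s \<le> 1"
    proof -
      have "(exp \<theta>)\<^sup>2 * s = exp (2 * \<theta>) * s" by (simp add: power2_eq_square flip: exp_add)
      thus ?thesis using ee e1(1) by linarith
    qed
    have U2: "U N (\<lambda>i. exp \<theta> * x i) = N * bes k (y * exp (2 * \<theta>)) * (exp \<theta> ^ k * rp k x)"
      unfolding U_def f_def sq_scale rp_scale s_def[symmetric] ly using l1 by simp
    have "s \<le> 1" using s(2) e1(2) by linarith
    hence U1: "U N x = N * bes k y * rp k x" by (simp add: U_def f_def s_def[symmetric] y_def)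
    have y0: "0 \<le> y" using lamp s by (simp add: y_def)
    have "y \<le> y * exp (2 * \<theta>)" using y0 \<theta> mult_left_mono[of 1 "exp (2 * \<theta>)" y] by simp
    hence b: "0 < bes k y" "0 < bes k (y * exp (2 * \<theta>))" using bpos y0 by auto
    have "\<bar>U N x\<bar> = N * (bes k y * \<bar>rp k x\<bar>)" unfolding U1 using N b by (simp add: abs_mult)
    also have "\<dots> \<le> N * (exp (- \<kappa> * \<theta>) * (bes k (y * exp (2 * \<theta>)) * (exp \<theta> ^ k * \<bar>rp k x\<bar>)))"
      using main N by (intro mult_left_mono) auto
    also have "\<dots> = exp (- \<kappa> * \<theta>) * \<bar>U N (\<lambda>i. exp \<theta> * x i)\<bar>" unfolding U2 using N b by (simp add: abs_mult)
    finally show ?thesis .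
  qed
  have kp: "real k / 2 \<le> \<kappa>0" "0 < \<kappa>0"
  proof -
    have k0: "0 \<le> real (k\<^sup>2)" by simp
    have "(real k / 2)\<^sup>2 = real (k\<^sup>2) / 4" by (simp add: power_divide)
    also have "\<dots> \<le> real (k\<^sup>2) + 1 - lam / 4" using lam(2) k0 by linarith
    finally have "real k / 2 \<le> sqrt (real (k\<^sup>2) + 1 - lam / 4)" by (rule real_le_rsqrt)
    thus "real k / 2 \<le> \<kappa>0" by (simp add: \<kappa>0_def add.commute)
    thus "0 < \<kappa>0" using k by linarith
  qed
  have \<alpha>0: "0 \<le> \<alpha>" unfolding \<alpha>_def using lam(4) kp(2) by (intro divide_nonneg_pos) auto
  have outer: "\<bar>U N x\<bar> \<le> exp (- real k * \<theta> / 2) * \<bar>U N (\<lambda>i. exp (- \<theta>) * x i)\<bar>"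
    if \<theta>: "\<theta> > 0" and x: "x \<in> outer_part \<theta>" for \<theta> x
  proof -
    define s where "s = sq x"
    define t where "t = s * exp (- 2 * \<theta>)"
    have s: "exp (2 * \<theta>) \<le> s" "s \<le> 4" using x by (auto simp: s_def outer_part_def)
    have e1: "1 < exp (2 * \<theta>)" using \<theta> by simp
    hence s1: "1 < s" using s by linarith
    have t1: "1 \<le> t"
    proof -
      have "exp (2 * \<theta>) * exp (- 2 * \<theta>) \<le> t" unfolding t_def using s by (intro mult_right_mono) auto
      thus ?thesis by (simp flip: exp_add)
    qed
    have t4: "t \<le> 4"
    proof -
      have "t \<le> s * 1" unfolding t_def using s1 \<theta> by (intro mult_left_mono) auto
      thus ?thesis using s by simp
    qed
    have tt: "(exp (- \<theta>))\<^sup>2 * s = t" by (simp add: t_def power2_eq_square flip: exp_add)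
    \<comment> \<open>The contracted point may lie on the circle, where \<open>U\<close> uses the
      inner profile; continuity lets the outer one be used there too.\<close>
    have g1: "(if t \<le> 1 then f N t else g N t) = g N t"
    proof (cases "t \<le> 1")
      case True
      hence [simp]: "t = 1" using t1 by simp
      have "sinh (\<kappa>0 * ln 2) > 0" using kp by simp
      thus ?thesis using kp(2) by (auto simp: f_def g_def shp_1 \<alpha>_def)
    qed simp
    have U1: "U N x = g N s * rp k x" using s1 by (simp add: U_def s_def)
    have U2: "U N (\<lambda>i. exp (- \<theta>) * x i) = g N t * (exp (- \<theta>) ^ k * rp k x)"
      unfolding U_def sq_scale rp_scale s_def[symmetric] tt g1 by simp
    have sh: "0 \<le> shp \<kappa>0 k s" "shp \<kappa>0 k s \<le> exp (- (\<kappa>0 + 1 + real k) * \<theta>) * shp \<kappa>0 k t"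
      using shp_decay[of \<kappa>0 \<theta> s k] kp \<theta> s s1 by (auto simp: t_def)
    have sht: "0 \<le> shp \<kappa>0 k t" using shp_decay(1)[of \<kappa>0 \<theta> t k] kp \<theta> t1 t4 by auto
    \<comment> \<open>The factor exp (-\<theta>)^k reappears from the homogeneity of Re (z^k) at the
      contracted point. What is left is exp (-\<kappa>0 \<theta>) and a spare exp (-\<theta>), and
      \<kappa>0 \<ge> k/2.\<close>
    have ex: "exp (- (\<kappa>0 + 1 + real k) * \<theta>) \<le> exp (- real k * \<theta> / 2) * exp (- \<theta>) ^ k"
    proof -
      have "real k / 2 * \<theta> \<le> \<kappa>0 * \<theta>" using kp \<theta> by (intro mult_right_mono) auto
      moreover have "- (\<kappa>0 + 1 + real k) * \<theta> = - (\<kappa>0 * \<theta>) - \<theta> - real k * \<theta>"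
        "- real k * \<theta> / 2 + real k * (- \<theta>) = - (real k / 2 * \<theta>) - real k * \<theta>" by (simp_all add: algebra_simps)
      ultimately have "- (\<kappa>0 + 1 + real k) * \<theta> \<le> - real k * \<theta> / 2 + real k * (- \<theta>)" using \<theta> by linarith
      hence "exp (- (\<kappa>0 + 1 + real k) * \<theta>) \<le> exp (- real k * \<theta> / 2 + real k * (- \<theta>))" by (simp only: exp_le_cancel_iff)
      thus ?thesis by (simp only: exp_add exp_of_nat_mult)
    qed
    have "\<bar>U N x\<bar> = N * \<alpha> * \<bar>rp k x\<bar> * shp \<kappa>0 k s" unfolding U1 g_def using N \<alpha>0 sh by (simp add: abs_mult)
    also have "\<dots> \<le> N * \<alpha> * \<bar>rp k x\<bar> * (exp (- real k * \<theta> / 2) * exp (- \<theta>) ^ k * shp \<kappa>0 k t)"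
      using N \<alpha>0 order_trans[OF sh(2) mult_right_mono[OF ex sht]] by (intro mult_left_mono) auto
    also have "\<dots> = exp (- real k * \<theta> / 2) * \<bar>U N (\<lambda>i. exp (- \<theta>) * x i)\<bar>"
      unfolding U2 g_def using N \<alpha>0 sht by (simp add: abs_mult)
    finally show ?thesis .
  qed
  show ?thesis
    using lam(1,2,5) all[of N] n1 inner outer by (intro exI[of _ lam] exI[of _ "U N"] conjI) blast+
qed

section \<open>Uniform constants for a set away from the circle\<close>

lemma away_from_circle:
  assumes \<omega>: "\<omega> \<subseteq> cdisk 4" and d: "eset_dist 2 (Euclidean_space 2 closure_of \<omega>) circle > 0"
  shows "\<exists>\<theta>>0. \<omega> \<subseteq> inner_part \<theta> \<union> outer_part \<theta>"
proof -
  \<comment> \<open>The distance is infinite for an empty set; the cap at 1 makes it real and also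
    ensures \<delta> \<le> 1, which covers the origin.\<close>
  define D where "D = min (eset_dist 2 (Euclidean_space 2 closure_of \<omega>) circle) 1"
  define \<delta> where "\<delta> = enn2real D"
  have D1: "D \<le> 1" by (simp add: D_def)
  hence "D < top" by (rule le_less_trans) simp
  hence Df: "D \<noteq> top" "D > 0" "D \<le> 1" using d D1 by (auto simp: D_def)
  have D: "D = ennreal \<delta>" unfolding \<delta>_def using Df(1) by (simp add: less_top)
  have \<delta>: "0 < \<delta>" "\<delta> \<le> 1" using Df D by (auto simp: ennreal_le_1)
  have far: "\<delta> \<le> \<bar>sqrt (sq x) - 1\<bar>" if x: "x \<in> \<omega>" and s: "sq x > 0" for x
  proof -
    define r where "r = sqrt (sq x)"
    have r: "r > 0" "r\<^sup>2 = sq x" using s by (auto simp: r_def)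
    \<comment> \<open>The radial projection of x to the circle, at distance exactly the difference
      of the radii.\<close>
    define y where "y = (\<lambda>i. 1 / r * x i)"
    have xR: "x \<in> Rn 2" using x \<omega> by (auto simp: cdisk_def)
    have y: "y \<in> circle"
    proof -
      have "sq y = (1 / r)\<^sup>2 * r\<^sup>2" unfolding y_def r(2) by (rule sq_scale)
      also have "\<dots> = 1" using r(1) by (simp add: power_divide)
      finally show ?thesis using xR by (simp add: circle_def y_def Rn_iff)
    qed
    have "\<omega> \<subseteq> topspace (Euclidean_space 2)" using \<omega> by (auto simp: cdisk_def)
    hence xc: "x \<in> Euclidean_space 2 closure_of \<omega>" using closure_of_subset x by blast
    have "edist 2 x y = sqrt ((1 - 1 / r)\<^sup>2 * sq x)"
      by (simp add: edist_def L2_set_2 y_def sq_def algebra_simps power2_eq_square)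
    also have "\<dots> = \<bar>(1 - 1 / r) * r\<bar>" unfolding r(2)[symmetric] by (simp flip: power_mult_distrib)
    also have "(1 - 1 / r) * r = r - 1" using r by (simp add: field_simps)
    finally have e: "edist 2 x y = \<bar>r - 1\<bar>" .
    have "D \<le> eset_dist 2 (Euclidean_space 2 closure_of \<omega>) circle" by (simp add: D_def)
    also have "\<dots> \<le> ennreal (edist 2 x y)"
      unfolding eset_dist_def by (rule INF_lower2[OF xc INF_lower2[OF y order_refl]])
    finally have "ennreal \<delta> \<le> ennreal \<bar>r - 1\<bar>" unfolding D e .
    thus ?thesis by (simp add: r_def)
  qed
  show ?thesis
  \<comment> \<open>With \<theta> = \<delta>/4, radii up to 1 - \<delta> have square at most exp
    (-\<delta>) = exp (-4 \<theta>), and radii from 1 + \<delta> on have square at least exp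
    (\<delta>/2) = exp (2 \<theta>).\<close>
  proof (intro exI[of _ "\<delta> / 4"] conjI subsetI)
    show "0 < \<delta> / 4" using \<delta> by simp
    fix x assume x: "x \<in> \<omega>"
    have xR: "x \<in> Rn 2" "sq x \<le> 4" using x \<omega> by (auto simp: cdisk_def)
    define r where "r = sqrt (sq x)"
    have r: "0 \<le> r" "r\<^sup>2 = sq x" using sq_nonneg[of x] by (auto simp: r_def)
    consider "r \<le> 1 - \<delta>" | "r \<ge> 1 + \<delta>"
      using far[OF x] sq_nonneg[of x] \<delta> by (cases "sq x = 0") (auto simp: r_def abs_if split: if_splits)
    thus "x \<in> inner_part (\<delta> / 4) \<union> outer_part (\<delta> / 4)"
    proof cases
      case 1
      have "sq x \<le> (1 - \<delta>)\<^sup>2" unfolding r(2)[symmetric] using 1 r(1) by (rule power_mono)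
      also have "\<dots> \<le> 1 - \<delta>" using \<delta> unfolding power2_eq_square by (intro mult_left_le) auto
      also have "\<dots> \<le> exp (- \<delta>)" using exp_ge_add_one_self[of "- \<delta>"] by simp
      finally show ?thesis using xR(1) by (simp add: inner_part_def)
    next
      case 2
      have "exp (\<delta> / 2) \<le> 1 + \<delta> / 2 + (\<delta> / 2)\<^sup>2" using \<delta> by (intro exp_bound) auto
      also have "(\<delta> / 2)\<^sup>2 \<le> \<delta> / 2" using \<delta> unfolding power2_eq_square by (intro mult_left_le) auto
      also have "1 + \<delta> / 2 + \<delta> / 2 \<le> (1 + \<delta>)\<^sup>2" using \<delta> by (simp add: power2_eq_square algebra_simps)
      also have "\<dots> \<le> sq x" unfolding r(2)[symmetric] using 2 \<delta> by (intro power_mono) auto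
      finally have "exp (\<delta> / 2) \<le> sq x" by simp
      thus ?thesis using xR by (simp add: outer_part_def)
    qed
  qed
qed

theorem theorem1p1:
  shows "\<exists>(n0::nat) M S \<Omega>m \<Omega>p \<nu> cm cp.
    n0 \<ge> 1 \<and>
    transmission_geometry n0 M S \<Omega>m \<Omega>p \<nu> \<and>
    transmission_coefficient n0 S \<Omega>m \<Omega>p cm cp \<and>
    (\<exists>(lam :: nat \<Rightarrow> real) (u :: nat \<Rightarrow> pt \<Rightarrow> real).
      filterlim lam at_top sequentially \<and>
      (\<forall>n. u n \<in> operator_domain n0 M S \<Omega>m \<Omega>p \<nu> cm cp \<and>
           continuity_condition n0 S \<Omega>m \<Omega>p (u n) \<and>
           flux_condition n0 S \<Omega>m \<Omega>p \<nu> cm cp (u n)) \<and>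
      (\<forall>\<omega>. \<omega> \<subseteq> M \<and> \<omega> \<in> sets (leb n0) \<and>
           eset_dist n0 (Euclidean_space n0 closure_of \<omega>) S > 0 \<longrightarrow>
        (\<exists>C d. C > 0 \<and> d > 0 \<and>
          (\<forall>n. L2_norm n0 \<omega> (u n) \<le> C * exp (- d * sqrt (lam n)) \<and>
               minus_Delta_eq n0 (Euclidean_space n0 interior_of M)
                 (pw_coeff \<Omega>m \<Omega>p cm cp) (u n) (\<lambda>x. lam n * u n x) \<and>
               L2_norm n0 M (u n) = 1))))"
proof -
  define K where "K n = n + 256" for n :: nat
  define P where "P n l v \<longleftrightarrow> real ((K n)\<^sup>2) < l \<and> l \<le> 3 / 2 * real ((K n)\<^sup>2) \<and>
    (\<forall>\<epsilon>::real. 0 < \<epsilon> \<and> \<epsilon> \<le> 1/2 \<and> 8 * pi \<le> K n * \<epsilon> * sqrt \<epsilon> \<longrightarrow> l \<le> (K n)\<^sup>2 * (1 + \<epsilon>)) \<and>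
    v \<in> operator_domain 2 (cdisk 4) circle (disk 1) annulus (\<lambda>x. x) (\<lambda>_. 1) (\<lambda>x. 4 * sq x) \<and>
    continuity_condition 2 circle (disk 1) annulus v \<and>
    flux_condition 2 circle (disk 1) annulus (\<lambda>x. x) (\<lambda>_. 1) (\<lambda>x. 4 * sq x) v \<and>
    minus_Delta_eq 2 (disk 4) (pw_coeff (disk 1) annulus (\<lambda>_. 1) (\<lambda>x. 4 * sq x)) v (\<lambda>x. l * v x) \<and>
    bounded_meas (cdisk 4) v \<and> L2_norm 2 (cdisk 4) v = 1 \<and>
    (\<forall>\<theta>>0. \<forall>\<kappa>\<ge>0. l * exp (- 2 * \<theta>) \<le> real ((K n)\<^sup>2) - \<kappa>\<^sup>2 \<longrightarrow>
       (\<forall>x\<in>inner_part \<theta>. \<bar>v x\<bar> \<le> exp (- \<kappa> * \<theta>) * \<bar>v (\<lambda>i. exp \<theta> * x i)\<bar>)) \<and>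
    (\<forall>\<theta>>0. \<forall>x\<in>outer_part \<theta>. \<bar>v x\<bar> \<le> exp (- real (K n) * \<theta> / 2) * \<bar>v (\<lambda>i. exp (- \<theta>) * x i)\<bar>)" for n :: nat and l :: real and v :: "pt \<Rightarrow> real"
  have "\<exists>l v. P n l v" for n
    unfolding P_def by (rule normalized_mode_exists) (simp add: K_def)
  then obtain lam :: "nat \<Rightarrow> real" and u :: "nat \<Rightarrow> pt \<Rightarrow> real" where P: "\<And>n. P n (lam n) (u n)"
    by metis
  note Q = P[unfolded P_def]
  have lam: "\<And>n. real ((K n)\<^sup>2) < lam n" "\<And>n. lam n \<le> 3 / 2 * real ((K n)\<^sup>2)"
      "\<And>n (\<epsilon> :: real). 0 < \<epsilon> \<Longrightarrow> \<epsilon> \<le> 1/2 \<Longrightarrow> 8 * pi \<le> K n * \<epsilon> * sqrt \<epsilon> \<Longrightarrow> lam n \<le> (K n)\<^sup>2 * (1 + \<epsilon>)" and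
    u: "\<And>n. u n \<in> operator_domain 2 (cdisk 4) circle (disk 1) annulus (\<lambda>x. x) (\<lambda>_. 1) (\<lambda>x. 4 * sq x)"
      "\<And>n. continuity_condition 2 circle (disk 1) annulus (u n)"
      "\<And>n. flux_condition 2 circle (disk 1) annulus (\<lambda>x. x) (\<lambda>_. 1) (\<lambda>x. 4 * sq x) (u n)"
      "\<And>n. minus_Delta_eq 2 (disk 4) (pw_coeff (disk 1) annulus (\<lambda>_. 1) (\<lambda>x. 4 * sq x)) (u n) (\<lambda>x. lam n * u n x)"
      "\<And>n. bounded_meas (cdisk 4) (u n)" "\<And>n. L2_norm 2 (cdisk 4) (u n) = 1" and
    decay: "\<And>n \<theta> \<kappa> x. \<theta> > 0 \<Longrightarrow> \<kappa> \<ge> 0 \<Longrightarrow> lam n * exp (- 2 * \<theta>) \<le> real ((K n)\<^sup>2) - \<kappa>\<^sup>2 \<Longrightarrow> x \<in> inner_part \<theta> \<Longrightarrow>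
        \<bar>u n x\<bar> \<le> exp (- \<kappa> * \<theta>) * \<bar>u n (\<lambda>i. exp \<theta> * x i)\<bar>"
      "\<And>n \<theta> x. \<theta> > 0 \<Longrightarrow> x \<in> outer_part \<theta> \<Longrightarrow>
        \<bar>u n x\<bar> \<le> exp (- real (K n) * \<theta> / 2) * \<bar>u n (\<lambda>i. exp (- \<theta>) * x i)\<bar>"
    using Q by blast+
  have lim: "filterlim lam at_top sequentially"
  proof (rule filterlim_at_top_mono[OF filterlim_real_sequentially], intro always_eventually allI)
    fix n
    have "n \<le> K n * 1" by (simp add: K_def)
    also have "\<dots> \<le> (K n)\<^sup>2" unfolding power2_eq_square by (intro mult_left_mono) (auto simp: K_def)
    finally have "real n \<le> real ((K n)\<^sup>2)" by (simp only: of_nat_le_iff)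
    thus "real n \<le> lam n" using lam(1)[of n] by linarith
  qed
  have sl: "sqrt (lam n) \<le> 2 * real (K n)" for n
  proof (rule real_le_lsqrt)
    show "lam n \<le> (2 * real (K n))\<^sup>2"
    proof -
      have "0 \<le> real ((K n)\<^sup>2)" by simp
      hence "lam n \<le> 4 * real ((K n)\<^sup>2)" using lam(2)[of n] by linarith
      thus ?thesis by (simp add: power_mult_distrib)
    qed
  qed simp
  have bound: "\<exists>C d. C > 0 \<and> d > 0 \<and> (\<forall>n. L2_norm 2 \<omega> (u n) \<le> C * exp (- d * sqrt (lam n)))"
    if \<omega>: "\<omega> \<subseteq> cdisk 4" "\<omega> \<in> sets (leb 2)" "eset_dist 2 (Euclidean_space 2 closure_of \<omega>) circle > 0" for \<omega>
  proof -
    obtain \<theta> where \<theta>: "\<theta> > 0" and sub: "\<omega> \<subseteq> inner_part \<theta> \<union> outer_part \<theta>"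
      using away_from_circle[OF \<omega>(1,3)] by blast
    \<comment> \<open>The numbers \<epsilon> and \<eta> share the gap between exp (-2 \<theta>) and
      1: the midpoint (1 + exp (-2 \<theta>))/2 equals 1 - \<eta>^2 and bounds (1 + \<epsilon>) exp
      (-2 \<theta>). Then \<kappa> = \<eta> k is admissible as soon as lam \<le> k^2 (1 +
      \<epsilon>).\<close>
    define \<eta> where "\<eta> = sqrt ((1 - exp (- 2 * \<theta>)) / 2)"
    define \<epsilon> where "\<epsilon> = min (1 / 2) ((exp (2 * \<theta>) - 1) / 2)"
    have e: "exp (- 2 * \<theta>) < 1" "exp (2 * \<theta>) > 1" using \<theta> by simp_all
    have "0 < \<epsilon>" using e(2) by (simp add: \<epsilon>_def)
    moreover have "\<epsilon> \<le> 1 / 2" "\<epsilon> \<le> (exp (2 * \<theta>) - 1) / 2"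
      unfolding \<epsilon>_def by (rule min.cobounded1, rule min.cobounded2)
    ultimately have \<epsilon>: "0 < \<epsilon>" "\<epsilon> \<le> 1 / 2" "\<epsilon> \<le> (exp (2 * \<theta>) - 1) / 2" by blast+
    have \<eta>: "\<eta> > 0" "\<eta>\<^sup>2 = (1 - exp (- 2 * \<theta>)) / 2" using e by (auto simp: \<eta>_def)
    have gap: "(1 + \<epsilon>) * exp (- 2 * \<theta>) \<le> 1 - \<eta>\<^sup>2"
    proof -
      have "(1 + \<epsilon>) * exp (- 2 * \<theta>) \<le> (1 + (exp (2 * \<theta>) - 1) / 2) * exp (- 2 * \<theta>)"
        using \<epsilon>(3) by (intro mult_right_mono) auto
      also have "\<dots> = (exp (- 2 * \<theta>) + exp (2 * \<theta>) * exp (- 2 * \<theta>)) / 2" by (simp add: field_simps)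
      also have "exp (2 * \<theta>) * exp (- 2 * \<theta>) = 1" by (simp flip: exp_add)
      finally show ?thesis unfolding \<eta>(2) by (simp add: field_simps)
    qed
    \<comment> \<open>From this index on the Sturm bound applies with the chosen \<epsilon>.\<close>
    define K0 where "K0 = 8 * pi / (\<epsilon> * sqrt \<epsilon>)"
    \<comment> \<open>The worse of the inner rate \<theta> \<eta> and the outer rate
      \<theta>/2.\<close>
    define d0 where "d0 = \<theta> * min \<eta> (1 / 2)"
    have d0: "d0 > 0" using \<theta> \<eta> by (simp add: d0_def)
    \<comment> \<open>1 + exp \<theta> comes from the inner and outer parts, the Jacobian of the
      contraction giving exp \<theta>; the last summand absorbs the finitely many indices below
      \<open>K0\<close>, where the norm is at most 1.\<close>
    define C where "C = 1 + exp \<theta> + exp (d0 * K0)"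
    have C: "C > 0" by (simp add: C_def add_pos_pos)
    have "L2_norm 2 \<omega> (u n) \<le> C * exp (- d0 * real (K n))" for n
    proof (cases "K0 \<le> real (K n)")
      case True
      have "0 < \<epsilon> * sqrt \<epsilon>" using \<epsilon>(1) by simp
      hence "8 * pi \<le> K n * \<epsilon> * sqrt \<epsilon>" using True by (simp add: K0_def pos_divide_le_eq mult.assoc)
      hence "lam n \<le> (K n)\<^sup>2 * (1 + \<epsilon>)" using \<epsilon> by (intro lam(3)) auto
      hence "lam n * exp (- 2 * \<theta>) \<le> (K n)\<^sup>2 * (1 + \<epsilon>) * exp (- 2 * \<theta>)" by (intro mult_right_mono) auto
      also have "\<dots> = real ((K n)\<^sup>2) * ((1 + \<epsilon>) * exp (- 2 * \<theta>))" by simp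
      also have "\<dots> \<le> real ((K n)\<^sup>2) * (1 - \<eta>\<^sup>2)" by (rule mult_left_mono[OF gap]) simp
      also have "\<dots> = real ((K n)\<^sup>2) - (\<eta> * K n)\<^sup>2" by (simp add: algebra_simps power_mult_distrib)
      finally have l: "lam n * exp (- 2 * \<theta>) \<le> real ((K n)\<^sup>2) - (\<eta> * K n)\<^sup>2" .
      have "L2_norm 2 \<omega> (u n) \<le> exp (- (\<eta> * K n) * \<theta>) + exp \<theta> * exp (- real (K n) * \<theta> / 2)"
        using \<theta> \<eta>(1)
        by (intro L2_norm_le_inner_outer[OF u(5,6) _ \<omega>(2) sub] decay(1)[OF _ _ l] decay(2)) auto
      also have "\<dots> \<le> exp (- d0 * real (K n)) + exp \<theta> * exp (- d0 * real (K n))"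
      proof (intro add_mono mult_left_mono)
        have "d0 * real (K n) \<le> \<theta> * \<eta> * real (K n)" "d0 * real (K n) \<le> \<theta> * (1 / 2) * real (K n)"
          unfolding d0_def using \<theta> by (intro mult_right_mono mult_left_mono; simp)+
        thus "exp (- (\<eta> * K n) * \<theta>) \<le> exp (- d0 * real (K n))"
          "exp (- real (K n) * \<theta> / 2) \<le> exp (- d0 * real (K n))" by (simp_all add: mult_ac)
      qed simp
      also have "\<dots> = (1 + exp \<theta>) * exp (- d0 * real (K n))" by (simp add: algebra_simps)
      also have "\<dots> \<le> C * exp (- d0 * real (K n))" by (intro mult_right_mono) (auto simp: C_def)
      finally show ?thesis .
    next
      case False
      have "L2_norm 2 \<omega> (u n) \<le> 1" using L2_norm_subset_le[OF u(5) \<omega>(2,1)] u(6) by metis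
      also have "1 = exp (d0 * real (K n)) * exp (- d0 * real (K n))" by (simp flip: exp_add)
      also have "\<dots> \<le> exp (d0 * K0) * exp (- d0 * real (K n))"
        using False d0 by (intro mult_right_mono) auto
      also have "\<dots> \<le> C * exp (- d0 * real (K n))" by (intro mult_right_mono) (auto simp: C_def add_nonneg_nonneg)
      finally show ?thesis .
    qed
    \<comment> \<open>Passage from the angular frequency to the eigenvalue: sqrt lam \<le> 2 K costs
      half of the rate.\<close>
    moreover have "C * exp (- d0 * real (K n)) \<le> C * exp (- (d0 / 2) * sqrt (lam n))" for n
    proof -
      have "d0 / 2 * sqrt (lam n) \<le> d0 / 2 * (2 * real (K n))" using sl d0 by (intro mult_left_mono) auto
      thus ?thesis using C by simp
    qed
    ultimately have "\<forall>n. L2_norm 2 \<omega> (u n) \<le> C * exp (- (d0 / 2) * sqrt (lam n))"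
      by (meson order_trans)
    moreover have "d0 / 2 > 0" using d0 by simp
    ultimately show ?thesis using C by blast
  qed
  show ?thesis
  proof (rule exI[of _ 2], rule exI[of _ "cdisk 4"], rule exI[of _ circle], rule exI[of _ "disk 1"],
      rule exI[of _ annulus], rule exI[of _ "\<lambda>x. x"], rule exI[of _ "\<lambda>_. 1"], rule exI[of _ "\<lambda>x. 4 * sq x"],
      intro conjI, simp, rule disk_geometry, rule disk_coefficient,
      rule exI[of _ lam], rule exI[of _ u], intro conjI allI impI)
    fix \<omega> assume "\<omega> \<subseteq> cdisk 4 \<and> \<omega> \<in> sets (leb 2) \<and> 0 < eset_dist 2 (Euclidean_space 2 closure_of \<omega>) circle"
    then obtain C d where "C > 0" "d > 0" "\<forall>n. L2_norm 2 \<omega> (u n) \<le> C * exp (- d * sqrt (lam n))"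
      using bound by blast
    thus "\<exists>C d. C > 0 \<and> d > 0 \<and> (\<forall>n. L2_norm 2 \<omega> (u n) \<le> C * exp (- d * sqrt (lam n)) \<and>
         minus_Delta_eq 2 (Euclidean_space 2 interior_of cdisk 4)
           (pw_coeff (disk 1) annulus (\<lambda>_. 1) (\<lambda>x. 4 * sq x)) (u n) (\<lambda>x. lam n * u n x) \<and>
         L2_norm 2 (cdisk 4) (u n) = 1)"
      using u(4,6) by (intro exI[of _ C] exI[of _ d]) (simp add: interior_cdisk)
  qed (rule lim u)+
qed

end
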